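(* Let $G$ be a countably infinite group (not necessarily sofic), let $K$ be a finite abelian group, identify $K$ with the subgroup of constant functions in $K^G$, and let $\lambda$ denote the Haar probability measure on $K^G/K$. Then $$h^{\mathrm{Rok}}(G\curvearrowright K^G/K,\lambda)\le\mathcal{C}_{\sup}(G)\cdot\log|K|.$$
   Context: Shift action: $K^G$ has the product topology ($K$ discrete) and $G$ acts by $(g\cdot x)(h)=x(g^{-1}h)$; this induces an action by continuous automorphisms on $K^G/K$. Cost: For a probability-measure-preserving (p.m.p.) action $G\curvearrowright(X,\mu)$ on a standard probability space let $\mathcal{R}$ be its orbit equivalence relation. A graphing of $\mathcal{R}$ is a countable collection $\Phi=\{\phi_i:A_i\to B_i\}$ of Borel bijections between Borel subsets of $X$ such that, on a conull set, $\mathcal{R}$ equals the smallest equivalence relation containing all pairs $(x,\phi_i(x))$, $x\in A_i$; its cost is $\sum_i\mu(A_i)$. The cost of $\mathcal{R}$ is the infimum of the costs of its graphings. $\mathcal{C}_{\sup}(G)\in[0,\infty]$ is the supremum of the costs of the orbit equivalence relations of all free p.m.p. actions of $G$. Convention: $\infty\cdot0=0$ (relevant only when $K$ is trivial). Rokhlin entropy: Let $G\curvearrowright(X,\mu)$ be a p.m.p. action. A countable-valued Borel function $\alpha$ on $X$ is generating if there is a $G$-invariant conull set $X'\subseteq X$ such that for all $x\ne y$ in $X'$ there is $g\in G$ with $\alpha(g\cdot x)\ne\alpha(g\cdot y)$. The Shannon entropy is $\mathrm{H}_\mu(\alpha)=\sum_k-\mu(\alpha^{-1}(k))\log\mu(\alpha^{-1}(k))$;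 for a countable Borel partition $\mathcal{Q}$, $\mathrm{H}(\alpha|\mathcal{Q})=\sum_{Q\in\mathcal{Q}}\mu(Q)\mathrm{H}_{\mu_Q}(\alpha)$ with $\mu_Q(A)=\mu(A\cap Q)/\mu(Q)$; for a sub-$\sigma$-algebra $\mathcal{F}$, $\mathrm{H}(\alpha|\mathcal{F})$ is the infimum of $\mathrm{H}(\alpha|\mathcal{Q})$ over countable $\mathcal{F}$-measurable partitions $\mathcal{Q}$. The Rokhlin entropy is $h^{\mathrm{Rok}}(G\curvearrowright X,\mu)=\inf\{\mathrm{H}(\alpha|\mathcal{J}):\alpha\text{ a countable-valued generating function}\}$, where $\mathcal{J}$ is the $\sigma$-algebra of $G$-invariant Borel sets (so $\mathrm{H}(\alpha|\mathcal{J})=\mathrm{H}(\alpha)$ when the action is ergodic). *)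

theory Defs
  imports "HOL-Probability.Probability" "HOL-Algebra.Group_Action" "HOL-Algebra.Product_Groups"
begin

definition borel_of :: "'a topology \<Rightarrow> 'a measure" where
  "borel_of T = sigma (topspace T) {U. openin T U}"

definition standard_borel :: "'a measure \<Rightarrow> bool" where
  "standard_borel M \<longleftrightarrow>
     (\<exists>T. completely_metrizable_space T \<and> second_countable T \<and> sets M = sets (borel_of T))"

definition standard_prob_space :: "'a measure \<Rightarrow> bool" where
  "standard_prob_space M \<longleftrightarrow> standard_borel M \<and> prob_space M"

definition conull :: "'a measure \<Rightarrow> 'a set \<Rightarrow> bool" where
  "conull M X \<longleftrightarrow> X \<in> sets M \<and> space M - X \<in> null_sets M"

definition pmp_action ::
    "('g, 'b) monoid_scheme \<Rightarrow> 'a measure \<Rightarrow> ('g \<Rightarrow> 'a \<Rightarrow> 'a) \<Rightarrow> bool" where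
  "pmp_action G M \<phi> \<longleftrightarrow>
     standard_prob_space M \<and> group_action G (space M) \<phi> \<and>
     (\<forall>g\<in>carrier G. \<phi> g \<in> measurable M M \<and> distr M M (\<phi> g) = M)"

text \<open>Freeness is understood almost everywhere, as usual for p.m.p. actions.\<close>

definition free_pmp_action ::
    "('g, 'b) monoid_scheme \<Rightarrow> 'a measure \<Rightarrow> ('g \<Rightarrow> 'a \<Rightarrow> 'a) \<Rightarrow> bool" where
  "free_pmp_action G M \<phi> \<longleftrightarrow>
     pmp_action G M \<phi> \<and> (AE x in M. stabilizer G \<phi> x = {\<one>\<^bsub>G\<^esub>})"

definition orbit_rel ::
    "('g, 'b) monoid_scheme \<Rightarrow> 'a measure \<Rightarrow> ('g \<Rightarrow> 'a \<Rightarrow> 'a) \<Rightarrow> ('a \<times> 'a) set" where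
  "orbit_rel G M \<phi> = {(x, y). x \<in> space M \<and> y \<in> orbit G \<phi> x}"

text \<open>The inverse of an injective Borel map is automatically Borel (Lusin--Souslin); it is required here explicitly.\<close>

definition borel_partial_bij :: "'a measure \<Rightarrow> 'a set \<Rightarrow> ('a \<Rightarrow> 'a) \<Rightarrow> bool" where
  "borel_partial_bij M A f \<longleftrightarrow>
     A \<in> sets M \<and> f ` A \<in> sets M \<and> inj_on f A \<and>
     f \<in> measurable (restrict_space M A) M \<and>
     the_inv_into A f \<in> measurable (restrict_space M (f ` A)) M"

definition smallest_equiv :: "'a set \<Rightarrow> ('a \<times> 'a) set \<Rightarrow> ('a \<times> 'a) set" where
  "smallest_equiv X P = \<Inter>{E. equiv X E \<and> P \<subseteq> E}"

text \<open>
  A countable collection of partial bijections is indexed by the natural numbers; finite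
  collections are covered because domains may be empty. Both the relation and the generating
  pairs are restricted to the conull set \<open>X\<close>: a connection passing through the discarded null
  set must not count, since a partial bijection with null domain has cost zero but may well
  have an image of positive measure.
\<close>

definition graphing ::
    "'a measure \<Rightarrow> ('a \<times> 'a) set \<Rightarrow> (nat \<Rightarrow> 'a set) \<Rightarrow> (nat \<Rightarrow> 'a \<Rightarrow> 'a) \<Rightarrow> bool" where
  "graphing M R A f \<longleftrightarrow>
     (\<forall>i. borel_partial_bij M (A i) (f i)) \<and>
     (\<exists>X. conull M X \<and>
        R \<inter> X \<times> X = smallest_equiv X ({(x, f i x) | i x. x \<in> A i} \<inter> X \<times> X))"

definition cost :: "'a measure \<Rightarrow> ('a \<times> 'a) set \<Rightarrow> ennreal" where
  "cost M R = (INF (A, f)\<in>{(A, f). graphing M R A f}. \<Sum>i. emeasure M (A i))"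

text \<open>
  Every standard Borel space has at most the cardinality of the continuum, so up to isomorphism
  all standard probability spaces are of type \<^typ>\<open>real measure\<close>; their underlying set and
  \<open>\<sigma>\<close>-algebra remain arbitrary.
\<close>

definition sup_cost :: "('g, 'b) monoid_scheme \<Rightarrow> ennreal" where
  "sup_cost G = (SUP (M, \<phi>)\<in>{(M :: real measure, \<phi>). free_pmp_action G M \<phi>}.
     cost M (orbit_rel G M \<phi>))"

text \<open>Countable-valued Borel functions are taken to have values in \<^typ>\<open>nat\<close>.\<close>

definition generating ::
    "('g, 'b) monoid_scheme \<Rightarrow> 'a measure \<Rightarrow> ('g \<Rightarrow> 'a \<Rightarrow> 'a) \<Rightarrow> ('a \<Rightarrow> nat) \<Rightarrow> bool" where
  "generating G M \<phi> \<alpha> \<longleftrightarrow>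
     \<alpha> \<in> measurable M (count_space UNIV) \<and>
     (\<exists>X. conull M X \<and> (\<forall>g\<in>carrier G. \<phi> g ` X = X) \<and>
        (\<forall>x\<in>X. \<forall>y\<in>X. x \<noteq> y \<longrightarrow> (\<exists>g\<in>carrier G. \<alpha> (\<phi> g x) \<noteq> \<alpha> (\<phi> g y))))"

definition shannon_entropy :: "'a measure \<Rightarrow> ('a \<Rightarrow> nat) \<Rightarrow> ennreal" where
  "shannon_entropy M \<alpha> =
     (\<Sum>k. ennreal (- (measure M (\<alpha> -` {k} \<inter> space M) * ln (measure M (\<alpha> -` {k} \<inter> space M)))))"

text \<open>Null sets \<open>Q\<close> contribute \<open>0\<close>, as \<open>0 * \<infinity> = 0\<close> in \<^typ>\<open>ennreal\<close>.\<close>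

definition cond_entropy_partition ::
    "'a measure \<Rightarrow> ('a \<Rightarrow> nat) \<Rightarrow> 'a set set \<Rightarrow> ennreal" where
  "cond_entropy_partition M \<alpha> \<Q> =
     (\<Sum>\<^sub>\<infinity>Q\<in>\<Q>. emeasure M Q * shannon_entropy (uniform_measure M Q) \<alpha>)"

definition cond_entropy :: "'a measure \<Rightarrow> ('a \<Rightarrow> nat) \<Rightarrow> 'a set set \<Rightarrow> ennreal" where
  "cond_entropy M \<alpha> \<F> =
     (INF \<Q>\<in>{\<Q>. countable \<Q> \<and> \<Q> \<subseteq> \<F> \<and> partition_on (space M) \<Q>}.
        cond_entropy_partition M \<alpha> \<Q>)"

definition invariant_sets ::
    "('g, 'b) monoid_scheme \<Rightarrow> 'a measure \<Rightarrow> ('g \<Rightarrow> 'a \<Rightarrow> 'a) \<Rightarrow> 'a set set" where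
  "invariant_sets G M \<phi> = {A \<in> sets M. \<forall>g\<in>carrier G. \<phi> g ` A = A}"

definition rokhlin_entropy ::
    "('g, 'b) monoid_scheme \<Rightarrow> 'a measure \<Rightarrow> ('g \<Rightarrow> 'a \<Rightarrow> 'a) \<Rightarrow> ennreal" where
  "rokhlin_entropy G M \<phi> =
     (INF \<alpha>\<in>{\<alpha>. generating G M \<phi> \<alpha>}. cond_entropy M \<alpha> (invariant_sets G M \<phi>))"

definition quotient_topology :: "'a topology \<Rightarrow> ('a \<Rightarrow> 'b) \<Rightarrow> 'b topology" where
  "quotient_topology T f =
     topology (\<lambda>U. U \<subseteq> f ` topspace T \<and> openin T {x \<in> topspace T. f x \<in> U})"

lemma openin_quotient_topology:
  "openin (quotient_topology T f) U \<longleftrightarrow>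
     U \<subseteq> f ` topspace T \<and> openin T {x \<in> topspace T. f x \<in> U}"
proof -
  have "istopology (\<lambda>U. U \<subseteq> f ` topspace T \<and> openin T {x \<in> topspace T. f x \<in> U})"
    unfolding istopology_def
  proof (intro conjI allI impI)
    fix S U assume "S \<subseteq> f ` topspace T \<and> openin T {x \<in> topspace T. f x \<in> S}"
      and "U \<subseteq> f ` topspace T \<and> openin T {x \<in> topspace T. f x \<in> U}"
    moreover have "{x \<in> topspace T. f x \<in> S \<inter> U} =
        {x \<in> topspace T. f x \<in> S} \<inter> {x \<in> topspace T. f x \<in> U}"
      by auto
    ultimately show "S \<inter> U \<subseteq> f ` topspace T" "openin T {x \<in> topspace T. f x \<in> S \<inter> U}"
      by auto
  next
    fix \<K> assume \<K>: "\<forall>S\<in>\<K>. S \<subseteq> f ` topspace T \<and> openin T {x \<in> topspace T. f x \<in> S}"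
    have "{x \<in> topspace T. f x \<in> \<Union>\<K>} = (\<Union>S\<in>\<K>. {x \<in> topspace T. f x \<in> S})"
      by auto
    with \<K> show "\<Union>\<K> \<subseteq> f ` topspace T" "openin T {x \<in> topspace T. f x \<in> \<Union>\<K>}"
      by auto
  qed
  then show ?thesis
    by (simp add: quotient_topology_def topology_inverse')
qed

lemma topspace_quotient_topology: "topspace (quotient_topology T f) = f ` topspace T"
proof (rule subset_antisym)
  show "topspace (quotient_topology T f) \<subseteq> f ` topspace T"
    by (metis openin_quotient_topology openin_topspace)
  have "{x \<in> topspace T. f x \<in> f ` topspace T} = topspace T" by auto
  then have "openin (quotient_topology T f) (f ` topspace T)"
    by (simp add: openin_quotient_topology)
  then show "f ` topspace T \<subseteq> topspace (quotient_topology T f)"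
    by (rule openin_subset)
qed

lemma quotient_map_quotient_topology: "quotient_map T (quotient_topology T f) f"
  by (simp add: quotient_map_def topspace_quotient_topology openin_quotient_topology)

definition full_group ::
    "('g, 'b) monoid_scheme \<Rightarrow> ('k, 'c) monoid_scheme \<Rightarrow> ('g \<Rightarrow> 'k) monoid" where
  "full_group G K = product_group (carrier G) (\<lambda>_. K)"

definition full_topology ::
    "('g, 'b) monoid_scheme \<Rightarrow> ('k, 'c) monoid_scheme \<Rightarrow> ('g \<Rightarrow> 'k) topology" where
  "full_topology G K = product_topology (\<lambda>_. discrete_topology (carrier K)) (carrier G)"

definition constants ::
    "('g, 'b) monoid_scheme \<Rightarrow> ('k, 'c) monoid_scheme \<Rightarrow> ('g \<Rightarrow> 'k) set" where
  "constants G K = (\<lambda>k. \<lambda>h\<in>carrier G. k) ` carrier K"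

definition quot_group ::
    "('g, 'b) monoid_scheme \<Rightarrow> ('k, 'c) monoid_scheme \<Rightarrow> ('g \<Rightarrow> 'k) set monoid" where
  "quot_group G K = full_group G K Mod constants G K"

definition quot_topology ::
    "('g, 'b) monoid_scheme \<Rightarrow> ('k, 'c) monoid_scheme \<Rightarrow> ('g \<Rightarrow> 'k) set topology" where
  "quot_topology G K =
     quotient_topology (full_topology G K) (\<lambda>x. constants G K #>\<^bsub>full_group G K\<^esub> x)"

definition shift ::
    "('g, 'b) monoid_scheme \<Rightarrow> 'g \<Rightarrow> ('g \<Rightarrow> 'k) \<Rightarrow> ('g \<Rightarrow> 'k)" where
  "shift G g x = (\<lambda>h\<in>carrier G. x (inv\<^bsub>G\<^esub> g \<otimes>\<^bsub>G\<^esub> h))"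

text \<open>The shift preserves constants, so the image of a coset under it is again a coset.\<close>

definition quot_shift ::
    "('g, 'b) monoid_scheme \<Rightarrow> ('k, 'c) monoid_scheme \<Rightarrow>
     'g \<Rightarrow> ('g \<Rightarrow> 'k) set \<Rightarrow> ('g \<Rightarrow> 'k) set" where
  "quot_shift G K g = (\<lambda>C\<in>carrier (quot_group G K). shift G g ` C)"

text \<open>
  Haar probability measure of a compact metrizable group \<open>\<Gamma>\<close> with topology \<open>T\<close>; regularity is
  automatic for Borel probability measures on such a group.
\<close>

definition haar_prob_measure ::
    "('a, 'b) monoid_scheme \<Rightarrow> 'a topology \<Rightarrow> 'a measure \<Rightarrow> bool" where
  "haar_prob_measure \<Gamma> T M \<longleftrightarrow>
     sets M = sets (borel_of T) \<and> prob_space M \<and>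
     (\<forall>a\<in>carrier \<Gamma>. \<forall>A\<in>sets M. a <#\<^bsub>\<Gamma>\<^esub> A \<in> sets M \<and> emeasure M (a <#\<^bsub>\<Gamma>\<^esub> A) = emeasure M A)"

end

theory Submission
  imports Defs "HOL-Real_Asymp.Real_Asymp"
begin

text \<open>
  A point of \<open>X = K\<^sup>G / K\<close> is a function \<open>x\<close> from \<open>G\<close> to \<open>K\<close> up to a constant factor, so it is
  the same as the family of all ratios of values of \<open>x\<close>. These ratios multiply along paths. Hence
  \<open>x\<close> is known as soon as the ratios are known along the edges of any connected graph on the orbit
  of \<open>x\<close>; one such ratio costs at most \<open>log |K|\<close>, and a graphing is such a graph whose expected
  number of edges per point is its cost. The graphing must, however, be readable from the recorded
  data, and the pattern of the points at which ratios are recorded must itself cost almost nothing.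

  Both requirements are met by a marker set \<open>E\<close> of small measure \<open>\<delta>\<close>, the set of points that are
  constant on a large finite set \<open>F\<close> and take another value at one more place \<open>u\<close>. Its indicator
  function has small entropy, and the factor \<open>Y\<close> of \<open>X\<close> generated by the indicator is essentially
  free (\<open>marker_free\<close>): for \<open>g \<noteq> 1\<close> the events that \<open>h x\<close> and \<open>h g x\<close> disagree about \<open>E\<close> have
  probability bounded below, and they become independent as \<open>h\<close> runs to infinity. The factor is
  realised on a Polish topology on a set of reals, so its cost is at most \<open>\<C>\<^sub>s\<^sub>u\<^sub>p(G)\<close>.

  Choose a graphing of \<open>Y\<close> of total mass less than \<open>c\<close>, where \<open>c\<close> exceeds the supremal cost slightly,
  and let \<open>m = \<lceil>c / \<delta>\<rceil>\<close>. Then the edges have no more mass than \<open>m\<close> copies of \<open>E\<close>. As translates of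
  sets of positive measure meet, a greedy procedure (\<open>greedy_allocation\<close>) moves almost every edge
  along its orbit to a point of \<open>E\<close>, with at most \<open>m\<close> edges for each point. The function that is
  \<open>0\<close> off \<open>E\<close> and on \<open>E\<close> records the \<open>m\<close> ratios of the edges received there is generating: its
  translates reveal the point of \<open>Y\<close>, thereby the graphing and the allocation, thereby the ratios along
  all edges (\<open>graphing_determines_coset\<close>). Its entropy is at most
  \<open>- (1 - \<delta>) log (1 - \<delta>) - \<delta> log \<delta> + \<delta> m log |K|\<close>, which tends to \<open>c log |K|\<close> as \<open>\<delta>\<close> tends to
  \<open>0\<close>.

  All facts about the Haar measure come from one averaging argument (\<open>measure_Int_cylinder\<close>):
  translating by the elements that are trivial off a finite set \<open>F\<close> preserves the measure, fixes the
  sets that are independent of the coordinates in \<open>F\<close>, and permutes all patterns on \<open>F\<close>.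
\<close>

section \<open>Shifts and cosets of constant functions\<close>

text \<open>
  A basic open neighbourhood restricts only finitely many coordinates.
\<close>

lemma product_open_contains_cylinder:
  assumes "openin (product_topology T I) U" and "x \<in> U"
  obtains F where "finite F" "F \<subseteq> I"
    "\<And>y. y \<in> topspace (product_topology T I) \<Longrightarrow> (\<And>i. i \<in> F \<Longrightarrow> y i = x i) \<Longrightarrow> y \<in> U"
proof -
  obtain V where V: "x \<in> (\<Pi>\<^sub>E i\<in>I. V i)" "finite {i. V i \<noteq> topspace (T i)}" "(\<Pi>\<^sub>E i\<in>I. V i) \<subseteq> U"
    using product_topology_open_contains_basis[OF assms] by auto
  show thesis
  proof
    show "finite (I \<inter> {i. V i \<noteq> topspace (T i)})" using V by auto
    fix y assume y: "y \<in> topspace (product_topology T I)"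
      and eq: "\<And>i. i \<in> I \<inter> {i. V i \<noteq> topspace (T i)} \<Longrightarrow> y i = x i"
    have "y i \<in> V i" if "i \<in> I" for i
    proof (cases "V i = topspace (T i)")
      case True
      then show ?thesis using y that by auto
    next
      case False
      then show ?thesis using eq[of i] V(1) that by auto
    qed
    then have "y \<in> (\<Pi>\<^sub>E i\<in>I. V i)" using y by (auto simp: PiE_iff)
    then show "y \<in> U" using V by blast
  qed auto
qed

context group
begin

lemma shift_apply: "h \<in> carrier G \<Longrightarrow> shift G g x h = x (inv g \<otimes> h)"
  by (simp add: shift_def)

lemma shift_one: "x \<in> extensional (carrier G) \<Longrightarrow> shift G \<one> x = x"
  by (auto simp: shift_def extensional_def fun_eq_iff)

lemma shift_shift:
  "g \<in> carrier G \<Longrightarrow> h \<in> carrier G \<Longrightarrow> shift G g (shift G h x) = shift G (g \<otimes> h) x"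
  by (auto simp: shift_def restrict_def fun_eq_iff inv_mult_group m_assoc)

lemma shift_in_PiE:
  "g \<in> carrier G \<Longrightarrow> x \<in> (\<Pi>\<^sub>E i\<in>carrier G. B) \<Longrightarrow> shift G g x \<in> (\<Pi>\<^sub>E i\<in>carrier G. B)"
  by (auto simp: shift_def PiE_iff extensional_def)

end

locale coset_shift =
  G: group G + K: comm_group K
  for G :: "('g, 'b) monoid_scheme" and K :: "('k, 'c) monoid_scheme" +
  fixes lam :: "('g \<Rightarrow> 'k) set measure"
  assumes countable_G: "countable (carrier G)"
    and infinite_G: "infinite (carrier G)"
    and finite_K: "finite (carrier K)"
    and haar: "haar_prob_measure (quot_group G K) (quot_topology G K) lam"
begin

abbreviation full :: "('g \<Rightarrow> 'k) set" where
  "full \<equiv> carrier (full_group G K)"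

abbreviation coset :: "('g \<Rightarrow> 'k) \<Rightarrow> ('g \<Rightarrow> 'k) set" where
  "coset x \<equiv> constants G K #>\<^bsub>full_group G K\<^esub> x"

abbreviation act :: "'g \<Rightarrow> ('g \<Rightarrow> 'k) set \<Rightarrow> ('g \<Rightarrow> 'k) set" where
  "act \<equiv> quot_shift G K"

lemma full_eq: "full = (\<Pi>\<^sub>E h\<in>carrier G. carrier K)"
  by (simp add: full_group_def)

lemma full_group: "comm_group (full_group G K)"
proof (rule group.group_comm_groupI)
  show "group (full_group G K)"
    by (simp add: full_group_def)
next
  fix x y assume "x \<in> full" "y \<in> full"
  then show "x \<otimes>\<^bsub>full_group G K\<^esub> y = y \<otimes>\<^bsub>full_group G K\<^esub> x"
    by (auto simp: full_group_def PiE_iff K.m_comm intro!: restrict_ext)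
qed

lemma full_mult: "x \<otimes>\<^bsub>full_group G K\<^esub> y = (\<lambda>h\<in>carrier G. x h \<otimes>\<^bsub>K\<^esub> y h)"
  by (simp add: full_group_def)

lemma full_inv: "x \<in> full \<Longrightarrow> inv\<^bsub>full_group G K\<^esub> x = (\<lambda>h\<in>carrier G. inv\<^bsub>K\<^esub> (x h))"
  by (simp add: full_group_def)

lemma full_closed: "x \<in> full \<Longrightarrow> h \<in> carrier G \<Longrightarrow> x h \<in> carrier K"
  by (auto simp: full_eq)

lemma subgroup_constants: "subgroup (constants G K) (full_group G K)"
proof -
  interpret F: comm_group "full_group G K" by (rule full_group)
  show ?thesis
  proof (rule F.subgroupI)
    show "constants G K \<subseteq> full" "constants G K \<noteq> {}"
      by (auto simp: constants_def full_eq)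
  next
    fix a assume "a \<in> constants G K"
    then obtain k where k: "k \<in> carrier K" "a = (\<lambda>h\<in>carrier G. k)"
      by (auto simp: constants_def)
    then have "a \<in> full" by (auto simp: full_eq)
    then have "inv\<^bsub>full_group G K\<^esub> a = (\<lambda>h\<in>carrier G. inv\<^bsub>K\<^esub> k)"
      using k by (auto simp: full_inv restrict_def)
    then show "inv\<^bsub>full_group G K\<^esub> a \<in> constants G K"
      using k by (auto simp: constants_def)
  next
    fix a b assume "a \<in> constants G K" "b \<in> constants G K"
    then obtain k l where k: "k \<in> carrier K" "l \<in> carrier K"
      "a = (\<lambda>h\<in>carrier G. k)" "b = (\<lambda>h\<in>carrier G. l)"
      by (auto simp: constants_def)
    then have "a \<otimes>\<^bsub>full_group G K\<^esub> b = (\<lambda>h\<in>carrier G. k \<otimes>\<^bsub>K\<^esub> l)"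
      by (auto simp: full_mult restrict_def)
    then show "a \<otimes>\<^bsub>full_group G K\<^esub> b \<in> constants G K"
      using k by (auto simp: constants_def)
  qed
qed

lemma normal_constants: "constants G K \<lhd> full_group G K"
  by (rule comm_group.subgroup_imp_normal[OF full_group subgroup_constants])

lemma coset_eq: "coset x = {(\<lambda>h\<in>carrier G. k \<otimes>\<^bsub>K\<^esub> x h) | k. k \<in> carrier K}"
  by (force simp: r_coset_def constants_def full_mult restrict_def)

lemma coset_eq_iff:
  assumes "x \<in> full" "y \<in> full"
  shows "coset x = coset y \<longleftrightarrow> (\<exists>k\<in>carrier K. \<forall>h\<in>carrier G. x h = k \<otimes>\<^bsub>K\<^esub> y h)"
proof -
  interpret F: comm_group "full_group G K" by (rule full_group)
  have "coset x = coset y \<longleftrightarrow> x \<in> coset y"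
    using F.repr_independence[OF _ assms(2) subgroup_constants]
      F.rcos_self[OF assms(1) subgroup_constants] by metis
  also have "\<dots> \<longleftrightarrow> (\<exists>k\<in>carrier K. x = (\<lambda>h\<in>carrier G. k \<otimes>\<^bsub>K\<^esub> y h))"
    by (auto simp: coset_eq)
  also have "\<dots> \<longleftrightarrow> (\<exists>k\<in>carrier K. \<forall>h\<in>carrier G. x h = k \<otimes>\<^bsub>K\<^esub> y h)"
    using assms by (intro bex_cong refl) (auto simp: full_eq fun_eq_iff PiE_iff extensional_def)
  finally show ?thesis .
qed

lemma carrier_quot: "carrier (quot_group G K) = coset ` full"
  by (auto simp: quot_group_def FactGroup_def RCOSETS_def)

lemma coset_mult:
  assumes "x \<in> full" "y \<in> full"
  shows "coset x \<otimes>\<^bsub>quot_group G K\<^esub> coset y = coset (x \<otimes>\<^bsub>full_group G K\<^esub> y)"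
  using normal.rcos_sum[OF normal_constants assms] by (simp add: quot_group_def FactGroup_def)

lemma shift_full: "g \<in> carrier G \<Longrightarrow> x \<in> full \<Longrightarrow> shift G g x \<in> full"
  unfolding full_eq by (rule G.shift_in_PiE)

lemma act_coset:
  assumes "g \<in> carrier G" "x \<in> full"
  shows "act g (coset x) = coset (shift G g x)"
proof -
  have "shift G g (\<lambda>h\<in>carrier G. k \<otimes>\<^bsub>K\<^esub> x h) = (\<lambda>h\<in>carrier G. k \<otimes>\<^bsub>K\<^esub> shift G g x h)" for k
    using assms by (auto simp: shift_def restrict_def fun_eq_iff)
  then have "shift G g ` coset x = coset (shift G g x)"
    unfolding coset_eq by (force simp: image_iff)
  then show ?thesis
    using assms by (simp add: quot_shift_def carrier_quot)
qed

lemma act_one: "C \<in> carrier (quot_group G K) \<Longrightarrow> act \<one>\<^bsub>G\<^esub> C = C"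
  by (auto simp: carrier_quot act_coset G.shift_one full_eq PiE_iff)

lemma act_act:
  "C \<in> carrier (quot_group G K) \<Longrightarrow> g \<in> carrier G \<Longrightarrow> h \<in> carrier G \<Longrightarrow>
    act g (act h C) = act (g \<otimes>\<^bsub>G\<^esub> h) C"
  by (auto simp: carrier_quot act_coset shift_full G.shift_shift)

lemma act_closed:
  "C \<in> carrier (quot_group G K) \<Longrightarrow> g \<in> carrier G \<Longrightarrow> act g C \<in> carrier (quot_group G K)"
  by (auto simp: carrier_quot act_coset shift_full)

text \<open>
  The ratio \<open>x(a) / x(b)\<close> is the same for all representatives \<open>x\<close> of a coset, hence the arbitrary choice.
\<close>

definition ratio :: "('g \<Rightarrow> 'k) set \<Rightarrow> 'g \<Rightarrow> 'g \<Rightarrow> 'k" where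
  "ratio C a b = (let x = (SOME x. x \<in> full \<and> C = coset x) in x a \<otimes>\<^bsub>K\<^esub> inv\<^bsub>K\<^esub> x b)"

lemma ratio_coset:
  assumes "x \<in> full" "a \<in> carrier G" "b \<in> carrier G"
  shows "ratio (coset x) a b = x a \<otimes>\<^bsub>K\<^esub> inv\<^bsub>K\<^esub> x b"
proof -
  define y where "y = (SOME y. y \<in> full \<and> coset x = coset y)"
  have y: "y \<in> full" "coset y = coset x"
    using someI[of "\<lambda>y. y \<in> full \<and> coset x = coset y" x] assms by (auto simp: y_def)
  then obtain k where k: "k \<in> carrier K" "\<And>h. h \<in> carrier G \<Longrightarrow> y h = k \<otimes>\<^bsub>K\<^esub> x h"
    using coset_eq_iff assms by metis
  have c: "x a \<in> carrier K" "x b \<in> carrier K" using assms full_closed by auto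
  have "(k \<otimes>\<^bsub>K\<^esub> x a) \<otimes>\<^bsub>K\<^esub> inv\<^bsub>K\<^esub> (k \<otimes>\<^bsub>K\<^esub> x b) = x a \<otimes>\<^bsub>K\<^esub> inv\<^bsub>K\<^esub> x b"
  proof -
    have "(k \<otimes>\<^bsub>K\<^esub> x a) \<otimes>\<^bsub>K\<^esub> inv\<^bsub>K\<^esub> (k \<otimes>\<^bsub>K\<^esub> x b) =
        (x a \<otimes>\<^bsub>K\<^esub> inv\<^bsub>K\<^esub> x b) \<otimes>\<^bsub>K\<^esub> (k \<otimes>\<^bsub>K\<^esub> inv\<^bsub>K\<^esub> k)"
      using k c by (simp add: K.inv_mult K.m_ac del: K.r_inv K.Units_r_inv)
    then show ?thesis using k c by simp
  qed
  then show ?thesis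
    using k assms y_def by (simp add: ratio_def Let_def)
qed

lemma ratio_closed:
  "C \<in> carrier (quot_group G K) \<Longrightarrow> a \<in> carrier G \<Longrightarrow> b \<in> carrier G \<Longrightarrow> ratio C a b \<in> carrier K"
  by (auto simp: carrier_quot ratio_coset full_closed)

lemma ratio_act:
  assumes "C \<in> carrier (quot_group G K)" "g \<in> carrier G" "a \<in> carrier G" "b \<in> carrier G"
  shows "ratio (act g C) a b = ratio C (inv\<^bsub>G\<^esub> g \<otimes>\<^bsub>G\<^esub> a) (inv\<^bsub>G\<^esub> g \<otimes>\<^bsub>G\<^esub> b)"
  using assms by (auto simp: carrier_quot act_coset ratio_coset shift_full G.shift_apply)

lemma ratio_trans:
  assumes "C \<in> carrier (quot_group G K)" "a \<in> carrier G" "b \<in> carrier G" "c \<in> carrier G"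
  shows "ratio C a c = ratio C a b \<otimes>\<^bsub>K\<^esub> ratio C b c"
proof -
  obtain x where x: "x \<in> full" "C = coset x" using assms by (auto simp: carrier_quot)
  have "x a \<in> carrier K" "x b \<in> carrier K" "x c \<in> carrier K" using x assms full_closed by auto
  then show ?thesis
    using x assms by (simp add: ratio_coset K.m_assoc K.inv_solve_left flip: K.m_assoc[of "inv\<^bsub>K\<^esub> x b"])
qed

lemma ratio_refl: "C \<in> carrier (quot_group G K) \<Longrightarrow> a \<in> carrier G \<Longrightarrow> ratio C a a = \<one>\<^bsub>K\<^esub>"
  by (auto simp: carrier_quot ratio_coset full_closed)

lemma ratio_sym:
  "C \<in> carrier (quot_group G K) \<Longrightarrow> a \<in> carrier G \<Longrightarrow> b \<in> carrier G \<Longrightarrow>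
    ratio C b a = inv\<^bsub>K\<^esub> ratio C a b"
  by (auto simp: carrier_quot ratio_coset full_closed K.inv_mult K.m_comm)

text \<open>
  The ratios to a fixed coordinate are coordinates on the quotient, which identify it with the functions
  from the remaining elements of \<open>G\<close> to \<open>K\<close>.
\<close>

lemma ratio_ext:
  assumes "C \<in> carrier (quot_group G K)" "D \<in> carrier (quot_group G K)" "b \<in> carrier G"
    and "\<And>a. a \<in> carrier G \<Longrightarrow> ratio C a b = ratio D a b"
  shows "C = D"
proof -
  obtain x y where x: "x \<in> full" "C = coset x" "y \<in> full" "D = coset y"
    using assms by (auto simp: carrier_quot)
  have "x h = (x b \<otimes>\<^bsub>K\<^esub> inv\<^bsub>K\<^esub> y b) \<otimes>\<^bsub>K\<^esub> y h" if h: "h \<in> carrier G" for h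
  proof -
    have c: "x h \<in> carrier K" "x b \<in> carrier K" "y h \<in> carrier K" "y b \<in> carrier K"
      using x assms full_closed h by auto
    have "x h = (x h \<otimes>\<^bsub>K\<^esub> inv\<^bsub>K\<^esub> x b) \<otimes>\<^bsub>K\<^esub> x b"
      using c by (simp add: K.m_assoc)
    also have "\<dots> = (y h \<otimes>\<^bsub>K\<^esub> inv\<^bsub>K\<^esub> y b) \<otimes>\<^bsub>K\<^esub> x b"
      using assms(4)[OF h] x h assms(3) by (simp add: ratio_coset)
    also have "\<dots> = (x b \<otimes>\<^bsub>K\<^esub> inv\<^bsub>K\<^esub> y b) \<otimes>\<^bsub>K\<^esub> y h"
      using c by (simp add: K.m_ac)
    finally show ?thesis .
  qed
  moreover have "x b \<otimes>\<^bsub>K\<^esub> inv\<^bsub>K\<^esub> y b \<in> carrier K" using x assms full_closed by auto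
  ultimately show ?thesis using x coset_eq_iff by blast
qed

end

section \<open>Cylinder sets and the Haar measure\<close>

context coset_shift
begin

sublocale prob_space lam
  using haar by (simp add: haar_prob_measure_def)

lemma topspace_full: "topspace (full_topology G K) = full"
  by (simp add: full_topology_def full_eq)

lemma openin_quot:
  "openin (quot_topology G K) U \<longleftrightarrow>
    U \<subseteq> carrier (quot_group G K) \<and> openin (full_topology G K) {x \<in> full. coset x \<in> U}"
  by (simp add: quot_topology_def openin_quotient_topology topspace_full carrier_quot)

lemma topspace_quot: "topspace (quot_topology G K) = carrier (quot_group G K)"
  by (simp add: quot_topology_def topspace_quotient_topology topspace_full carrier_quot)

lemma sets_lam_open: "sets lam = sigma_sets (carrier (quot_group G K)) {U. openin (quot_topology G K) U}"
proof -
  have "{U. openin (quot_topology G K) U} \<subseteq> Pow (topspace (quot_topology G K))"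
    using openin_subset by auto
  then have "sets (borel_of (quot_topology G K)) =
      sigma_sets (topspace (quot_topology G K)) {U. openin (quot_topology G K) U}"
    unfolding borel_of_def by (rule sets_measure_of)
  then show ?thesis using haar by (simp add: haar_prob_measure_def topspace_quot)
qed

lemma space_lam: "space lam = carrier (quot_group G K)"
proof -
  have "openin (quot_topology G K) (carrier (quot_group G K))"
    using openin_topspace[of "quot_topology G K"] by (simp add: topspace_quot)
  then have "carrier (quot_group G K) \<in> sets lam"
    unfolding sets_lam_open by (auto intro: sigma_sets.Basic)
  moreover have "space lam \<subseteq> carrier (quot_group G K)"
    using sets.top[of lam] unfolding sets_lam_open
    by (rule sigma_sets_into_sp[rotated]) (use openin_subset topspace_quot in blast)
  ultimately show ?thesis using sets.sets_into_space by blast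
qed

text \<open>
  Membership of a coset is tested on representatives; as all representatives qualify, a set that depends
  on \<open>F\<close> only depends on the ratios of values at points of \<open>F\<close>.
\<close>

definition depends_on :: "'g set \<Rightarrow> ('g \<Rightarrow> 'k) set set \<Rightarrow> bool" where
  "depends_on F A \<longleftrightarrow> A \<subseteq> carrier (quot_group G K) \<and>
     (\<forall>x\<in>full. \<forall>y\<in>full. (\<forall>f\<in>F. x f = y f) \<longrightarrow> coset x \<in> A \<longrightarrow> coset y \<in> A)"

lemma depends_onD:
  "depends_on F A \<Longrightarrow> x \<in> full \<Longrightarrow> y \<in> full \<Longrightarrow> (\<And>f. f \<in> F \<Longrightarrow> x f = y f) \<Longrightarrow>
    coset x \<in> A \<longleftrightarrow> coset y \<in> A"
  unfolding depends_on_def by (metis (no_types, lifting))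

lemma depends_onI:
  assumes "A \<subseteq> carrier (quot_group G K)"
    and "\<And>x y. x \<in> full \<Longrightarrow> y \<in> full \<Longrightarrow> (\<And>f. f \<in> F \<Longrightarrow> x f = y f) \<Longrightarrow> coset x \<in> A \<Longrightarrow> coset y \<in> A"
  shows "depends_on F A"
  unfolding depends_on_def using assms by blast

lemma depends_on_mono: "depends_on F A \<Longrightarrow> F \<subseteq> F' \<Longrightarrow> depends_on F' A"
  unfolding depends_on_def by (meson subsetD)

lemma depends_on_compl:
  assumes "depends_on F A"
  shows "depends_on F (carrier (quot_group G K) - A)"
proof (rule depends_onI)
  fix x y assume "x \<in> full" "y \<in> full" "\<And>f. f \<in> F \<Longrightarrow> x f = y f"
    and x: "coset x \<in> carrier (quot_group G K) - A"
  then have "coset x \<in> A \<longleftrightarrow> coset y \<in> A"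
    by (intro depends_onD[OF assms])
  then show "coset y \<in> carrier (quot_group G K) - A"
    using x \<open>y \<in> full\<close> by (auto simp: carrier_quot)
qed auto

lemma depends_on_Int:
  assumes "depends_on F A" "depends_on F B"
  shows "depends_on F (A \<inter> B)"
proof (rule depends_onI)
  show "A \<inter> B \<subseteq> carrier (quot_group G K)" using assms by (auto simp: depends_on_def)
qed (use assms depends_onD in blast)

lemma depends_on_act:
  assumes "depends_on F A" "g \<in> carrier G" "F \<subseteq> carrier G"
  shows "depends_on ((\<lambda>f. inv\<^bsub>G\<^esub> g \<otimes>\<^bsub>G\<^esub> f) ` F) {C \<in> carrier (quot_group G K). act g C \<in> A}"
proof (rule depends_onI)
  fix x y
  assume xy: "x \<in> full" "y \<in> full"
    and eq: "\<And>f. f \<in> (\<lambda>f. inv\<^bsub>G\<^esub> g \<otimes>\<^bsub>G\<^esub> f) ` F \<Longrightarrow> x f = y f"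
    and x: "coset x \<in> {C \<in> carrier (quot_group G K). act g C \<in> A}"
  have "coset (shift G g x) \<in> A \<longleftrightarrow> coset (shift G g y) \<in> A"
  proof (rule depends_onD[OF assms(1)])
    fix f assume "f \<in> F"
    then show "shift G g x f = shift G g y f"
      using eq[of "inv\<^bsub>G\<^esub> g \<otimes>\<^bsub>G\<^esub> f"] assms(3) by (auto simp: G.shift_apply)
  qed (use xy assms shift_full in auto)
  then show "coset y \<in> {C \<in> carrier (quot_group G K). act g C \<in> A}"
    using x xy assms(2) by (simp add: act_coset) (auto simp: carrier_quot)
qed auto

text \<open>
  The preimage in \<open>K\<^sup>G\<close> contains with each function its whole cylinder over \<open>F\<close>.
\<close>

lemma depends_on_open:
  assumes "depends_on F A" "finite F"
  shows "openin (quot_topology G K) A"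
proof -
  have "openin (full_topology G K) {x \<in> full. coset x \<in> A}"
  proof (subst openin_subopen, intro ballI)
    fix x assume x: "x \<in> {x \<in> full. coset x \<in> A}"
    define V where "V i = (if i \<in> F \<inter> carrier G then {x i} else carrier K)" for i
    have "openin (full_topology G K) (\<Pi>\<^sub>E i\<in>carrier G. V i)"
      unfolding full_topology_def
    proof (rule product_topology_basis)
      show "openin (discrete_topology (carrier K)) (V i)" for i
        using x full_closed by (auto simp: V_def)
      show "finite {i. V i \<noteq> topspace (discrete_topology (carrier K))}"
        by (rule finite_subset[OF _ \<open>finite F\<close>]) (auto simp: V_def)
    qed
    moreover have "x \<in> (\<Pi>\<^sub>E i\<in>carrier G. V i)"
      using x by (auto simp: V_def full_eq PiE_iff)
    moreover have "(\<Pi>\<^sub>E i\<in>carrier G. V i) \<subseteq> {x \<in> full. coset x \<in> A}"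
    proof
      fix y assume y: "y \<in> (\<Pi>\<^sub>E i\<in>carrier G. V i)"
      have yf: "y i \<in> carrier K" if "i \<in> carrier G" for i
        using PiE_mem[OF y that] x full_closed that by (auto simp: V_def split: if_splits)
      then have y': "y \<in> full" using y by (auto simp: full_eq PiE_iff)
      have "y f = x f" if "f \<in> F" for f
      proof (cases "f \<in> carrier G")
        case True
        then show ?thesis using PiE_mem[OF y True] that by (simp add: V_def)
      next
        case False
        then show ?thesis using x y' by (auto simp: full_eq PiE_iff extensional_def)
      qed
      then show "y \<in> {x \<in> full. coset x \<in> A}"
        using x y' depends_onD[OF assms(1), of y x] by auto
    qed
    ultimately show "\<exists>T. openin (full_topology G K) T \<and> x \<in> T \<and> T \<subseteq> {x \<in> full. coset x \<in> A}"
      by blast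
  qed
  then show ?thesis using assms by (simp add: openin_quot depends_on_def)
qed

lemma depends_on_measurable:
  "depends_on F A \<Longrightarrow> finite F \<Longrightarrow> A \<in> sets lam"
  unfolding sets_lam_open by (auto intro: sigma_sets.Basic depends_on_open)

definition cylinders :: "('g \<Rightarrow> 'k) set set set" where
  "cylinders = {A. \<exists>F. finite F \<and> F \<subseteq> carrier G \<and> depends_on F A}"

lemma cylinders_sets: "cylinders \<subseteq> sets lam"
  by (auto simp: cylinders_def depends_on_measurable)

text \<open>
  Exhaust \<open>G\<close> by finite sets \<open>F n\<close>. The part of an open set that the coordinates in \<open>F n\<close> already certify
  is a cylinder set, and these parts exhaust the open set because each point has a cylinder around it.
\<close>

lemma open_countable_union_cylinders:
  assumes U: "openin (quot_topology G K) U"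
  obtains A :: "nat \<Rightarrow> _" where "range A \<subseteq> cylinders" "U = (\<Union>n. A n)"
proof -
  define F where "F n = from_nat_into (carrier G) ` {..<n::nat}" for n
  have ne: "carrier G \<noteq> {}" using infinite_G by auto
  have F: "finite (F n)" "F n \<subseteq> carrier G" for n
    using from_nat_into[OF ne] by (auto simp: F_def)
  define P where "P n x \<longleftrightarrow> x \<in> full \<and> (\<forall>y\<in>full. (\<forall>f\<in>F n. y f = x f) \<longrightarrow> coset y \<in> U)" for n x
  define A where "A n = {coset x | x. P n x}" for n
  have "depends_on (F n) (A n)" for n
    unfolding depends_on_def
  proof (intro conjI ballI impI)
    show "A n \<subseteq> carrier (quot_group G K)" by (auto simp: A_def P_def carrier_quot)
    fix x y assume x: "x \<in> full" and y: "y \<in> full" and eq: "\<forall>f\<in>F n. x f = y f" and "coset x \<in> A n"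
    then obtain x' where x': "coset x = coset x'" "P n x'"
      by (auto simp: A_def)
    then have "x' \<in> full" by (simp add: P_def)
    then obtain k where k: "k \<in> carrier K" "\<forall>h\<in>carrier G. x' h = k \<otimes>\<^bsub>K\<^esub> x h"
      using coset_eq_iff x x' by metis
    \<comment> \<open>The certificate may belong to another representative, so the constant is carried over to \<open>y\<close>.\<close>
    define y' where "y' = (\<lambda>h\<in>carrier G. k \<otimes>\<^bsub>K\<^esub> y h)"
    have y': "y' \<in> full" using y k by (auto simp: y'_def full_eq)
    have "coset y' = coset y" using coset_eq_iff[OF y' y] k by (auto simp: y'_def)
    moreover have "P n y'"
    proof -
      have "y' f = x' f" if "f \<in> F n" for f
        using eq k that F(2)[of n] by (auto simp: y'_def)
      then show ?thesis using x'(2) y' by (simp add: P_def)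
    qed
    ultimately show "coset y \<in> A n" by (auto simp: A_def)
  qed
  then have 1: "range A \<subseteq> cylinders"
    unfolding cylinders_def image_subset_iff using F by (intro ballI CollectI exI conjI)
  have "C \<in> (\<Union>n. A n)" if C: "C \<in> U" for C
  proof -
    obtain x where x: "x \<in> full" "C = coset x"
      using C U unfolding openin_quot carrier_quot by auto
    have "openin (full_topology G K) {x \<in> full. coset x \<in> U}" "x \<in> {x \<in> full. coset x \<in> U}"
      using U openin_quot C x by auto
    then obtain H where H: "finite H" "H \<subseteq> carrier G"
      "\<And>y. y \<in> full \<Longrightarrow> (\<And>i. i \<in> H \<Longrightarrow> y i = x i) \<Longrightarrow> coset y \<in> U"
      unfolding full_topology_def
      by (rule product_open_contains_cylinder) (auto simp: full_eq)
    have "\<exists>n. H \<subseteq> F n"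
    proof -
      define N where "N = Suc (Max (to_nat_on (carrier G) ` H))"
      have "h \<in> F N" if "h \<in> H" for h
      proof -
        have "to_nat_on (carrier G) h < N"
          using that H by (auto simp: N_def le_imp_less_Suc)
        moreover have "from_nat_into (carrier G) (to_nat_on (carrier G) h) = h"
          using that H countable_G by (auto intro: from_nat_into_to_nat_on)
        ultimately show ?thesis by (force simp: F_def)
      qed
      then show ?thesis by auto
    qed
    then obtain n where "H \<subseteq> F n" by auto
    then have "P n x" using H(3) x(1) unfolding P_def by blast
    then show ?thesis using x by (auto simp: A_def)
  qed
  moreover have "A n \<subseteq> U" for n by (auto simp: A_def P_def)
  ultimately have "U = (\<Union>n. A n)" by blast
  with 1 show thesis by (rule that)
qed

lemma sets_lam: "sets lam = sigma_sets (carrier (quot_group G K)) cylinders"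
  unfolding sets_lam_open
proof (rule sigma_sets_eqI)
  fix U assume "U \<in> {U. openin (quot_topology G K) U}"
  then obtain A :: "nat \<Rightarrow> _" where A: "range A \<subseteq> cylinders" "U = (\<Union>n. A n)"
    using open_countable_union_cylinders by auto
  then show "U \<in> sigma_sets (carrier (quot_group G K)) cylinders"
    unfolding A(2) by (intro sigma_sets.Union sigma_sets.Basic) auto
next
  fix A assume "A \<in> cylinders"
  then show "A \<in> sigma_sets (carrier (quot_group G K)) {U. openin (quot_topology G K) U}"
    by (auto simp: cylinders_def intro!: sigma_sets.Basic depends_on_open)
qed

text \<open>
  A copy of the finite group \<open>K\<^sup>F\<close> inside \<open>K\<^sup>G\<close>. Its translations move every pattern on \<open>F\<close> to every
  other pattern and leave the remaining coordinates alone.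
\<close>

definition supported_on :: "'g set \<Rightarrow> ('g \<Rightarrow> 'k) set" where
  "supported_on F = {z \<in> full. \<forall>h\<in>carrier G - F. z h = \<one>\<^bsub>K\<^esub>}"

lemma supported_on_bij:
  assumes "F \<subseteq> carrier G"
  shows "bij_betw (\<lambda>z. restrict z F) (supported_on F) (\<Pi>\<^sub>E h\<in>F. carrier K)"
proof (rule bij_betw_byWitness[where f' = "\<lambda>z. \<lambda>h\<in>carrier G. if h \<in> F then z h else \<one>\<^bsub>K\<^esub>"])
  show "\<forall>z\<in>supported_on F. (\<lambda>h\<in>carrier G. if h \<in> F then restrict z F h else \<one>\<^bsub>K\<^esub>) = z"
    using assms by (auto simp: supported_on_def full_eq fun_eq_iff PiE_iff extensional_def)
  show "\<forall>z\<in>\<Pi>\<^sub>E h\<in>F. carrier K. restrict (\<lambda>h\<in>carrier G. if h \<in> F then z h else \<one>\<^bsub>K\<^esub>) F = z"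
    using assms by (auto simp: fun_eq_iff PiE_iff extensional_def)
  show "(\<lambda>z. restrict z F) ` supported_on F \<subseteq> (\<Pi>\<^sub>E h\<in>F. carrier K)"
    using assms full_closed by (auto simp: supported_on_def)
  show "(\<lambda>z. \<lambda>h\<in>carrier G. if h \<in> F then z h else \<one>\<^bsub>K\<^esub>) ` (\<Pi>\<^sub>E h\<in>F. carrier K) \<subseteq> supported_on F"
    using assms by (auto simp: supported_on_def full_eq)
qed

lemma card_supported_on:
  assumes "F \<subseteq> carrier G" "finite F"
  shows "card (supported_on F) = card (carrier K) ^ card F"
  using bij_betw_same_card[OF supported_on_bij[OF assms(1)]] assms by (simp add: card_PiE)

lemma finite_supported_on:
  assumes "F \<subseteq> carrier G" "finite F"
  shows "finite (supported_on F)"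
  using bij_betw_finite[OF supported_on_bij[OF assms(1)]] assms finite_K by (simp add: finite_PiE)

lemma card_K_pos: "card (carrier K) > 0"
  using finite_K K.one_closed by (auto simp: card_gt_0_iff)

definition cylinder_count :: "'g set \<Rightarrow> ('g \<Rightarrow> 'k) set set \<Rightarrow> nat" where
  "cylinder_count F B = card {z \<in> supported_on F. coset z \<in> B}"

lemma full_quot_closed: "x \<in> full \<Longrightarrow> y \<in> full \<Longrightarrow> (\<lambda>h\<in>carrier G. inv\<^bsub>K\<^esub> (y h) \<otimes>\<^bsub>K\<^esub> x h) \<in> full"
  by (auto simp: full_eq PiE_iff)

text \<open>
  This is the invariance of the Haar measure. The translate by the class of \<open>w\<close> is described by
  representatives, without the multiplication of cosets.
\<close>

lemma translate_measure:
  assumes w: "w \<in> full" and A: "A \<in> sets lam"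
  shows "{coset x | x. x \<in> full \<and> coset (\<lambda>h\<in>carrier G. inv\<^bsub>K\<^esub> (w h) \<otimes>\<^bsub>K\<^esub> x h) \<in> A} \<in> sets lam" (is "?T \<in> _")
    and "measure lam {coset x | x. x \<in> full \<and> coset (\<lambda>h\<in>carrier G. inv\<^bsub>K\<^esub> (w h) \<otimes>\<^bsub>K\<^esub> x h) \<in> A} = measure lam A"
proof -
  have AX: "A \<subseteq> carrier (quot_group G K)"
    using sets.sets_into_space[OF A] by (simp add: space_lam)
  have "?T = coset w <#\<^bsub>quot_group G K\<^esub> A"
  proof (intro equalityI subsetI)
    fix C assume "C \<in> ?T"
    then obtain x where x: "x \<in> full" "C = coset x" "coset (\<lambda>h\<in>carrier G. inv\<^bsub>K\<^esub> (w h) \<otimes>\<^bsub>K\<^esub> x h) \<in> A"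
      by auto
    define y where "y = (\<lambda>h\<in>carrier G. inv\<^bsub>K\<^esub> (w h) \<otimes>\<^bsub>K\<^esub> x h)"
    have y: "y \<in> full" unfolding y_def using x(1) w by (rule full_quot_closed)
    have "w \<otimes>\<^bsub>full_group G K\<^esub> y = x"
      using x(1) w
      by (auto simp: full_mult y_def fun_eq_iff full_eq PiE_iff extensional_def simp flip: K.m_assoc)
    then have "coset w \<otimes>\<^bsub>quot_group G K\<^esub> coset y = C"
      using coset_mult[OF w y] x by simp
    then show "C \<in> coset w <#\<^bsub>quot_group G K\<^esub> A"
      using x(3) by (auto simp: l_coset_def y_def)
  next
    fix C assume "C \<in> coset w <#\<^bsub>quot_group G K\<^esub> A"
    then obtain y where y: "y \<in> full" "coset y \<in> A" "C = coset w \<otimes>\<^bsub>quot_group G K\<^esub> coset y"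
      using AX by (force simp: l_coset_def carrier_quot)
    define x where "x = w \<otimes>\<^bsub>full_group G K\<^esub> y"
    have x: "x \<in> full" "C = coset x"
      using w y coset_mult by (auto simp: x_def full_mult full_eq PiE_iff)
    have "(\<lambda>h\<in>carrier G. inv\<^bsub>K\<^esub> (w h) \<otimes>\<^bsub>K\<^esub> x h) = y"
      using y(1) w
      by (auto simp: full_mult x_def fun_eq_iff full_eq PiE_iff extensional_def simp flip: K.m_assoc)
    then show "C \<in> ?T" using x y by auto
  qed
  then show "?T \<in> sets lam" "measure lam ?T = measure lam A"
    using haar w A by (auto simp: haar_prob_measure_def carrier_quot measure_def)
qed

text \<open>
  As \<open>z\<close> runs over \<open>K\<^sup>F\<close>, so does the restriction of \<open>x / z\<close> to \<open>F\<close>; the count is therefore independent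
  of \<open>x\<close>. The reindexing is an involution.
\<close>

lemma supported_on_count_translate:
  assumes F: "finite F" "F \<subseteq> carrier G" and B: "depends_on F B" and x: "x \<in> full"
  shows "card {z \<in> supported_on F. coset (\<lambda>h\<in>carrier G. inv\<^bsub>K\<^esub> (z h) \<otimes>\<^bsub>K\<^esub> x h) \<in> B} = cylinder_count F B"
proof -
  define \<iota> where "\<iota> z = (\<lambda>h\<in>carrier G. if h \<in> F then inv\<^bsub>K\<^esub> (z h) \<otimes>\<^bsub>K\<^esub> x h else \<one>\<^bsub>K\<^esub>)" for z
  have closed: "\<iota> z \<in> supported_on F" if "z \<in> supported_on F" for z
    using that x by (auto simp: \<iota>_def supported_on_def full_eq PiE_iff)
  have inv: "\<iota> (\<iota> z) = z" if "z \<in> supported_on F" for z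
  proof
    fix h
    show "\<iota> (\<iota> z) h = z h"
    proof (cases "h \<in> carrier G \<and> h \<in> F")
      case True
      then have "z h \<in> carrier K" "x h \<in> carrier K"
        using that x full_closed by (auto simp: supported_on_def)
      then have "inv\<^bsub>K\<^esub> (inv\<^bsub>K\<^esub> (z h) \<otimes>\<^bsub>K\<^esub> x h) \<otimes>\<^bsub>K\<^esub> x h = z h"
        by (simp add: K.inv_mult K.m_assoc)
      then show ?thesis using True by (simp add: \<iota>_def)
    next
      case False
      then show ?thesis using that
        by (auto simp: \<iota>_def supported_on_def full_eq PiE_iff extensional_def)
    qed
  qed
  have eq: "coset (\<lambda>h\<in>carrier G. inv\<^bsub>K\<^esub> (z h) \<otimes>\<^bsub>K\<^esub> x h) \<in> B \<longleftrightarrow> coset (\<iota> z) \<in> B"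
    if "z \<in> supported_on F" for z
    using closed[OF that] that x F(2)
    by (intro depends_onD[OF B]) (auto simp: supported_on_def \<iota>_def full_quot_closed)
  have "bij_betw \<iota> {z \<in> supported_on F. coset (\<lambda>h\<in>carrier G. inv\<^bsub>K\<^esub> (z h) \<otimes>\<^bsub>K\<^esub> x h) \<in> B}
      {z \<in> supported_on F. coset z \<in> B}"
    by (rule bij_betw_byWitness[where f' = \<iota>]) (auto simp: closed inv eq)
  then show ?thesis
    unfolding cylinder_count_def by (rule bij_betw_same_card)
qed

text \<open>
  Translating \<open>A \<inter> B\<close> by \<open>z \<in> K\<^sup>F\<close> changes neither its measure nor the condition of being in \<open>A\<close>. Summed
  over \<open>z\<close>, the indicator functions of the translates give a constant multiple of that of \<open>A\<close>, since
  the number of \<open>z\<close> that carry a given point into \<open>B\<close> is always the same.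
\<close>

lemma measure_Int_cylinder:
  assumes F: "finite F" "F \<subseteq> carrier G" and B: "depends_on F B"
    and A: "A \<in> sets lam" "depends_on (carrier G - F) A"
  shows "measure lam (A \<inter> B) * card (supported_on F) = measure lam A * cylinder_count F B"
proof -
  define T where
    "T z = {coset x | x. x \<in> full \<and> coset (\<lambda>h\<in>carrier G. inv\<^bsub>K\<^esub> (z h) \<otimes>\<^bsub>K\<^esub> x h) \<in> A \<inter> B}" for z
  have AB: "A \<inter> B \<in> sets lam" using A B F depends_on_measurable by auto
  have zf: "z \<in> full" if "z \<in> supported_on F" for z using that by (simp add: supported_on_def)
  have T: "T z \<in> sets lam" "measure lam (T z) = measure lam (A \<inter> B)" if "z \<in> supported_on F" for z
    using translate_measure[OF zf[OF that] AB] by (auto simp: T_def)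
  have mem: "coset x \<in> T z \<longleftrightarrow>
      coset x \<in> A \<and> coset (\<lambda>h\<in>carrier G. inv\<^bsub>K\<^esub> (z h) \<otimes>\<^bsub>K\<^esub> x h) \<in> B"
    if z: "z \<in> supported_on F" and x: "x \<in> full" for x z
  proof -
    let ?d = "\<lambda>x. (\<lambda>h\<in>carrier G. inv\<^bsub>K\<^esub> (z h) \<otimes>\<^bsub>K\<^esub> x h)"
    have d: "?d y \<in> full" if "y \<in> full" for y using full_quot_closed that zf[OF z] by auto
    have eqd: "coset (?d y) = coset (?d x)" if y: "y \<in> full" "coset x = coset y" for y
    proof -
      obtain k where k: "k \<in> carrier K" "\<forall>h\<in>carrier G. y h = k \<otimes>\<^bsub>K\<^esub> x h"
        using coset_eq_iff x y by metis
      have "\<forall>h\<in>carrier G. ?d y h = k \<otimes>\<^bsub>K\<^esub> ?d x h"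
        using k x zf[OF z] full_closed by (auto simp: K.m_lcomm)
      then show ?thesis using coset_eq_iff[OF d d] k x y by blast
    qed
    have "coset (?d x) \<in> A \<longleftrightarrow> coset x \<in> A"
    proof (rule depends_onD[OF A(2) d[OF x] x])
      fix h assume "h \<in> carrier G - F"
      then show "?d x h = x h" using z x full_closed by (auto simp: supported_on_def)
    qed
    moreover have "coset x \<in> T z \<longleftrightarrow> coset (?d x) \<in> A \<inter> B"
    proof
      assume "coset x \<in> T z"
      then obtain y where "y \<in> full" "coset x = coset y" "coset (?d y) \<in> A \<inter> B"
        unfolding T_def mem_Collect_eq by blast
      then show "coset (?d x) \<in> A \<inter> B" using eqd[of y] by simp
    next
      assume "coset (?d x) \<in> A \<inter> B"
      then show "coset x \<in> T z" using x unfolding T_def by blast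
    qed
    ultimately show ?thesis by blast
  qed
  have "measure lam (A \<inter> B) * card (supported_on F) = (\<Sum>z\<in>supported_on F. measure lam (T z))"
    using T by simp
  also have "\<dots> = (\<integral>C. (\<Sum>z\<in>supported_on F. indicator (T z) C) \<partial>lam)"
    using T by (subst Bochner_Integration.integral_sum) (auto simp: less_top[symmetric])
  also have "\<dots> = (\<integral>C. real (cylinder_count F B) * indicator A C \<partial>lam)"
  proof (rule Bochner_Integration.integral_cong[OF refl])
    fix C assume "C \<in> space lam"
    then obtain x where x: "x \<in> full" "C = coset x" by (auto simp: space_lam carrier_quot)
    have "(\<Sum>z\<in>supported_on F. indicator (T z) C :: real) = card {z \<in> supported_on F. C \<in> T z}"
      using finite_supported_on[OF F(2,1)]
      by (simp add: indicator_def sum.If_cases Collect_conj_eq)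
    also have "\<dots> = real (cylinder_count F B) * indicator A C"
    proof (cases "C \<in> A")
      case True
      then have "{z \<in> supported_on F. C \<in> T z} =
          {z \<in> supported_on F. coset (\<lambda>h\<in>carrier G. inv\<^bsub>K\<^esub> (z h) \<otimes>\<^bsub>K\<^esub> x h) \<in> B}"
        unfolding x(2) by (intro Collect_cong conj_cong refl) (simp add: mem x(1))
      then show ?thesis using supported_on_count_translate[OF F B x(1)] True by simp
    next
      case False
      then have "{z \<in> supported_on F. C \<in> T z} = {}"
        unfolding x(2) by (simp add: mem x(1))
      then show ?thesis using False by (simp only: card.empty) simp
    qed
    finally show "(\<Sum>z\<in>supported_on F. indicator (T z) C) = real (cylinder_count F B) * indicator A C" .
  qed
  also have "\<dots> = measure lam A * cylinder_count F B"
    using A by simp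
  finally show ?thesis .
qed

lemma depends_on_space: "depends_on F (carrier (quot_group G K))"
  by (auto simp: depends_on_def carrier_quot)

text \<open>
  The case \<open>A = X\<close>: the distribution of the patterns on \<open>F\<close> is uniform.
\<close>

lemma measure_cylinder:
  assumes F: "finite F" "F \<subseteq> carrier G" and B: "depends_on F B"
  shows "measure lam B = cylinder_count F B / card (carrier K) ^ card F"
proof -
  have "B \<subseteq> space lam" using B by (auto simp: depends_on_def space_lam)
  moreover have "space lam \<in> sets lam" by simp
  ultimately show ?thesis
    using measure_Int_cylinder[OF F B, of "space lam"] card_K_pos
    prob_space
    by (simp add: space_lam depends_on_space card_supported_on[OF F(2,1)] Int_absorb1 field_simps)
qed

lemma measure_Int_cylinder_indep:
  assumes F: "finite F" "F \<subseteq> carrier G" and B: "depends_on F B"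
    and A: "A \<in> sets lam" "depends_on (carrier G - F) A"
  shows "measure lam (A \<inter> B) = measure lam A * measure lam B"
  using measure_Int_cylinder[OF assms] card_K_pos
  by (simp add: measure_cylinder[OF F B] card_supported_on[OF F(2,1)] field_simps)

end

section \<open>Invariance, approximation and recurrence of the shift\<close>

context coset_shift
begin

text \<open>
  The shift by \<open>g\<close> carries the patterns on \<open>g\<^sup>-\<^sup>1 F\<close> bijectively to those on \<open>F\<close>.
\<close>

lemma cylinder_count_act:
  assumes g: "g \<in> carrier G" and F: "F \<subseteq> carrier G"
  shows "cylinder_count ((\<lambda>f. inv\<^bsub>G\<^esub> g \<otimes>\<^bsub>G\<^esub> f) ` F) {C \<in> carrier (quot_group G K). act g C \<in> A} =
    cylinder_count F A"
proof -
  let ?F' = "(\<lambda>f. inv\<^bsub>G\<^esub> g \<otimes>\<^bsub>G\<^esub> f) ` F"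
  have 1: "shift G g z \<in> supported_on F" if "z \<in> supported_on ?F'" for z
  proof -
    have "z (inv\<^bsub>G\<^esub> g \<otimes>\<^bsub>G\<^esub> h) = \<one>\<^bsub>K\<^esub>" if h: "h \<in> carrier G - F" for h
    proof -
      have "inv\<^bsub>G\<^esub> g \<otimes>\<^bsub>G\<^esub> h \<notin> ?F'" using h F g by (auto simp: subset_iff)
      then show ?thesis using \<open>z \<in> supported_on ?F'\<close> h g by (auto simp: supported_on_def)
    qed
    then show ?thesis using that g by (auto simp: supported_on_def shift_full G.shift_apply)
  qed
  have 2: "shift G (inv\<^bsub>G\<^esub> g) z \<in> supported_on ?F'" if "z \<in> supported_on F" for z
  proof -
    have "z (g \<otimes>\<^bsub>G\<^esub> h) = \<one>\<^bsub>K\<^esub>" if h: "h \<in> carrier G - ?F'" for h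
    proof -
      have "inv\<^bsub>G\<^esub> g \<otimes>\<^bsub>G\<^esub> (g \<otimes>\<^bsub>G\<^esub> h) = h" using h g by (simp flip: G.m_assoc)
      then have "g \<otimes>\<^bsub>G\<^esub> h \<notin> F" using h by force
      then show ?thesis using \<open>z \<in> supported_on F\<close> h g by (auto simp: supported_on_def)
    qed
    then show ?thesis using that g by (auto simp: supported_on_def shift_full G.shift_apply)
  qed
  have sf: "z \<in> full \<and> z \<in> extensional (carrier G)" if "z \<in> supported_on E" for z E
    using that by (auto simp: supported_on_def full_eq PiE_iff)
  have "bij_betw (shift G g) {z \<in> supported_on ?F'. coset z \<in> {C \<in> carrier (quot_group G K). act g C \<in> A}}
      {z \<in> supported_on F. coset z \<in> A}"
  proof (rule bij_betw_byWitness[where f' = "shift G (inv\<^bsub>G\<^esub> g)"])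
    show "\<forall>z\<in>{z \<in> supported_on ?F'. coset z \<in> {C \<in> carrier (quot_group G K). act g C \<in> A}}.
        shift G (inv\<^bsub>G\<^esub> g) (shift G g z) = z"
      using g sf by (auto simp: G.shift_shift intro!: G.shift_one)
    show "\<forall>z\<in>{z \<in> supported_on F. coset z \<in> A}. shift G g (shift G (inv\<^bsub>G\<^esub> g) z) = z"
      using g sf by (auto simp: G.shift_shift intro!: G.shift_one)
    show "shift G g ` {z \<in> supported_on ?F'. coset z \<in> {C \<in> carrier (quot_group G K). act g C \<in> A}}
        \<subseteq> {z \<in> supported_on F. coset z \<in> A}"
      using 1 g sf by (auto simp: act_coset)
    have "act g (coset (shift G (inv\<^bsub>G\<^esub> g) z)) = coset z" if "z \<in> supported_on F" for z
      using g sf[OF that] by (simp add: act_coset shift_full G.shift_shift G.shift_one)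
    then show "shift G (inv\<^bsub>G\<^esub> g) ` {z \<in> supported_on F. coset z \<in> A}
        \<subseteq> {z \<in> supported_on ?F'. coset z \<in> {C \<in> carrier (quot_group G K). act g C \<in> A}}"
      using 2 g sf by (auto simp: shift_full carrier_quot)
  qed
  then show ?thesis unfolding cylinder_count_def by (rule bij_betw_same_card)
qed

lemma cylinders_act:
  assumes "A \<in> cylinders" "g \<in> carrier G"
  shows "{C \<in> carrier (quot_group G K). act g C \<in> A} \<in> cylinders"
    and "measure lam {C \<in> carrier (quot_group G K). act g C \<in> A} = measure lam A"
proof -
  obtain F where F: "finite F" "F \<subseteq> carrier G" "depends_on F A"
    using assms by (auto simp: cylinders_def)
  let ?F' = "(\<lambda>f. inv\<^bsub>G\<^esub> g \<otimes>\<^bsub>G\<^esub> f) ` F"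
  have F': "finite ?F'" "?F' \<subseteq> carrier G" "depends_on ?F' {C \<in> carrier (quot_group G K). act g C \<in> A}"
    using F assms by (auto intro: depends_on_act)
  then show "{C \<in> carrier (quot_group G K). act g C \<in> A} \<in> cylinders"
    unfolding cylinders_def by (intro CollectI exI conjI)
  have "inj_on (\<lambda>f. inv\<^bsub>G\<^esub> g \<otimes>\<^bsub>G\<^esub> f) F"
    using F assms by (auto simp: inj_on_def subset_iff)
  then have "card ?F' = card F" by (rule card_image)
  then show "measure lam {C \<in> carrier (quot_group G K). act g C \<in> A} = measure lam A"
    using cylinder_count_act[OF assms(2) F(2)]
    by (simp add: measure_cylinder[OF F] measure_cylinder[OF F'])
qed

lemma cylinders_Int: "A \<in> cylinders \<Longrightarrow> B \<in> cylinders \<Longrightarrow> A \<inter> B \<in> cylinders"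
proof -
  assume "A \<in> cylinders" "B \<in> cylinders"
  then obtain F F' where F: "finite F" "F \<subseteq> carrier G" "depends_on F A"
     "finite F'" "F' \<subseteq> carrier G" "depends_on F' B"
    unfolding cylinders_def by blast
  then have "depends_on (F \<union> F') (A \<inter> B)"
    by (intro depends_on_Int) (blast intro: depends_on_mono)+
  moreover have "finite (F \<union> F')" "F \<union> F' \<subseteq> carrier G" using F by auto
  ultimately show "A \<inter> B \<in> cylinders" unfolding cylinders_def by blast
qed

lemma cylinders_compl: "A \<in> cylinders \<Longrightarrow> carrier (quot_group G K) - A \<in> cylinders"
  unfolding cylinders_def using depends_on_compl by blast

lemma cylinders_empty: "{} \<in> cylinders"
  unfolding cylinders_def by (auto simp: depends_on_def intro!: exI[of _ "{}"])

lemma cylinders_space: "carrier (quot_group G K) \<in> cylinders"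
  using cylinders_compl[OF cylinders_empty] by simp

lemma cylinders_into: "A \<in> cylinders \<Longrightarrow> A \<subseteq> carrier (quot_group G K)"
  unfolding cylinders_def depends_on_def by blast

lemma cylinders_Un: "A \<in> cylinders \<Longrightarrow> B \<in> cylinders \<Longrightarrow> A \<union> B \<in> cylinders"
proof -
  assume AB: "A \<in> cylinders" "B \<in> cylinders"
  have "A \<union> B = carrier (quot_group G K) - ((carrier (quot_group G K) - A) \<inter> (carrier (quot_group G K) - B))"
    using AB cylinders_into by blast
  then show ?thesis using AB cylinders_compl cylinders_Int by simp
qed

lemma cylinders_UN:
  assumes "finite I" "\<And>i. i \<in> I \<Longrightarrow> A i \<in> cylinders"
  shows "(\<Union>i\<in>I. A i) \<in> cylinders"
  using assms by (induction I) (auto simp: cylinders_empty intro: cylinders_Un)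

lemma act_measurable [measurable]:
  assumes "g \<in> carrier G"
  shows "act g \<in> measurable lam lam"
proof (rule measurable_sigma_sets[OF sets_lam])
  show "cylinders \<subseteq> Pow (carrier (quot_group G K))" using cylinders_into by auto
  show "act g \<in> space lam \<rightarrow> carrier (quot_group G K)"
    using act_closed assms by (auto simp: space_lam)
  fix A assume "A \<in> cylinders"
  then have "{C \<in> carrier (quot_group G K). act g C \<in> A} \<in> sets lam"
    using cylinders_act assms cylinders_sets by blast
  then show "act g -` A \<inter> space lam \<in> sets lam"
    by (simp add: space_lam vimage_def Int_def conj_commute)
qed

text \<open>
  Cylinder sets form a generating \<open>\<pi>\<close>-system on which the two measures agree by counting patterns.
\<close>

lemma act_distr:
  assumes g: "g \<in> carrier G"
  shows "distr lam lam (act g) = lam"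
proof (rule measure_eqI_generator_eq[where E = cylinders and \<Omega> = "carrier (quot_group G K)"
      and A = "\<lambda>_. carrier (quot_group G K)"])
  show "Int_stable cylinders" by (auto simp: Int_stable_def cylinders_Int)
  show "cylinders \<subseteq> Pow (carrier (quot_group G K))" using cylinders_into by auto
  fix A assume A: "A \<in> cylinders"
  have "act g -` A \<inter> space lam = {C \<in> carrier (quot_group G K). act g C \<in> A}"
    by (auto simp: space_lam)
  then show "emeasure (distr lam lam (act g)) A = emeasure lam A"
    using A cylinders_sets cylinders_act[OF A g] g
    by (subst emeasure_distr) (auto simp: emeasure_eq_measure)
next
  interpret D: prob_space "distr lam lam (act g)" by (rule prob_space_distr) (use g in simp)
  show "emeasure (distr lam lam (act g)) (carrier (quot_group G K)) \<noteq> \<infinity>" by simp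
qed (auto simp: sets_lam cylinders_space)

lemma measure_act:
  assumes "g \<in> carrier G" "A \<in> sets lam"
  shows "measure lam {C \<in> carrier (quot_group G K). act g C \<in> A} = measure lam A"
proof -
  have "measure (distr lam lam (act g)) A = measure lam {C \<in> carrier (quot_group G K). act g C \<in> A}"
    using assms by (subst measure_distr) (auto simp: space_lam intro!: arg_cong[of _ _ "measure lam"])
  then show ?thesis using act_distr[OF assms(1)] by simp
qed

lemma sets_act:
  assumes "g \<in> carrier G" "A \<in> sets lam"
  shows "{C \<in> carrier (quot_group G K). act g C \<in> A} \<in> sets lam"
proof -
  have "{C \<in> carrier (quot_group G K). act g C \<in> A} = act g -` A \<inter> space lam"
    by (auto simp: space_lam)
  then show ?thesis using measurable_sets[OF act_measurable] assms by simp
qed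

text \<open>
  The sets that can be approximated form a \<open>\<sigma>\<close>-algebra: a countable union is approximated by finitely
  many of its members, and each of those by a cylinder set.
\<close>

lemma approximate_by_cylinder:
  assumes "A \<in> sets lam" "\<epsilon> > 0"
  shows "\<exists>B\<in>cylinders. measure lam ((A - B) \<union> (B - A)) < \<epsilon>"
proof -
  have "A \<in> sigma_sets (carrier (quot_group G K)) cylinders" using assms sets_lam by simp
  then show ?thesis using \<open>\<epsilon> > 0\<close>
  proof (induction arbitrary: \<epsilon>)
    case (Basic A)
    then show ?case by (intro bexI[of _ A]) auto
  next
    case Empty
    then show ?case by (intro bexI[of _ "{}"]) (auto simp: cylinders_empty)
  next
    case (Compl A)
    then obtain B where B: "B \<in> cylinders" "measure lam ((A - B) \<union> (B - A)) < \<epsilon>" by blast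
    let ?X = "carrier (quot_group G K)"
    have "A \<subseteq> ?X" using sigma_sets_into_sp[OF _ Compl(1)] cylinders_into by auto
    then have "((?X - A) - (?X - B)) \<union> ((?X - B) - (?X - A)) = (A - B) \<union> (B - A)"
      using cylinders_into[OF B(1)] by blast
    then show ?case using B cylinders_compl by (intro bexI[of _ "?X - B"]) auto
  next
    case (Union A)
    have A: "A i \<in> sets lam" for i using Union(1) sets_lam by simp
    have "(\<lambda>n. measure lam (\<Union>i<n. A i)) \<longlonglongrightarrow> measure lam (\<Union>n. \<Union>i<n. A i)"
      by (rule finite_Lim_measure_incseq) (use A in \<open>auto simp: incseq_def, fastforce\<close>)
    moreover have "(\<Union>n. \<Union>i<n. A i) = (\<Union>n. A n)" by auto
    ultimately have "(\<lambda>n. measure lam (\<Union>i<n. A i)) \<longlonglongrightarrow> measure lam (\<Union>n. A n)" by simp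
    then have "eventually (\<lambda>n. measure lam (\<Union>i<n. A i) > measure lam (\<Union>n. A n) - \<epsilon> / 2) sequentially"
      using \<open>\<epsilon> > 0\<close> by (intro order_tendstoD) auto
    then obtain N where N: "measure lam (\<Union>i<N. A i) > measure lam (\<Union>n. A n) - \<epsilon> / 2"
      by (auto simp: eventually_sequentially)
    have "\<exists>B\<in>cylinders. measure lam ((A i - B) \<union> (B - A i)) < \<epsilon> / (2 * (real N + 1))" for i
      using Union(2)[of "\<epsilon> / (2 * (real N + 1))" i] \<open>\<epsilon> > 0\<close> by simp
    then obtain B where B: "\<And>i. B i \<in> cylinders"
      "\<And>i. measure lam ((A i - B i) \<union> (B i - A i)) < \<epsilon> / (2 * (real N + 1))"
      by metis
    have Bs: "B i \<in> sets lam" for i using B cylinders_sets by auto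
    let ?U = "\<Union>n. A n" and ?V = "\<Union>i<N. B i"
    have "measure lam ((?U - ?V) \<union> (?V - ?U)) \<le>
        measure lam ((?U - (\<Union>i<N. A i)) \<union> (\<Union>i<N. (A i - B i) \<union> (B i - A i)))"
      using A Bs by (intro finite_measure_mono) auto
    also have "\<dots> \<le> measure lam (?U - (\<Union>i<N. A i)) + measure lam (\<Union>i<N. (A i - B i) \<union> (B i - A i))"
      using A Bs by (intro measure_Un_le) auto
    also have "measure lam (?U - (\<Union>i<N. A i)) = measure lam ?U - measure lam (\<Union>i<N. A i)"
      using A by (intro finite_measure_Diff) auto
    also have "measure lam (\<Union>i<N. (A i - B i) \<union> (B i - A i)) \<le>
        (\<Sum>i<N. measure lam ((A i - B i) \<union> (B i - A i)))"
      using A Bs by (intro finite_measure_subadditive_finite) auto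
    also have "\<dots> \<le> (\<Sum>i<N. \<epsilon> / (2 * (real N + 1)))"
      using B(2) by (intro sum_mono) (simp add: less_imp_le)
    also have "\<dots> \<le> \<epsilon> / 2" using \<open>\<epsilon> > 0\<close> by (simp add: field_simps)
    finally have "measure lam ((?U - ?V) \<union> (?V - ?U)) < \<epsilon>" using N by linarith
    moreover have "?V \<in> cylinders" using B by (intro cylinders_UN) auto
    ultimately show ?case by blast
  qed
qed

lemma measure_close:
  assumes "A \<in> sets lam" "B \<in> sets lam" "measure lam ((A - B) \<union> (B - A)) < \<epsilon>"
  shows "\<bar>measure lam A - measure lam B\<bar> < \<epsilon>"
proof -
  have "measure lam A \<le> measure lam (B \<union> ((A - B) \<union> (B - A)))"
       "measure lam B \<le> measure lam (A \<union> ((A - B) \<union> (B - A)))"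
    using assms by (auto intro!: finite_measure_mono)
  moreover have "measure lam (B \<union> ((A - B) \<union> (B - A))) \<le> measure lam B + measure lam ((A - B) \<union> (B - A))"
     "measure lam (A \<union> ((A - B) \<union> (B - A))) \<le> measure lam A + measure lam ((A - B) \<union> (B - A))"
    using assms by (auto intro!: measure_Un_le)
  ultimately show ?thesis using assms by linarith
qed

lemma finite_not_disjoint_translates:
  assumes "finite F" "F \<subseteq> carrier G" "finite F'" "F' \<subseteq> carrier G"
  shows "finite {g \<in> carrier G. (\<lambda>f. inv\<^bsub>G\<^esub> g \<otimes>\<^bsub>G\<^esub> f) ` F' \<inter> F \<noteq> {}}"
proof (rule finite_subset)
  show "{g \<in> carrier G. (\<lambda>f. inv\<^bsub>G\<^esub> g \<otimes>\<^bsub>G\<^esub> f) ` F' \<inter> F \<noteq> {}} \<subseteq>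
      (\<lambda>(f', f). f' \<otimes>\<^bsub>G\<^esub> inv\<^bsub>G\<^esub> f) ` (F' \<times> F)"
  proof
    fix g assume "g \<in> {g \<in> carrier G. (\<lambda>f. inv\<^bsub>G\<^esub> g \<otimes>\<^bsub>G\<^esub> f) ` F' \<inter> F \<noteq> {}}"
    then obtain f' where g: "g \<in> carrier G" "f' \<in> F'" "inv\<^bsub>G\<^esub> g \<otimes>\<^bsub>G\<^esub> f' \<in> F" by auto
    then have "f' \<in> carrier G" using assms by auto
    then have "g = f' \<otimes>\<^bsub>G\<^esub> inv\<^bsub>G\<^esub> (inv\<^bsub>G\<^esub> g \<otimes>\<^bsub>G\<^esub> f')"
      using g by (simp add: G.inv_mult_group flip: G.m_assoc)
    then show "g \<in> (\<lambda>(f', f). f' \<otimes>\<^bsub>G\<^esub> inv\<^bsub>G\<^esub> f) ` (F' \<times> F)"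
      using g by (intro image_eqI[of _ _ "(f', inv\<^bsub>G\<^esub> g \<otimes>\<^bsub>G\<^esub> f')"]) auto
  qed
qed (use assms in auto)

lemma exists_disjoint_translate:
  assumes "finite F" "F \<subseteq> carrier G" "finite F'" "F' \<subseteq> carrier G"
  shows "\<exists>g\<in>carrier G. (\<lambda>f. inv\<^bsub>G\<^esub> g \<otimes>\<^bsub>G\<^esub> f) ` F' \<inter> F = {}"
proof (rule ccontr)
  assume "\<not> ?thesis"
  then have "{g \<in> carrier G. (\<lambda>f. inv\<^bsub>G\<^esub> g \<otimes>\<^bsub>G\<^esub> f) ` F' \<inter> F \<noteq> {}} = carrier G" by blast
  then show False using finite_not_disjoint_translates[OF assms] infinite_G by simp
qed

lemma measure_Int_disjoint:
  assumes "finite F" "F \<subseteq> carrier G" "depends_on F A"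
    and "finite F'" "F' \<subseteq> carrier G" "depends_on F' B" and "F \<inter> F' = {}"
  shows "measure lam (A \<inter> B) = measure lam A * measure lam B"
  using assms by (intro measure_Int_cylinder_indep[of F'] depends_on_measurable[of F])
    (auto intro: depends_on_mono)

text \<open>
  This form of ergodicity is all that the allocation of edges needs. Replace \<open>U\<close> and \<open>V\<close> by cylinder sets
  and take \<open>g\<close> so far out that the two sets of coordinates become disjoint; then the events are
  independent, and their intersection is too large to be due to the error of approximation.
\<close>

lemma shift_moves_into:
  assumes U: "U \<in> sets lam" "measure lam U > 0" and V: "V \<in> sets lam" "measure lam V > 0"
  shows "\<exists>g\<in>carrier G. measure lam {C \<in> U. act g C \<in> V} > 0"
proof (rule ccontr)
  assume contra: "\<not> ?thesis"
  let ?u = "measure lam U" and ?v = "measure lam V" and ?X = "carrier (quot_group G K)"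
  define \<epsilon> where "\<epsilon> = ?u * ?v / 8"
  have uv: "?u \<le> 1" "?v \<le> 1" by simp_all
  have \<epsilon>: "\<epsilon> > 0" using U V by (simp add: \<epsilon>_def)
  obtain U' where U': "U' \<in> cylinders" "measure lam ((U - U') \<union> (U' - U)) < \<epsilon>"
    using approximate_by_cylinder[OF U(1) \<epsilon>] by blast
  obtain V' where V': "V' \<in> cylinders" "measure lam ((V - V') \<union> (V' - V)) < \<epsilon>"
    using approximate_by_cylinder[OF V(1) \<epsilon>] by blast
  obtain F where F: "finite F" "F \<subseteq> carrier G" "depends_on F U'"
    using U' by (auto simp: cylinders_def)
  obtain F' where F': "finite F'" "F' \<subseteq> carrier G" "depends_on F' V'"
    using V' by (auto simp: cylinders_def)
  obtain g where g: "g \<in> carrier G" "(\<lambda>f. inv\<^bsub>G\<^esub> g \<otimes>\<^bsub>G\<^esub> f) ` F' \<inter> F = {}"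
    using exists_disjoint_translate[OF F(1,2) F'(1,2)] by blast
  let ?p = "\<lambda>A. {C \<in> ?X. act g C \<in> A}"
  have sU: "U' \<in> sets lam" and sV: "V' \<in> sets lam" using U' V' cylinders_sets by auto
  have "{C \<in> U. act g C \<in> V} = U \<inter> ?p V"
    using sets.sets_into_space[OF U(1)] by (auto simp: space_lam)
  then have sUV: "{C \<in> U. act g C \<in> V} \<in> sets lam"
    using U(1) sets_act[OF g(1) V(1)] by simp
  have sVV: "?p ((V - V') \<union> (V' - V)) \<in> sets lam"
    by (rule sets_act[OF g(1)]) (use V(1) sV in auto)
  have "measure lam (U' \<inter> ?p V') = measure lam U' * measure lam (?p V')"
    using F F' g by (intro measure_Int_disjoint[OF F, of "(\<lambda>f. inv\<^bsub>G\<^esub> g \<otimes>\<^bsub>G\<^esub> f) ` F'"])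
      (auto intro: depends_on_act)
  then have "measure lam U' * measure lam V' = measure lam (U' \<inter> ?p V')"
    using measure_act[OF g(1) sV] by simp
  also have "\<dots> \<le> measure lam ({C \<in> U. act g C \<in> V} \<union> ((U - U') \<union> (U' - U)) \<union> ?p ((V - V') \<union> (V' - V)))"
    using sUV sU U(1) sVV by (intro finite_measure_mono sets.Un sets.Diff) auto
  also have "\<dots> \<le> measure lam ({C \<in> U. act g C \<in> V} \<union> ((U - U') \<union> (U' - U))) + measure lam (?p ((V - V') \<union> (V' - V)))"
    using sUV sU U(1) sVV by (intro measure_Un_le sets.Un sets.Diff)
  also have "measure lam ({C \<in> U. act g C \<in> V} \<union> ((U - U') \<union> (U' - U))) \<le>
      measure lam {C \<in> U. act g C \<in> V} + measure lam ((U - U') \<union> (U' - U))"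
    using sUV sU U(1) by (intro measure_Un_le sets.Un sets.Diff)
  also have "measure lam {C \<in> U. act g C \<in> V} = 0"
  proof -
    have "\<not> measure lam {C \<in> U. act g C \<in> V} > 0" using contra g(1) by blast
    then show ?thesis using measure_nonneg[of lam "{C \<in> U. act g C \<in> V}"] by linarith
  qed
  also have "measure lam (?p ((V - V') \<union> (V' - V))) = measure lam ((V - V') \<union> (V' - V))"
    using g V sV by (intro measure_act) auto
  finally have "measure lam U' * measure lam V' \<le> 2 * \<epsilon>" using U' V' by linarith
  moreover have "(?u - \<epsilon>) * (?v - \<epsilon>) \<le> measure lam U' * measure lam V'"
  proof (rule mult_mono)
    show "?u - \<epsilon> \<le> measure lam U'" "?v - \<epsilon> \<le> measure lam V'"
      using measure_close[OF U(1) sU U'(2)] measure_close[OF V(1) sV V'(2)] by linarith+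
    have "?u * ?v \<le> 1 * ?v" using U V uv by (intro mult_right_mono) auto
    then show "0 \<le> ?v - \<epsilon>" unfolding \<epsilon>_def using V by linarith
  qed simp
  moreover have "(?u - \<epsilon>) * (?v - \<epsilon>) = ?u * ?v - \<epsilon> * (?u + ?v) + \<epsilon> * \<epsilon>"
    by (simp add: algebra_simps)
  moreover have "\<epsilon> * (?u + ?v) \<le> \<epsilon> * 2" 
    by (intro mult_left_mono) (use uv \<epsilon> in linarith)+
  moreover have "\<epsilon> * \<epsilon> > 0" using \<epsilon> by simp
  ultimately have "?u * ?v < 4 * \<epsilon>" by linarith
  then show False using U V by (simp add: \<epsilon>_def)
qed

end

section \<open>Markers\<close>

context coset_shift
begin

lemma measure_cylinder_ge:
  assumes F: "finite F" "F \<subseteq> carrier G" and B: "depends_on F B" "B \<noteq> {}"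
  shows "measure lam B \<ge> 1 / real (card (carrier K)) ^ card F"
proof -
  obtain x where x: "x \<in> full" "coset x \<in> B"
    using B unfolding depends_on_def carrier_quot by blast
  define z where "z = (\<lambda>h\<in>carrier G. if h \<in> F then x h else \<one>\<^bsub>K\<^esub>)"
  have z: "z \<in> supported_on F" using x by (auto simp: z_def supported_on_def full_eq PiE_iff)
  have "coset z \<in> B \<longleftrightarrow> coset x \<in> B"
    using z x F(2) by (intro depends_onD[OF B(1)]) (auto simp: supported_on_def z_def)
  then have "z \<in> {z \<in> supported_on F. coset z \<in> B}" using z x by simp
  then have "cylinder_count F B > 0"
    unfolding cylinder_count_def using finite_supported_on[OF F(2,1)] by (auto simp: card_gt_0_iff)
  then show ?thesis using card_K_pos by (simp add: measure_cylinder[OF F B(1)] divide_right_mono)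
qed

text \<open>
  The condition at \<open>u\<close> breaks every symmetry that the shape of \<open>F\<close> may have; without it, a nontrivial
  \<open>s\<close> with \<open>s F = F\<close> would make \<open>marker_separates\<close> below fail.
\<close>

definition marker :: "'g set \<Rightarrow> 'g \<Rightarrow> ('g \<Rightarrow> 'k) set set" where
  "marker F u = {C \<in> carrier (quot_group G K).
     (\<forall>f\<in>F. ratio C f \<one>\<^bsub>G\<^esub> = \<one>\<^bsub>K\<^esub>) \<and> ratio C u \<one>\<^bsub>G\<^esub> \<noteq> \<one>\<^bsub>K\<^esub>}"

lemma marker_coset:
  assumes "x \<in> full" "F \<subseteq> carrier G" "u \<in> carrier G"
  shows "coset x \<in> marker F u \<longleftrightarrow> (\<forall>f\<in>F. x f = x \<one>\<^bsub>G\<^esub>) \<and> x u \<noteq> x \<one>\<^bsub>G\<^esub>"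
proof -
  have "ratio (coset x) f \<one>\<^bsub>G\<^esub> = \<one>\<^bsub>K\<^esub> \<longleftrightarrow> x f = x \<one>\<^bsub>G\<^esub>" if "f \<in> carrier G" for f
    using that assms(1) full_closed[OF assms(1)]
    by (simp add: ratio_coset K.inv_solve_right')
  then show ?thesis using assms by (auto simp: marker_def carrier_quot subset_iff)
qed

lemma marker_depends:
  assumes "F \<subseteq> carrier G" "u \<in> carrier G" "\<one>\<^bsub>G\<^esub> \<in> F"
  shows "depends_on (insert u F) (marker F u)"
proof (rule depends_onI)
  show "marker F u \<subseteq> carrier (quot_group G K)" by (auto simp: marker_def)
  fix x y assume xy: "x \<in> full" "y \<in> full" and eq: "\<And>f. f \<in> insert u F \<Longrightarrow> x f = y f"
    and x: "coset x \<in> marker F u"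
  have e: "x f = y f" if "f \<in> F" for f using eq that by blast
  have "x u = y u" using eq by blast
  moreover have "x \<one>\<^bsub>G\<^esub> = y \<one>\<^bsub>G\<^esub>" using e assms(3) .
  moreover have "y f = y \<one>\<^bsub>G\<^esub>" if "f \<in> F" for f
    using x e[OF that] e[OF assms(3)] that unfolding marker_coset[OF xy(1) assms(1,2)] by metis
  moreover have "x u \<noteq> x \<one>\<^bsub>G\<^esub>" using x unfolding marker_coset[OF xy(1) assms(1,2)] by blast
  ultimately show "coset y \<in> marker F u"
    unfolding marker_coset[OF xy(2) assms(1,2)] by simp
qed

text \<open>
  A pattern in the marker set is determined by its values at \<open>1\<close> and at \<open>u\<close>.
\<close>

lemma measure_marker_le:
  assumes F: "finite F" "F \<subseteq> carrier G" "\<one>\<^bsub>G\<^esub> \<in> F" and u: "u \<in> carrier G" "u \<notin> F"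
  shows "measure lam (marker F u) \<le> real (card (carrier K)) ^ 2 / real (card (carrier K)) ^ Suc (card F)"
proof -
  have "cylinder_count (insert u F) (marker F u) \<le> card (carrier K \<times> carrier K)"
    unfolding cylinder_count_def
  proof (rule card_inj_on_le[where f = "\<lambda>z. (z \<one>\<^bsub>G\<^esub>, z u)"])
    show "inj_on (\<lambda>z. (z \<one>\<^bsub>G\<^esub>, z u)) {z \<in> supported_on (insert u F). coset z \<in> marker F u}"
    proof (rule inj_onI)
      fix z w
      assume z: "z \<in> {z \<in> supported_on (insert u F). coset z \<in> marker F u}"
        and w: "w \<in> {z \<in> supported_on (insert u F). coset z \<in> marker F u}"
        and eq: "(z \<one>\<^bsub>G\<^esub>, z u) = (w \<one>\<^bsub>G\<^esub>, w u)"
      have zw: "z \<in> full" "w \<in> full" using z w by (auto simp: supported_on_def)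
      show "z = w"
      proof
        fix h
        show "z h = w h"
        proof (cases "h \<in> carrier G")
          case True
          then show ?thesis
          proof (cases "h \<in> F")
            case True
            then have "z h = z \<one>\<^bsub>G\<^esub>" "w h = w \<one>\<^bsub>G\<^esub>"
              using z w by (simp_all add: marker_coset[OF zw(1) F(2) u(1)] marker_coset[OF zw(2) F(2) u(1)])
            then show ?thesis using eq by simp
          next
            case False
            then show ?thesis using z w eq True by (cases "h = u") (auto simp: supported_on_def)
          qed
        next
          case False
          then show ?thesis using zw by (auto simp: full_eq PiE_iff extensional_def)
        qed
      qed
    qed
    show "(\<lambda>z. (z \<one>\<^bsub>G\<^esub>, z u)) ` {z \<in> supported_on (insert u F). coset z \<in> marker F u}
        \<subseteq> carrier K \<times> carrier K"
      using u full_closed by (auto simp: supported_on_def)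
  qed (use finite_K in auto)
  then have "real (cylinder_count (insert u F) (marker F u)) \<le> real (card (carrier K)) ^ 2"
    by (simp add: card_cartesian_product power2_eq_square flip: of_nat_mult)
  moreover have "insert u F \<subseteq> carrier G" "finite (insert u F)" using F u by auto
  ultimately show ?thesis
    using measure_cylinder[OF _ _ marker_depends[OF F(2) u(1) F(3)]] F u
    by (simp add: divide_right_mono)
qed

text \<open>
  The witness is the function that is nontrivial only at \<open>u\<close>. If its shift by \<open>s\<close>, which is nontrivial only
  at \<open>s u\<close>, were in the marker set, then the value at \<open>u\<close> would be the exceptional one and \<open>s u = u\<close>,
  or the value at \<open>1\<close> would be nontrivial and could not recur at the other points of \<open>F\<close>.
\<close>

lemma marker_separates:
  assumes F: "finite F" "F \<subseteq> carrier G" "\<one>\<^bsub>G\<^esub> \<in> F" "card F \<ge> 2"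
    and u: "u \<in> carrier G" "u \<notin> F" and K: "card (carrier K) \<ge> 2"
  obtains C where "C \<in> marker F u"
    "\<And>s. s \<in> carrier G \<Longrightarrow> s \<noteq> \<one>\<^bsub>G\<^esub> \<Longrightarrow> act s C \<notin> marker F u"
proof -
  have "\<exists>k\<in>carrier K. k \<noteq> \<one>\<^bsub>K\<^esub>"
  proof (rule ccontr)
    assume "\<not> ?thesis"
    then have "carrier K \<subseteq> {\<one>\<^bsub>K\<^esub>}" by auto
    then have "card (carrier K) \<le> 1" using card_mono[of "{\<one>\<^bsub>K\<^esub>}" "carrier K"] by simp
    then show False using K by simp
  qed
  then obtain k where k: "k \<in> carrier K" "k \<noteq> \<one>\<^bsub>K\<^esub>" by auto
  define x where "x = (\<lambda>h\<in>carrier G. if h = u then k else \<one>\<^bsub>K\<^esub>)"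
  have x: "x \<in> full" using k by (auto simp: x_def full_eq)
  show thesis
  proof
    show "coset x \<in> marker F u" using x F u k by (auto simp: marker_coset x_def)
    fix s assume s: "s \<in> carrier G" "s \<noteq> \<one>\<^bsub>G\<^esub>"
    show "act s (coset x) \<notin> marker F u"
    proof
      assume "act s (coset x) \<in> marker F u"
      then have m: "\<And>f. f \<in> F \<Longrightarrow> x (inv\<^bsub>G\<^esub> s \<otimes>\<^bsub>G\<^esub> f) = x (inv\<^bsub>G\<^esub> s)"
        "x (inv\<^bsub>G\<^esub> s \<otimes>\<^bsub>G\<^esub> u) \<noteq> x (inv\<^bsub>G\<^esub> s)"
        using x s F(2) u by (auto simp: act_coset marker_coset shift_full G.shift_apply subset_iff)
      show False
      proof (cases "inv\<^bsub>G\<^esub> s = u")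
        case True
        have "F \<subseteq> {\<one>\<^bsub>G\<^esub>}"
        proof
          fix f assume f: "f \<in> F"
          then have "x (u \<otimes>\<^bsub>G\<^esub> f) = k" using m(1)[OF f] True u by (simp add: x_def)
          then have "u \<otimes>\<^bsub>G\<^esub> f = u" using k u F(2) f by (auto simp: x_def split: if_splits)
          then show "f \<in> {\<one>\<^bsub>G\<^esub>}" using u F(2) f by (auto simp: subset_iff)
        qed
        then have "card F \<le> 1" using card_mono[of "{\<one>\<^bsub>G\<^esub>}" F] by simp
        then show False using F by simp
      next
        case False
        then have "x (inv\<^bsub>G\<^esub> s \<otimes>\<^bsub>G\<^esub> u) \<noteq> \<one>\<^bsub>K\<^esub>" using m(2) s by (simp add: x_def)
        then have "inv\<^bsub>G\<^esub> s \<otimes>\<^bsub>G\<^esub> u = u" using s u by (auto simp: x_def split: if_splits)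
        then have "inv\<^bsub>G\<^esub> s = \<one>\<^bsub>G\<^esub>" using s u by simp
        then show False using s by (simp add: G.inv_eq_1_iff)
      qed
    qed
  qed
qed

text \<open>
  Let \<open>W h\<close> be the event that \<open>h x\<close> and \<open>h g x\<close> agree about the marker set. It depends on finitely many
  coordinates, and its complement has measure at least \<open>\<eta>\<close>, which does not depend on \<open>h\<close>, by
  \<open>marker_separates\<close>. The exceptional set \<open>N\<close> is contained in every \<open>W h\<close>. For \<open>h\<close> far out, \<open>W h\<close> is
  independent of a cylinder set close to \<open>N\<close>, so the measure of \<open>N\<close> is at most \<open>1 - \<eta>\<close> times itself, up to
  an arbitrarily small error.
\<close>

lemma marker_free:
  assumes F: "finite F" "F \<subseteq> carrier G" "\<one>\<^bsub>G\<^esub> \<in> F" "card F \<ge> 2"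
    and u: "u \<in> carrier G" "u \<notin> F" and K: "card (carrier K) \<ge> 2"
    and g: "g \<in> carrier G" "g \<noteq> \<one>\<^bsub>G\<^esub>"
  shows "{C \<in> carrier (quot_group G K). \<forall>h\<in>carrier G.
      act h C \<in> marker F u \<longleftrightarrow> act h (act g C) \<in> marker F u} \<in> null_sets lam"
proof -
  let ?X = "carrier (quot_group G K)" and ?E = "marker F u" and ?S = "insert u F"
  define W where "W h = {C \<in> ?X. act h C \<in> ?E \<longleftrightarrow> act h (act g C) \<in> ?E}" for h
  define N where "N = {C \<in> ?X. \<forall>h\<in>carrier G. act h C \<in> ?E \<longleftrightarrow> act h (act g C) \<in> ?E}"
  define T where "T h = (\<lambda>f. inv\<^bsub>G\<^esub> h \<otimes>\<^bsub>G\<^esub> f) ` ?S" for h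
  define \<eta> where "\<eta> = 1 / real (card (carrier K)) ^ (2 * card ?S)"
  have S: "finite ?S" "?S \<subseteq> carrier G" using F u by auto
  have E: "depends_on ?S ?E" using F u by (intro marker_depends)
  have \<eta>: "\<eta> > 0" using card_K_pos by (simp add: \<eta>_def)
  have ne: "carrier G \<noteq> {}" using G.one_closed by blast
  have T: "finite (T h)" "T h \<subseteq> carrier G" "card (T h) \<le> card ?S" if "h \<in> carrier G" for h
    using that S card_image_le[OF S(1)] by (auto simp: T_def)
  have dW: "depends_on (T h \<union> T (h \<otimes>\<^bsub>G\<^esub> g)) (W h)" if h: "h \<in> carrier G" for h
  proof (rule depends_onI)
    show "W h \<subseteq> ?X" by (auto simp: W_def)
    fix x y assume xy: "x \<in> full" "y \<in> full" and eq: "\<And>f. f \<in> T h \<union> T (h \<otimes>\<^bsub>G\<^esub> g) \<Longrightarrow> x f = y f"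
      and "coset x \<in> W h"
    have "coset x \<in> {C \<in> ?X. act a C \<in> ?E} \<longleftrightarrow> coset y \<in> {C \<in> ?X. act a C \<in> ?E}"
      if "a \<in> {h, h \<otimes>\<^bsub>G\<^esub> g}" for a
      using that h g eq
      by (intro depends_onD[OF depends_on_act[OF E _ S(2)] xy]) (auto simp: T_def)
    then show "coset y \<in> W h"
      using \<open>coset x \<in> W h\<close> xy h g by (auto simp: W_def act_act carrier_quot)
  qed
  have pW: "measure lam (W h) \<le> 1 - \<eta>" if h: "h \<in> carrier G" for h
  proof -
    obtain D where D: "D \<in> ?E" "\<And>s. s \<in> carrier G \<Longrightarrow> s \<noteq> \<one>\<^bsub>G\<^esub> \<Longrightarrow> act s D \<notin> ?E"
      using marker_separates[OF F u K] by blast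
    have DX: "D \<in> ?X" using D by (simp add: marker_def)
    define C where "C = act (inv\<^bsub>G\<^esub> h) D"
    have "h \<otimes>\<^bsub>G\<^esub> g \<otimes>\<^bsub>G\<^esub> inv\<^bsub>G\<^esub> h \<noteq> \<one>\<^bsub>G\<^esub>"
    proof
      assume "h \<otimes>\<^bsub>G\<^esub> g \<otimes>\<^bsub>G\<^esub> inv\<^bsub>G\<^esub> h = \<one>\<^bsub>G\<^esub>"
      then have "h \<otimes>\<^bsub>G\<^esub> g = h" using h g by (simp add: G.inv_solve_right')
      then show False using h g by simp
    qed
    then have "act (h \<otimes>\<^bsub>G\<^esub> g \<otimes>\<^bsub>G\<^esub> inv\<^bsub>G\<^esub> h) D \<notin> ?E" using h g by (intro D) auto
    then have "act h (act g C) \<notin> ?E"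
      using DX h g by (simp add: C_def act_act act_closed G.m_assoc)
    moreover have "act h C \<in> ?E" using DX h D by (simp add: C_def act_act act_one)
    ultimately have "C \<in> ?X - W h" using DX h by (auto simp: W_def C_def act_closed)
    then have "measure lam (?X - W h) \<ge> 1 / real (card (carrier K)) ^ card (T h \<union> T (h \<otimes>\<^bsub>G\<^esub> g))"
      using T h g by (intro measure_cylinder_ge depends_on_compl dW) auto
    moreover have "card (T h \<union> T (h \<otimes>\<^bsub>G\<^esub> g)) \<le> 2 * card ?S"
      using card_Un_le[of "T h" "T (h \<otimes>\<^bsub>G\<^esub> g)"] T(3)[OF h] T(3)[of "h \<otimes>\<^bsub>G\<^esub> g"] h g by simp
    then have "\<eta> \<le> 1 / real (card (carrier K)) ^ card (T h \<union> T (h \<otimes>\<^bsub>G\<^esub> g))"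
      unfolding \<eta>_def using card_K_pos by (intro divide_left_mono) (auto intro!: power_increasing)
    moreover have "W h \<in> sets lam" using dW[OF h] T h g by (intro depends_on_measurable) auto
    then have "measure lam (?X - W h) = 1 - measure lam (W h)"
      using prob_compl by (simp add: space_lam)
    ultimately show ?thesis by simp
  qed
  have Wm: "W h \<in> sets lam" if "h \<in> carrier G" for h
    using dW[OF that] T that g by (intro depends_on_measurable) auto
  have "N = (\<Inter>h\<in>carrier G. W h)" using ne by (auto simp: N_def W_def)
  then have Nm: "N \<in> sets lam" 
    using Wm countable_G ne by (auto intro!: sets.countable_INT')
  have bound: "measure lam N * \<eta> \<le> 2 * \<epsilon>" if \<epsilon>: "\<epsilon> > 0" "\<epsilon> \<le> 1" for \<epsilon>
  proof -
    obtain N' where N': "N' \<in> cylinders" "measure lam ((N - N') \<union> (N' - N)) < \<epsilon>"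
      using approximate_by_cylinder[OF Nm \<epsilon>(1)] by blast
    obtain H where H: "finite H" "H \<subseteq> carrier G" "depends_on H N'"
      using N' by (auto simp: cylinders_def)
    \<comment> \<open>If \<open>h\<^sup>-\<^sup>1 S\<close> misses \<open>g H\<close>, then \<open>(h g)\<^sup>-\<^sup>1 S\<close> misses \<open>H\<close>.\<close>
    define H' where "H' = H \<union> (\<lambda>h. g \<otimes>\<^bsub>G\<^esub> h) ` H"
    have H': "finite H'" "H' \<subseteq> carrier G" using H g by (auto simp: H'_def)
    have "\<exists>h\<in>carrier G. (\<lambda>f. inv\<^bsub>G\<^esub> h \<otimes>\<^bsub>G\<^esub> f) ` ?S \<inter> H' = {}"
      by (rule exists_disjoint_translate[OF H' S])
    then obtain h where h: "h \<in> carrier G" "T h \<inter> H' = {}" by (auto simp: T_def)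
    have "T (h \<otimes>\<^bsub>G\<^esub> g) \<inter> H = {}"
    proof (rule ccontr)
      assume "\<not> ?thesis"
      then obtain f where f: "f \<in> ?S" "inv\<^bsub>G\<^esub> (h \<otimes>\<^bsub>G\<^esub> g) \<otimes>\<^bsub>G\<^esub> f \<in> H" by (auto simp: T_def)
      have "f \<in> carrier G" using f S by auto
      then have "g \<otimes>\<^bsub>G\<^esub> (inv\<^bsub>G\<^esub> (h \<otimes>\<^bsub>G\<^esub> g) \<otimes>\<^bsub>G\<^esub> f) = inv\<^bsub>G\<^esub> h \<otimes>\<^bsub>G\<^esub> f"
        using h g by (simp add: G.inv_mult_group flip: G.m_assoc)
      then have "inv\<^bsub>G\<^esub> h \<otimes>\<^bsub>G\<^esub> f \<in> H'" using f unfolding H'_def by (metis UnI2 imageI)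
      then show False using h f by (auto simp: T_def)
    qed
    then have "measure lam (N' \<inter> W h) = measure lam N' * measure lam (W h)"
      using h g T by (intro measure_Int_disjoint[OF H _ _ dW]) (auto simp: H'_def)
    moreover have "N' \<in> sets lam" using N' cylinders_sets by auto
    moreover have "measure lam N \<le> measure lam (N' \<inter> W h) + measure lam ((N - N') \<union> (N' - N))"
    proof -
      have "N \<subseteq> W h" using h by (auto simp: N_def W_def)
      then have "measure lam N \<le> measure lam ((N' \<inter> W h) \<union> ((N - N') \<union> (N' - N)))"
        using Nm \<open>N' \<in> sets lam\<close> Wm h by (intro finite_measure_mono) auto
      also have "\<dots> \<le> measure lam (N' \<inter> W h) + measure lam ((N - N') \<union> (N' - N))"
        using Nm \<open>N' \<in> sets lam\<close> Wm h by (intro measure_Un_le) auto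
      finally show ?thesis .
    qed
    moreover have "measure lam N' * measure lam (W h) \<le> (measure lam N + \<epsilon>) * (1 - \<eta>)"
    proof (rule mult_mono)
      show "measure lam N' \<le> measure lam N + \<epsilon>"
        using measure_close[OF Nm \<open>N' \<in> sets lam\<close> N'(2)] by linarith
    qed (use pW h \<epsilon> in auto)
    ultimately have "measure lam N \<le> (measure lam N + \<epsilon>) * (1 - \<eta>) + \<epsilon>" using N' by linarith
    also have "\<dots> = measure lam N - measure lam N * \<eta> + 2 * \<epsilon> - \<epsilon> * \<eta>" by (simp add: algebra_simps)
    finally have "measure lam N * \<eta> \<le> 2 * \<epsilon> - \<epsilon> * \<eta>" by linarith
    moreover have "\<epsilon> * \<eta> > 0" using \<epsilon> \<eta> by simp
    ultimately show ?thesis by linarith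
  qed
  have "measure lam N * \<eta> \<le> 0"
  proof (rule field_le_epsilon)
    fix e :: real assume "e > 0"
    then show "measure lam N * \<eta> \<le> 0 + e"
      using bound[of "min 1 (e / 2)"] by linarith
  qed
  then have "measure lam N = 0" using \<eta> measure_nonneg[of lam N] by (simp add: mult_le_0_iff)
  then show ?thesis using Nm by (simp add: null_sets_def emeasure_eq_measure N_def)
qed

end

section \<open>Greedy allocation and entropy estimates\<close>

lemma suminf_ennreal_swap:
  fixes f :: "nat \<Rightarrow> nat \<Rightarrow> ennreal"
  shows "(\<Sum>i. \<Sum>j. f i j) = (\<Sum>j. \<Sum>i. f i j)"
proof -
  have "(\<Sum>i. \<Sum>j. f i j) = (\<integral>\<^sup>+i. (\<Sum>j. f i j) \<partial>count_space UNIV)"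
    by (simp add: nn_integral_count_space_nat)
  also have "\<dots> = (\<Sum>j. \<integral>\<^sup>+i. f i j \<partial>count_space UNIV)"
    by (intro nn_integral_suminf) auto
  finally show ?thesis by (simp add: nn_integral_count_space_nat)
qed

lemma suminf_ennreal_delta:
  fixes c :: ennreal
  shows "(\<Sum>i. if k = i then c else 0) = c"
  by (subst suminf_finite[of "{k}"]) auto

text \<open>
  Stage \<open>r\<close> handles the points of \<open>A (e r)\<close> that the map \<open>T (n r)\<close>, with inverse \<open>S (n r)\<close>, takes into
  \<open>E\<close>, and puts them in slot \<open>j r\<close> of the target point, unless the point has been handled before or
  the slot has been filled before.
\<close>

function greedy ::
  "(nat \<Rightarrow> 'a set) \<Rightarrow> 'a set \<Rightarrow> (nat \<Rightarrow> 'a \<Rightarrow> 'a) \<Rightarrow> (nat \<Rightarrow> 'a \<Rightarrow> 'a) \<Rightarrow> nat \<Rightarrow>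
    (nat \<Rightarrow> nat) \<Rightarrow> (nat \<Rightarrow> nat) \<Rightarrow> (nat \<Rightarrow> nat) \<Rightarrow> nat \<Rightarrow> 'a set" where
  "greedy A E T S m e n j r = {x \<in> A (e r). T (n r) x \<in> E \<and> j r < m \<and>
     (\<forall>r'<r. e r' = e r \<longrightarrow> x \<notin> greedy A E T S m e n j r') \<and>
     (\<forall>r'<r. j r' = j r \<longrightarrow> S (n r') (T (n r) x) \<notin> greedy A E T S m e n j r')}"
  by pat_completeness auto
termination by (relation "Wellfounded.measure (\<lambda>(A, E, T, S, m, e, n, j, r). r)") auto

declare greedy.simps [simp del]

text \<open>
  All combinations of an index \<open>i\<close>, a map \<open>T n\<close> and a slot occur as stages. If points of some \<open>A i\<close> of
  positive mass were never handled, then less mass than \<open>m\<close> times that of \<open>E\<close> would have been moved, so some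
  slot would be left unfilled with positive mass; but some \<open>T n\<close> takes an unhandled point to a point with that
  slot unfilled, and the corresponding stage should have handled it. The lemma serves as a measurable
  marriage theorem.
\<close>

lemma (in finite_measure) greedy_allocation:
  fixes T S :: "nat \<Rightarrow> 'a \<Rightarrow> 'a"
  assumes T: "\<And>n. T n \<in> measurable M M" and S: "\<And>n. S n \<in> measurable M M"
    and ST: "\<And>n x. x \<in> space M \<Longrightarrow> S n (T n x) = x" and TS: "\<And>n x. x \<in> space M \<Longrightarrow> T n (S n x) = x"
    and pres: "\<And>n B. B \<in> sets M \<Longrightarrow> emeasure M (S n -` B \<inter> space M) = emeasure M B"
    and rec: "\<And>U V. U \<in> sets M \<Longrightarrow> V \<in> sets M \<Longrightarrow> emeasure M U > 0 \<Longrightarrow> emeasure M V > 0 \<Longrightarrow>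
      \<exists>n. \<exists>x\<in>U. T n x \<in> V"
    and A: "\<And>i. A i \<in> sets M" and E: "E \<in> sets M"
    and le: "(\<Sum>i. emeasure M (A i)) \<le> of_nat m * emeasure M E"
  obtains P :: "nat \<Rightarrow> 'a set" and e n j :: "nat \<Rightarrow> nat" where
    "\<And>r. P r \<in> sets M" "\<And>r. P r \<subseteq> A (e r)" "\<And>r x. x \<in> P r \<Longrightarrow> T (n r) x \<in> E"
    "\<And>r x. x \<in> P r \<Longrightarrow> j r < m"
    "\<And>r r' x x'. x \<in> P r \<Longrightarrow> x' \<in> P r' \<Longrightarrow> j r = j r' \<Longrightarrow> T (n r) x = T (n r') x' \<Longrightarrow> r = r'"
    "\<And>i. A i - (\<Union>r\<in>{r. e r = i}. P r) \<in> null_sets M"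
proof -
  define e where "e r = fst (prod_decode r)" for r
  define n where "n r = fst (prod_decode (snd (prod_decode r)))" for r
  define j where "j r = snd (prod_decode (snd (prod_decode r)))" for r
  define P where "P = greedy A E T S m e n j"
  have P: "x \<in> P r \<longleftrightarrow> x \<in> A (e r) \<and> T (n r) x \<in> E \<and> j r < m \<and>
     (\<forall>r'<r. e r' = e r \<longrightarrow> x \<notin> P r') \<and> (\<forall>r'<r. j r' = j r \<longrightarrow> S (n r') (T (n r) x) \<notin> P r')" for x r
    unfolding P_def by (subst greedy.simps) blast
  have As: "A i \<subseteq> space M" for i using A sets.sets_into_space by auto
  have Ps: "P r \<subseteq> space M" for r using P As by blast
  have Pm: "P r \<in> sets M" for r
  proof (induction r rule: less_induct)
    case (less r)
    have "P r = A (e r) \<inter> {x \<in> space M. T (n r) x \<in> E} \<inter> {x \<in> space M. j r < m} \<inter>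
       {x \<in> space M. \<forall>r'\<in>{..<r}. e r' = e r \<longrightarrow> x \<notin> P r'} \<inter>
       {x \<in> space M. \<forall>r'\<in>{..<r}. j r' = j r \<longrightarrow> S (n r') (T (n r) x) \<notin> P r'}"
      by (rule Set.set_eqI) (use As in \<open>auto simp: P[of _ r]\<close>)
    also have "\<dots> \<in> sets M"
    proof -
      note T[measurable] S[measurable] A[measurable] E[measurable]
      have 1: "{x \<in> space M. x \<in> P r'} \<in> sets M" if "r' < r" for r'
        using less[OF that] Ps[of r'] by (simp add: Int_absorb1 Collect_conj_eq flip: Int_def)
      have 2: "{x \<in> space M. S (n r') (T (n r) x) \<in> P r'} \<in> sets M" if "r' < r" for r'
      proof -
        have "(\<lambda>x. S (n r') (T (n r) x)) \<in> measurable M M" by measurable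
        from measurable_sets[OF this less[OF that]] show ?thesis
          by (simp add: vimage_def Int_def conj_commute)
      qed
      have "{x \<in> space M. \<forall>r'\<in>{..<r}. e r' = e r \<longrightarrow> x \<notin> P r'} \<in> sets M"
        using 1 by (intro sets.sets_Collect_finite_All sets.sets_Collect_imp sets.sets_Collect_neg
            sets.sets_Collect_const) auto
      moreover have "{x \<in> space M. \<forall>r'\<in>{..<r}. j r' = j r \<longrightarrow> S (n r') (T (n r) x) \<notin> P r'} \<in> sets M"
        using 2 by (intro sets.sets_Collect_finite_All sets.sets_Collect_imp sets.sets_Collect_neg
            sets.sets_Collect_const) auto
      moreover have "{x \<in> space M. T (n r) x \<in> E} \<in> sets M" by measurable
      ultimately show ?thesis by (intro sets.Int A sets.sets_Collect_const)
    qed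
    finally show ?case .
  qed
  have disjP: "r = r'" if "x \<in> P r" "x \<in> P r'" "e r = e r'" for r r' x
    using that P[of x r] P[of x r'] by (metis linorder_neqE_nat)
  have disjT: "r = r'" if x: "x \<in> P r" "x' \<in> P r'" "j r = j r'" "T (n r) x = T (n r') x'" for r r' x x'
  proof -
    have "S (n r) (T (n r) x) = x" "S (n r') (T (n r') x') = x'" using x Ps ST by blast+
    then have "S (n r) (T (n r') x') = x" "S (n r') (T (n r) x) = x'" using x by simp_all
    then show ?thesis using x P[of x r] P[of x' r'] by (metis linorder_neqE_nat)
  qed
  have null: "A i - (\<Union>r\<in>{r. e r = i}. P r) \<in> null_sets M" for i
  proof (rule ccontr)
    let ?U = "A i - (\<Union>r\<in>{r. e r = i}. P r)"
    assume "?U \<notin> null_sets M"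
    moreover have Um: "?U \<in> sets M" using A Pm by auto
    ultimately have Upos: "emeasure M ?U > 0" by (auto simp: null_sets_def zero_less_iff_neq_zero)
    define Q where "Q k r = (if e r = k then P r else {})" for k r
    define R where "R k r = (if j r = k then S (n r) -` P r \<inter> space M else {})" for k r
    have Qm: "Q k r \<in> sets M" for k r using Pm by (simp add: Q_def)
    have Rm: "R k r \<in> sets M" for k r using measurable_sets[OF S Pm] by (simp add: R_def)
    have "disjoint_family (Q k)" for k
      unfolding disjoint_family_on_def Q_def using disjP by auto
    then have Q: "(\<Sum>r. emeasure M (Q k r)) = emeasure M (\<Union>r. Q k r)" for k
      using Qm by (intro suminf_emeasure) auto
    have RT: "y \<in> R k r \<longleftrightarrow> j r = k \<and> y \<in> space M \<and> (\<exists>x\<in>P r. y = T (n r) x)" for y k r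
    proof
      assume "y \<in> R k r"
      then have "j r = k" "S (n r) y \<in> P r" "y \<in> space M" by (auto simp: R_def split: if_splits)
      then show "j r = k \<and> y \<in> space M \<and> (\<exists>x\<in>P r. y = T (n r) x)"
        using TS[of y "n r"] by (metis (no_types))
    next
      assume "j r = k \<and> y \<in> space M \<and> (\<exists>x\<in>P r. y = T (n r) x)"
      then obtain x where "x \<in> P r" "y = T (n r) x" "j r = k" "y \<in> space M" by blast
      moreover from this have "S (n r) y = x" using ST Ps by blast
      ultimately show "y \<in> R k r" by (simp add: R_def)
    qed
    have "disjoint_family (R k)" for k
    proof -
      have "r = r'" if "y \<in> R k r" "y \<in> R k r'" for y r r'
        using that disjT unfolding RT by blast
      then show ?thesis unfolding disjoint_family_on_def by blast
    qed
    then have R: "(\<Sum>r. emeasure M (R k r)) = emeasure M (\<Union>r. R k r)" for k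
      using Rm by (intro suminf_emeasure) auto
    have QA: "(\<Union>r. Q k r) \<subseteq> A k" for k using P by (auto simp: Q_def split: if_splits)
    have RE: "(\<Union>r. R k r) \<subseteq> E" for k 
    proof
      fix y assume "y \<in> (\<Union>r. R k r)"
      then obtain r where "y \<in> R k r" by blast
      then obtain x where "x \<in> P r" "y = T (n r) x" unfolding RT by blast
      then show "y \<in> E" using P by blast
    qed
    have Psum: "(\<Sum>k. emeasure M (\<Union>r. Q k r)) = (\<Sum>r. emeasure M (P r))"
    proof -
      have "(\<Sum>k. emeasure M (\<Union>r. Q k r)) = (\<Sum>k. \<Sum>r. emeasure M (Q k r))" by (simp add: Q)
      also have "\<dots> = (\<Sum>r. \<Sum>k. emeasure M (Q k r))" by (rule suminf_ennreal_swap)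
      also have "(\<lambda>r. \<Sum>k. emeasure M (Q k r)) = (\<lambda>r. \<Sum>k. if e r = k then emeasure M (P r) else 0)"
        by (intro ext arg_cong[of _ _ suminf]) (simp add: Q_def)
      finally show ?thesis by (simp add: suminf_ennreal_delta)
    qed
    \<comment> \<open>If all slots were filled, the mass moved would be that of all slots, hence at least that of all \<open>A i\<close>.\<close>
    have "\<exists>k<m. emeasure M (\<Union>r. R k r) < emeasure M E"
    proof (rule ccontr)
      assume "\<not> ?thesis"
      then have "emeasure M (\<Union>r. R k r) = emeasure M E" if "k < m" for k
        using that emeasure_mono[OF RE E] by (metis antisym not_le)
      then have "of_nat m * emeasure M E = (\<Sum>k<m. emeasure M (\<Union>r. R k r))" by simp
      also have "\<dots> = (\<Sum>k<m. \<Sum>r. emeasure M (R k r))" by (simp add: R)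
      also have "\<dots> = (\<Sum>r. \<Sum>k<m. emeasure M (R k r))" by (rule suminf_sum[symmetric]) simp
      also have "\<dots> = (\<Sum>r. emeasure M (P r))"
      proof (intro arg_cong[of _ _ suminf] ext)
        fix r
        have "(\<Sum>k<m. emeasure M (R k r)) = (\<Sum>k<m. if k = j r then emeasure M (P r) else 0)"
          by (intro sum.cong refl) (use pres[OF Pm] in \<open>auto simp: R_def\<close>)
        also have "\<dots> = emeasure M (P r)"
        proof (cases "P r = {}")
          case False
          then have "j r < m" using P by blast
          then show ?thesis by (simp add: sum.delta)
        qed simp
        finally show "(\<Sum>k<m. emeasure M (R k r)) = emeasure M (P r)" .
      qed
      finally have *: "(\<Sum>k. emeasure M (A k)) \<le> (\<Sum>k. emeasure M (\<Union>r. Q k r))"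
        using le Psum by simp
      have fin: "(\<Sum>k. emeasure M (A k)) < \<infinity>"
        using le E by (auto simp: less_top[symmetric] ennreal_mult_eq_top_iff top_unique)
      have "(\<Sum>k. emeasure M (A k)) = (\<Sum>k. emeasure M (\<Union>r. Q k r) + emeasure M (A k - (\<Union>r. Q k r)))"
      proof (intro arg_cong[of _ _ suminf] ext)
        fix k
        have "A k = (\<Union>r. Q k r) \<union> (A k - (\<Union>r. Q k r))" using QA by blast
        then show "emeasure M (A k) = emeasure M (\<Union>r. Q k r) + emeasure M (A k - (\<Union>r. Q k r))"
          using Qm A by (subst plus_emeasure) auto
      qed
      also have "\<dots> = (\<Sum>k. emeasure M (\<Union>r. Q k r)) + (\<Sum>k. emeasure M (A k - (\<Union>r. Q k r)))"
        by (rule suminf_add[symmetric]) auto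
      finally have "(\<Sum>k. emeasure M (A k - (\<Union>r. Q k r))) = 0"
      proof -
        assume eq: "(\<Sum>k. emeasure M (A k)) =
          (\<Sum>k. emeasure M (\<Union>r. Q k r)) + (\<Sum>k. emeasure M (A k - (\<Union>r. Q k r)))" (is "_ = ?q + ?d")
        have "?q \<noteq> \<infinity>" using fin unfolding eq by auto
        moreover have "?q + ?d \<le> ?q + 0" using * unfolding eq by simp
        ultimately show ?thesis by (simp add: ennreal_add_left_cancel_le)
      qed
      moreover have "emeasure M (A i - (\<Union>r. Q i r)) \<le> (\<Sum>k. emeasure M (A k - (\<Union>r. Q k r)))"
        using sum_le_suminf[of "\<lambda>k. emeasure M (A k - (\<Union>r. Q k r))" "{i}"] by simp
      moreover have "(\<Union>r. Q i r) = (\<Union>r\<in>{r. e r = i}. P r)" by (auto simp: Q_def split: if_splits)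
      ultimately show False using Upos by simp
    qed
    then obtain k where k: "k < m" "emeasure M (\<Union>r. R k r) < emeasure M E" by blast
    let ?V = "E - (\<Union>r. R k r)"
    have Rum: "(\<Union>r. R k r) \<in> sets M" using Rm by auto
    have "emeasure M ?V > 0"
      using k emeasure_Diff[OF _ E Rum RE] by (simp add: diff_gr0_ennreal)
    then obtain l x where x: "x \<in> ?U" "T l x \<in> ?V"
      using rec[OF Um _ Upos] E Rum by blast
    define r where "r = prod_encode (i, prod_encode (l, k))"
    have r: "e r = i" "n r = l" "j r = k" by (simp_all add: r_def e_def n_def j_def)
    have "x \<in> P r"
    proof (subst P, intro conjI allI impI)
      fix r' assume "r' < r" "j r' = j r"
      moreover have "T l x \<in> space M" using x E sets.sets_into_space by blast
      ultimately show "S (n r') (T (n r) x) \<notin> P r'"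
        using x(2) r by (auto simp: R_def)
    qed (use x r k in auto)
    then show False using x r by auto
  qed
  show thesis
  proof (rule that[of P e n j])
    show "P r \<subseteq> A (e r)" for r using P by blast
    show "T (n r) x \<in> E" if "x \<in> P r" for r x using P that by blast
    show "j r < m" if "x \<in> P r" for r x using P that by blast
  qed (fact Pm disjT null)+
qed

text \<open>
  The tangent of the concave function \<open>- p ln p\<close> at \<open>q\<close>, the source of Gibbs' inequality.
\<close>

lemma minus_mult_ln_le:
  fixes p q :: real
  assumes "p \<ge> 0" "q > 0"
  shows "- (p * ln p) \<le> - p * ln q + q - p"
proof (cases "p = 0")
  case False
  then have p: "p > 0" using assms by simp
  have "ln (q / p) \<le> q / p - 1" using p assms by (intro ln_le_minus_one) simp
  then have "p * ln (q / p) \<le> p * (q / p - 1)" using p by (intro mult_left_mono) auto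
  then show ?thesis using p assms by (simp add: ln_div algebra_simps)
qed (use assms in auto)

text \<open>
  Compare the distribution with the one that spreads the mass \<open>\<delta>\<close> uniformly over the \<open>N\<close> nonzero values:
  the entropy is largest in that case.
\<close>

lemma shannon_entropy_two_level:
  assumes M: "prob_space M" and \<beta>: "\<beta> \<in> measurable M (count_space UNIV)"
    and le: "\<And>x. x \<in> space M \<Longrightarrow> \<beta> x \<le> N" and N: "N > 0"
    and \<delta>: "measure M {x \<in> space M. \<beta> x \<noteq> 0} = \<delta>" "\<delta> > 0" "\<delta> < 1"
  shows "shannon_entropy M \<beta> \<le> ennreal (- (1 - \<delta>) * ln (1 - \<delta>) + \<delta> * ln (real N / \<delta>))"
proof -
  interpret prob_space M by (rule M)
  define p where "p k = measure M (\<beta> -` {k} \<inter> space M)" for k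
  have m: "\<beta> -` B \<inter> space M \<in> sets M" for B using measurable_sets[OF \<beta>] by simp
  have p0: "p 0 = 1 - \<delta>"
  proof -
    have "\<beta> -` {0} \<inter> space M = space M - (\<beta> -` (- {0}) \<inter> space M)" by auto
    moreover have "\<beta> -` (- {0}) \<inter> space M = {x \<in> space M. \<beta> x \<noteq> 0}" by auto
    ultimately show ?thesis using prob_compl[OF m[of "- {0}"]] \<delta> by (simp add: p_def)
  qed
  have pk: "p k = 0" if "k > N" for k
  proof -
    have "\<beta> -` {k} \<inter> space M = {}" using le that by force
    then show ?thesis by (simp add: p_def)
  qed
  have sum1: "(\<Sum>k\<in>{1..N}. p k) = \<delta>"
  proof -
    have "{x \<in> space M. \<beta> x \<noteq> 0} = (\<Union>k\<in>{1..N}. \<beta> -` {k} \<inter> space M)" using le by force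
    then have "\<delta> = measure M (\<Union>k\<in>{1..N}. \<beta> -` {k} \<inter> space M)" using \<delta> by simp
    also have "\<dots> = (\<Sum>k\<in>{1..N}. p k)"
      unfolding p_def by (rule finite_measure_finite_Union) (use m in \<open>auto simp: disjoint_family_on_def\<close>)
    finally show ?thesis by simp
  qed
  have pnn: "0 \<le> - (p k * ln (p k))" for k
    using prob_le_1[of "\<beta> -` {k} \<inter> space M"]
    by (cases "p k = 0") (auto simp: p_def mult_nonneg_nonpos measure_nonneg less_le)
  have "shannon_entropy M \<beta> = (\<Sum>k. ennreal (- (p k * ln (p k))))"
    by (simp add: shannon_entropy_def p_def)
  also have "\<dots> = (\<Sum>k\<in>{0..N}. ennreal (- (p k * ln (p k))))"
    by (rule suminf_finite) (auto simp: pk)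
  also have "\<dots> = ennreal (\<Sum>k\<in>{0..N}. - (p k * ln (p k)))"
    using pnn by (intro sum_ennreal)
  also have "\<dots> \<le> ennreal (- (1 - \<delta>) * ln (1 - \<delta>) + \<delta> * ln (real N / \<delta>))"
  proof (rule ennreal_leI)
    let ?q = "\<delta> / real N"
    have "(\<Sum>k\<in>{0..N}. - (p k * ln (p k))) = - (p 0 * ln (p 0)) + (\<Sum>k\<in>{1..N}. - (p k * ln (p k)))"
      by (subst sum.atLeast_Suc_atMost) auto
    also have "(\<Sum>k\<in>{1..N}. - (p k * ln (p k))) \<le> (\<Sum>k\<in>{1..N}. - p k * ln ?q + ?q - p k)"
      using \<delta> N by (intro sum_mono minus_mult_ln_le) (auto simp: p_def)
    also have "\<dots> = - (\<Sum>k\<in>{1..N}. p k) * ln ?q + real N * ?q - (\<Sum>k\<in>{1..N}. p k)"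
      by (simp add: sum_subtractf sum.distrib sum_distrib_right sum_negf)
    also have "\<dots> = \<delta> * ln (real N / \<delta>)"
      unfolding sum1 using \<delta> N by (simp add: ln_div algebra_simps)
    finally show "(\<Sum>k\<in>{0..N}. - (p k * ln (p k))) \<le> - (1 - \<delta>) * ln (1 - \<delta>) + \<delta> * ln (real N / \<delta>)"
      unfolding p0 by (simp add: algebra_simps)
  qed
  finally show ?thesis .
qed

text \<open>
  Conditioning on the trivial partition.
\<close>

lemma cond_entropy_le_shannon_entropy:
  assumes "prob_space M" and "space M \<in> \<F>"
  shows "cond_entropy M \<alpha> \<F> \<le> shannon_entropy M \<alpha>"
proof -
  interpret prob_space M by fact
  have "uniform_measure M (space M) = M"
    by (rule measure_eqI) (auto simp: emeasure_space_1 Int_absorb1[OF sets.sets_into_space] divide_ennreal_def)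
  then have "cond_entropy_partition M \<alpha> {space M} = shannon_entropy M \<alpha>"
    by (simp add: cond_entropy_partition_def emeasure_space_1)
  moreover have "partition_on (space M) {space M}"
    using not_empty by (auto simp: partition_on_def disjoint_def)
  ultimately show ?thesis
    unfolding cond_entropy_def using assms by (intro INF_lower2[of "{space M}"]) auto
qed

text \<open>
  The part of the entropy that is due to the marker set and to rounding up the number of slots.
\<close>

lemma small_entropy_overhead:
  fixes L \<epsilon> :: real
  assumes "\<epsilon> > 0"
  obtains d where "d > 0" "\<And>\<delta>. 0 < \<delta> \<Longrightarrow> \<delta> < d \<Longrightarrow>
    - (1 - \<delta>) * ln (1 - \<delta>) - \<delta> * ln \<delta> + \<delta> * L < \<epsilon>"
proof -
  have "((\<lambda>\<delta>. - (1 - \<delta>) * ln (1 - \<delta>) - \<delta> * ln \<delta> + \<delta> * L) \<longlongrightarrow> 0) (at_right (0::real))"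
    by real_asymp
  then have "eventually (\<lambda>\<delta>. - (1 - \<delta>) * ln (1 - \<delta>) - \<delta> * ln \<delta> + \<delta> * L < \<epsilon>) (at_right 0)"
    using assms by (rule order_tendstoD)
  then show thesis using that by (auto simp: eventually_at_right_field)
qed

section \<open>A free factor carried by the real line\<close>

lemma sets_borel_of: "sets (borel_of T) = sigma_sets (topspace T) {U. openin T U}"
proof -
  have "{U. openin T U} \<subseteq> Pow (topspace T)" using openin_subset by auto
  then show ?thesis unfolding borel_of_def by (rule sets_measure_of)
qed

lemma space_borel_of: "space (borel_of T) = topspace T"
proof -
  have "{U. openin T U} \<subseteq> Pow (topspace T)" using openin_subset by auto
  then show ?thesis unfolding borel_of_def by (rule space_measure_of)
qed

lemma open_in_borel_of: "openin T U \<Longrightarrow> U \<in> sets (borel_of T)"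
  unfolding sets_borel_of by (auto intro: sigma_sets.Basic)

lemma continuous_map_measurable:
  assumes f: "continuous_map S T f" and M: "sets M = sets (borel_of S)"
  shows "f \<in> measurable M (borel_of T)"
proof (rule measurable_sigma_sets[OF sets_borel_of])
  have space: "space M = topspace S" using sets_eq_imp_space_eq[OF M] by (simp add: space_borel_of)
  show "{U. openin T U} \<subseteq> Pow (topspace T)" using openin_subset by auto
  show "f \<in> space M \<rightarrow> topspace T" using f space by (auto simp: continuous_map_def)
  fix U assume "U \<in> {U. openin T U}"
  then have "openin S {x \<in> topspace S. f x \<in> U}" using f by (auto simp: continuous_map_def)
  moreover have "f -` U \<inter> space M = {x \<in> topspace S. f x \<in> U}" using space by auto
  ultimately show "f -` U \<inter> space M \<in> sets M" using M open_in_borel_of by simp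
qed

text \<open>
  The Cantor space over an arbitrary countable index set.
\<close>

definition bit_topology :: "'i set \<Rightarrow> ('i \<Rightarrow> bool) topology" where
  "bit_topology I = product_topology (\<lambda>_. discrete_topology UNIV) I"

lemma topspace_bit_topology: "topspace (bit_topology I) = (\<Pi>\<^sub>E i\<in>I. UNIV)"
  by (simp add: bit_topology_def)

lemma openin_bit_coordinates:
  assumes "finite F"
  shows "openin (bit_topology I) {y \<in> \<Pi>\<^sub>E i\<in>I. UNIV. \<forall>f\<in>F \<inter> I. y f = b f}"
proof -
  have "openin (bit_topology I) (\<Pi>\<^sub>E i\<in>I. if i \<in> F then {b i} else UNIV)"
    unfolding bit_topology_def
    by (rule product_topology_basis) (auto intro: finite_subset[OF _ assms])
  moreover have "(\<Pi>\<^sub>E i\<in>I. if i \<in> F then {b i} else UNIV) = {y \<in> \<Pi>\<^sub>E i\<in>I. UNIV. \<forall>f\<in>F \<inter> I. y f = b f}"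
  proof (rule Set.set_eqI)
    fix y
    have "(\<forall>i\<in>I. y i \<in> (if i \<in> F then {b i} else UNIV)) \<longleftrightarrow> (\<forall>f\<in>F \<inter> I. y f = b f)" by auto
    then show "y \<in> (\<Pi>\<^sub>E i\<in>I. if i \<in> F then {b i} else UNIV) \<longleftrightarrow>
        y \<in> {y \<in> \<Pi>\<^sub>E i\<in>I. UNIV. \<forall>f\<in>F \<inter> I. y f = b f}"
      unfolding PiE_iff mem_Collect_eq by blast
  qed
  ultimately show ?thesis by simp
qed

lemma completely_metrizable_bit_topology:
  "countable I \<Longrightarrow> completely_metrizable_space (bit_topology I)"
  unfolding bit_topology_def completely_metrizable_space_product_topology
  by (auto simp: completely_metrizable_space_discrete_topology intro: countable_subset[of _ I])

lemma second_countable_bit_topology: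
  assumes "countable I"
  shows "second_countable (bit_topology I)"
proof -
  define Fin where "Fin = {F. finite F \<and> F \<subseteq> I}"
  define V where "V = (\<lambda>(F, S). {y \<in> \<Pi>\<^sub>E i\<in>I. UNIV. \<forall>f\<in>F \<inter> I. y f = (f \<in> S)})"
  have "countable Fin" unfolding Fin_def using assms by (intro countable_Collect_finite_subset)
  then have "countable (V ` (Fin \<times> Fin))" by (intro countable_image countable_SIGMA)
  moreover have op: "openin (bit_topology I) W" if "W \<in> V ` (Fin \<times> Fin)" for W
    using that openin_bit_coordinates by (auto simp: V_def Fin_def)
  moreover have base: "\<exists>W\<in>V ` (Fin \<times> Fin). x \<in> W \<and> W \<subseteq> U"
    if U: "openin (bit_topology I) U" "x \<in> U" for U x
  proof -
    have x: "x \<in> (\<Pi>\<^sub>E i\<in>I. UNIV)"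
      using openin_subset[OF U(1)] U(2) by (auto simp: topspace_bit_topology)
    obtain F where F: "finite F" "F \<subseteq> I"
      "\<And>y. y \<in> (\<Pi>\<^sub>E i\<in>I. UNIV) \<Longrightarrow> (\<And>i. i \<in> F \<Longrightarrow> y i = x i) \<Longrightarrow> y \<in> U"
      by (rule product_open_contains_cylinder[OF U[unfolded bit_topology_def]])
        (simp add: PiE_def)
    have "V (F, {f \<in> F. x f}) \<in> V ` (Fin \<times> Fin)"
      using F by (intro imageI) (auto simp: Fin_def)
    moreover have "x \<in> V (F, {f \<in> F. x f})" using x by (auto simp: V_def)
    moreover have "V (F, {f \<in> F. x f}) \<subseteq> U"
    proof
      fix y assume "y \<in> V (F, {f \<in> F. x f})"
      then show "y \<in> U" using F(2) by (intro F(3)) (auto simp: V_def)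
    qed
    ultimately show ?thesis by blast
  qed
  ultimately show ?thesis
    unfolding second_countable_def
    by (intro exI[of _ "V ` (Fin \<times> Fin)"] conjI ballI allI impI) (assumption, rule op, assumption, elim conjE, rule base)
qed

text \<open>
  The supremal cost ranges over measures on the reals, so the factor, a space of subsets of \<open>G\<close>, is renamed
  by real numbers. Any injection will do, because the topology is transported along it.
\<close>

lemma bits_into_reals:
  assumes "countable I"
  shows "\<exists>\<iota> :: ('i \<Rightarrow> bool) \<Rightarrow> real. inj_on \<iota> (\<Pi>\<^sub>E i\<in>I. UNIV)"
proof -
  obtain f :: "nat set \<Rightarrow> real" where f: "inj f"
    using nat_sets_eqpoll_reals unfolding eqpoll_def by (auto simp: bij_betw_def)
  define \<iota> :: "('i \<Rightarrow> bool) \<Rightarrow> real" where "\<iota> y = f {n. \<exists>i\<in>I. to_nat_on I i = n \<and> y i}" for y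
  have "inj_on \<iota> (\<Pi>\<^sub>E i\<in>I. UNIV)"
  proof (rule inj_onI)
    fix y z assume y: "y \<in> (\<Pi>\<^sub>E i\<in>I. UNIV)" and z: "z \<in> (\<Pi>\<^sub>E i\<in>I. UNIV)" and "\<iota> y = \<iota> z"
    from this(3) have eq: "{n. \<exists>i\<in>I. to_nat_on I i = n \<and> y i} = {n. \<exists>i\<in>I. to_nat_on I i = n \<and> z i}"
      unfolding \<iota>_def by (rule injD[OF f])
    have "y i = z i" if "i \<in> I" for i
    proof -
      have "w i \<longleftrightarrow> to_nat_on I i \<in> {n. \<exists>i\<in>I. to_nat_on I i = n \<and> w i}" for w
        using that inj_on_eq_iff[OF inj_on_to_nat_on[OF assms]] by auto
      from this[of y] this[of z] show ?thesis using eq by simp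
    qed
    then show "y = z" using y z by (intro PiE_ext[of y I "\<lambda>_. UNIV" z]) auto
  qed
  then show ?thesis by blast
qed

locale marked_coset_shift = coset_shift G K lam
  for G :: "('g, 'b) monoid_scheme" and K :: "('k, 'c) monoid_scheme" and lam +
  fixes F :: "'g set" and u :: 'g
  assumes finite_F: "finite F" and F_sub: "F \<subseteq> carrier G" and one_F: "\<one>\<^bsub>G\<^esub> \<in> F"
    and card_F: "card F \<ge> 2" and u_G: "u \<in> carrier G" and u_notin: "u \<notin> F"
    and card_K: "card (carrier K) \<ge> 2"
begin

abbreviation mark :: "('g \<Rightarrow> 'k) set set" where "mark \<equiv> marker F u"

abbreviation bits :: "('g \<Rightarrow> bool) set" where "bits \<equiv> \<Pi>\<^sub>E h\<in>carrier G. UNIV"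

lemma mark_cylinder: "mark \<in> cylinders"
  unfolding cylinders_def
  using marker_depends[OF F_sub u_G one_F] finite_F F_sub u_G
  by (intro CollectI exI[of _ "insert u F"]) auto

definition encode :: "('g \<Rightarrow> bool) \<Rightarrow> real" where
  "encode = (SOME \<iota>. inj_on \<iota> bits)"

lemma inj_encode: "inj_on encode bits"
  unfolding encode_def using someI_ex[OF bits_into_reals[OF countable_G]] .

definition decode :: "real \<Rightarrow> 'g \<Rightarrow> bool" where
  "decode = inv_into bits encode"

lemma encode_eq_iff [simp]: "x \<in> bits \<Longrightarrow> y \<in> bits \<Longrightarrow> encode x = encode y \<longleftrightarrow> x = y"
  using inj_encode by (rule inj_on_eq_iff)

lemma encode_mem [simp]: "y \<in> bits \<Longrightarrow> encode y \<in> encode ` bits"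
  by (rule imageI)

lemma decode_encode [simp]: "y \<in> bits \<Longrightarrow> decode (encode y) = y"
  unfolding decode_def using inj_encode by simp

definition real_topology :: "real topology" where
  "real_topology = quotient_topology (bit_topology (carrier G)) encode"

lemma topspace_real_topology: "topspace real_topology = encode ` bits"
  by (simp add: real_topology_def topspace_quotient_topology topspace_bit_topology)

lemma homeomorphic_encode: "homeomorphic_map (bit_topology (carrier G)) real_topology encode"
  unfolding homeomorphic_map_def real_topology_def
  using quotient_map_quotient_topology inj_encode by (simp add: topspace_bit_topology)

lemma openin_real_topology:
  "openin real_topology U \<longleftrightarrow> U \<subseteq> encode ` bits \<and> openin (bit_topology (carrier G)) {y \<in> bits. encode y \<in> U}"
  by (simp add: real_topology_def openin_quotient_topology topspace_bit_topology)

text \<open>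
  The translates \<open>h\<^sup>-\<^sup>1\<close> make the itinerary equivariant for the shift.
\<close>

definition itinerary :: "('g \<Rightarrow> 'k) set \<Rightarrow> 'g \<Rightarrow> bool" where
  "itinerary C = (\<lambda>h\<in>carrier G. act (inv\<^bsub>G\<^esub> h) C \<in> mark)"

lemma itinerary_bits: "itinerary C \<in> bits"
  by (simp add: itinerary_def)

lemma itinerary_act:
  "C \<in> carrier (quot_group G K) \<Longrightarrow> g \<in> carrier G \<Longrightarrow> itinerary (act g C) = shift G g (itinerary C)"
  by (auto simp: itinerary_def shift_def fun_eq_iff restrict_def act_act G.inv_mult_group)

definition factor_map :: "('g \<Rightarrow> 'k) set \<Rightarrow> real" where
  "factor_map C = encode (itinerary C)"

definition factor_measure :: "real measure" where
  "factor_measure = distr lam (borel_of real_topology) factor_map"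

definition factor_act :: "'g \<Rightarrow> real \<Rightarrow> real" where
  "factor_act g = (\<lambda>r\<in>encode ` bits. encode (shift G g (decode r)))"

lemma space_factor: "space factor_measure = encode ` bits"
  by (simp add: factor_measure_def space_borel_of topspace_real_topology)

lemma sets_factor: "sets factor_measure = sets (borel_of real_topology)"
  by (simp add: factor_measure_def)

lemma factor_map_space: "factor_map C \<in> space factor_measure"
  by (simp add: factor_map_def space_factor itinerary_bits)

lemma factor_map_act:
  "C \<in> carrier (quot_group G K) \<Longrightarrow> g \<in> carrier G \<Longrightarrow> factor_map (act g C) = factor_act g (factor_map C)"
  by (simp add: factor_map_def factor_act_def itinerary_bits itinerary_act)

lemma factor_map_eq_iff:
  assumes "C \<in> carrier (quot_group G K)" "D \<in> carrier (quot_group G K)"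
  shows "factor_map C = factor_map D \<longleftrightarrow> (\<forall>g\<in>carrier G. act g C \<in> mark \<longleftrightarrow> act g D \<in> mark)"
proof -
  have "factor_map C = factor_map D \<longleftrightarrow> itinerary C = itinerary D"
    unfolding factor_map_def by (rule encode_eq_iff[OF itinerary_bits itinerary_bits])
  also have "\<dots> \<longleftrightarrow> (\<forall>h\<in>carrier G. act (inv\<^bsub>G\<^esub> h) C \<in> mark \<longleftrightarrow> act (inv\<^bsub>G\<^esub> h) D \<in> mark)"
    unfolding itinerary_def by (auto simp: fun_eq_iff restrict_def)
  also have "\<dots> \<longleftrightarrow> (\<forall>g\<in>carrier G. act g C \<in> mark \<longleftrightarrow> act g D \<in> mark)"
    by (metis G.inv_closed G.inv_inv)
  finally show ?thesis .
qed

lemma decode_factor_map: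
  "h \<in> carrier G \<Longrightarrow> decode (factor_map C) h \<longleftrightarrow> act (inv\<^bsub>G\<^esub> h) C \<in> mark"
  unfolding factor_map_def decode_encode[OF itinerary_bits] by (simp add: itinerary_def)

lemma factor_map_measurable': "factor_map \<in> measurable lam (borel_of real_topology)"
proof -
  have "continuous_map (quot_topology G K) (bit_topology (carrier G)) itinerary"
    unfolding bit_topology_def continuous_map_componentwise
  proof (intro conjI ballI)
    show "itinerary ` topspace (quot_topology G K) \<subseteq> extensional (carrier G)"
      by (auto simp: itinerary_def)
    fix h assume h: "h \<in> carrier G"
    define A where "A = {C \<in> carrier (quot_group G K). act (inv\<^bsub>G\<^esub> h) C \<in> mark}"
    define B where "B = carrier (quot_group G K) - A"
    have "A \<in> cylinders"
      using h cylinders_act[OF mark_cylinder] unfolding A_def by blast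
    moreover from this have "B \<in> cylinders" unfolding B_def by (rule cylinders_compl)
    ultimately have o: "openin (quot_topology G K) A" "openin (quot_topology G K) B"
      unfolding cylinders_def using depends_on_open by auto
    show "continuous_map (quot_topology G K) (discrete_topology UNIV) (\<lambda>C. itinerary C h)"
      unfolding continuous_map_def
    proof (intro conjI allI impI)
      fix U :: "bool set"
      have "itinerary x h \<in> U \<longleftrightarrow> x \<in> A \<and> True \<in> U \<or> x \<in> B \<and> False \<in> U"
        if "x \<in> carrier (quot_group G K)" for x
        using h that by (cases "x \<in> A") (simp_all add: itinerary_def A_def B_def)
      moreover have "A \<subseteq> carrier (quot_group G K)" "B \<subseteq> carrier (quot_group G K)"
        by (auto simp: A_def B_def)
      ultimately have "{x \<in> topspace (quot_topology G K). itinerary x h \<in> U} =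
          (if True \<in> U then A else {}) \<union> (if False \<in> U then B else {})"
        unfolding topspace_quot by (auto split: if_splits)
      then show "openin (quot_topology G K) {x \<in> topspace (quot_topology G K). itinerary x h \<in> U}"
        using o by (simp add: openin_Un)
    qed auto
  qed
  then have "continuous_map (quot_topology G K) real_topology (encode \<circ> itinerary)"
    by (rule continuous_map_compose) (rule homeomorphic_imp_continuous_map[OF homeomorphic_encode])
  moreover have "encode \<circ> itinerary = factor_map" by (auto simp: factor_map_def)
  ultimately show ?thesis
    using haar by (intro continuous_map_measurable) (auto simp: haar_prob_measure_def)
qed

lemma factor_map_measurable [measurable]: "factor_map \<in> measurable lam factor_measure"
  using factor_map_measurable' by (simp add: measurable_def sets_factor space_factor space_borel_of topspace_real_topology)

lemma emeasure_factor:
  assumes "A \<in> sets factor_measure"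
  shows "emeasure factor_measure A = emeasure lam {C \<in> carrier (quot_group G K). factor_map C \<in> A}"
proof -
  have "emeasure factor_measure A = emeasure lam (factor_map -` A \<inter> space lam)"
    using assms factor_map_measurable' unfolding factor_measure_def by (intro emeasure_distr) auto
  also have "factor_map -` A \<inter> space lam = {C \<in> carrier (quot_group G K). factor_map C \<in> A}"
    by (auto simp: space_lam)
  finally show ?thesis .
qed

lemma sets_factor_vimage:
  assumes "A \<in> sets factor_measure"
  shows "{C \<in> carrier (quot_group G K). factor_map C \<in> A} \<in> sets lam"
  using measurable_sets[OF factor_map_measurable assms] by (simp add: space_lam vimage_def Int_def conj_commute)

lemma prob_factor: "prob_space factor_measure"
  unfolding factor_measure_def by (rule prob_space_distr[OF factor_map_measurable'])

lemma standard_factor: "standard_prob_space factor_measure"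
proof -
  have hs: "bit_topology (carrier G) homeomorphic_space real_topology"
    using homeomorphic_encode by (rule homeomorphic_map_imp_homeomorphic_space)
  have "completely_metrizable_space real_topology"
    using homeomorphic_completely_metrizable_space[OF hs] completely_metrizable_bit_topology[OF countable_G] by simp
  moreover have "second_countable real_topology"
    using homeomorphic_space_second_countability[OF hs] second_countable_bit_topology[OF countable_G] by simp
  ultimately show ?thesis
    unfolding standard_prob_space_def standard_borel_def using prob_factor sets_factor by blast
qed

lemma coordinate_sets [measurable]:
  assumes "h \<in> carrier G"
  shows "{r \<in> space factor_measure. decode r h} \<in> sets factor_measure"
proof -
  have "openin real_topology {r \<in> encode ` bits. decode r h}"
    unfolding openin_real_topology
  proof
    have "{y \<in> bits. encode y \<in> {r \<in> encode ` bits. decode r h}} = {y \<in> bits. \<forall>f\<in>{h} \<inter> carrier G. y f = True}"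
      using assms by auto
    then show "openin (bit_topology (carrier G)) {y \<in> bits. encode y \<in> {r \<in> encode ` bits. decode r h}}"
      using openin_bit_coordinates[of "{h}" "carrier G" "\<lambda>_. True"] by simp
  qed auto
  then show ?thesis by (simp add: space_factor sets_factor open_in_borel_of)
qed

lemma factor_act_encode [simp]: "y \<in> bits \<Longrightarrow> factor_act g (encode y) = encode (shift G g y)"
  by (simp add: factor_act_def)

lemma factor_act_closed:
  "g \<in> carrier G \<Longrightarrow> r \<in> space factor_measure \<Longrightarrow> factor_act g r \<in> space factor_measure"
  unfolding space_factor by (erule imageE) (simp add: G.shift_in_PiE)

lemma factor_act_one: "r \<in> space factor_measure \<Longrightarrow> factor_act \<one>\<^bsub>G\<^esub> r = r"
  unfolding space_factor by (erule imageE) (simp add: G.shift_one PiE_iff)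

lemma factor_act_act:
  "g \<in> carrier G \<Longrightarrow> h \<in> carrier G \<Longrightarrow> r \<in> space factor_measure \<Longrightarrow>
    factor_act g (factor_act h r) = factor_act (g \<otimes>\<^bsub>G\<^esub> h) r"
  unfolding space_factor by (erule imageE) (simp add: G.shift_in_PiE G.shift_shift)

lemma factor_act_measurable [measurable]:
  assumes "g \<in> carrier G"
  shows "factor_act g \<in> measurable factor_measure factor_measure"
proof -
  have "continuous_map (bit_topology (carrier G)) (bit_topology (carrier G)) (shift G g)"
    unfolding bit_topology_def continuous_map_componentwise
  proof (intro conjI ballI)
    show "shift G g ` topspace (product_topology (\<lambda>_. discrete_topology (UNIV :: bool set)) (carrier G)) \<subseteq> extensional (carrier G)"
      by (auto simp: shift_def)
    fix h assume h: "h \<in> carrier G"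
    then have "continuous_map (product_topology (\<lambda>_. discrete_topology (UNIV :: bool set)) (carrier G))
        (discrete_topology UNIV) (\<lambda>x. x (inv\<^bsub>G\<^esub> g \<otimes>\<^bsub>G\<^esub> h))"
      using assms by (intro continuous_map_product_projection) auto
    then show "continuous_map (product_topology (\<lambda>_. discrete_topology (UNIV :: bool set)) (carrier G))
        (discrete_topology UNIV) (\<lambda>x. shift G g x h)"
      using h by (simp add: G.shift_apply)
  qed
  then have "continuous_map (bit_topology (carrier G)) real_topology (encode \<circ> shift G g)"
    by (rule continuous_map_compose) (rule homeomorphic_imp_continuous_map[OF homeomorphic_encode])
  moreover have "quotient_map (bit_topology (carrier G)) real_topology encode"
    unfolding real_topology_def by (rule quotient_map_quotient_topology)
  moreover have "(encode \<circ> shift G g) y = (factor_act g \<circ> encode) y" if "y \<in> topspace (bit_topology (carrier G))" for y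
    using that by (simp add: factor_act_def topspace_bit_topology)
  ultimately have "continuous_map real_topology real_topology (factor_act g)"
    using continuous_map_eq continuous_compose_quotient_map by blast
  then have "factor_act g \<in> measurable factor_measure (borel_of real_topology)"
    by (rule continuous_map_measurable) (rule sets_factor)
  then show ?thesis by (simp add: measurable_def sets_factor space_factor space_borel_of topspace_real_topology)
qed

lemma emeasure_factor_act:
  assumes g: "g \<in> carrier G" and A: "A \<in> sets factor_measure"
  shows "emeasure factor_measure (factor_act g -` A \<inter> space factor_measure) = emeasure factor_measure A"
proof -
  let ?B = "{C \<in> carrier (quot_group G K). factor_map C \<in> A}"
  have "factor_act g -` A \<inter> space factor_measure \<in> sets factor_measure"
    using g A by (rule measurable_sets[OF factor_act_measurable])
  then have "emeasure factor_measure (factor_act g -` A \<inter> space factor_measure) =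
      emeasure lam {C \<in> carrier (quot_group G K). factor_map C \<in> factor_act g -` A \<inter> space factor_measure}"
    by (rule emeasure_factor)
  also have "{C \<in> carrier (quot_group G K). factor_map C \<in> factor_act g -` A \<inter> space factor_measure} =
      {C \<in> carrier (quot_group G K). act g C \<in> ?B}"
    using g by (auto simp: factor_map_act act_closed factor_map_space)
  also have "emeasure lam \<dots> = emeasure lam ?B"
    using measure_act[OF g sets_factor_vimage[OF A]] by (simp add: emeasure_eq_measure)
  finally show ?thesis using emeasure_factor[OF A] by simp
qed

lemma group_action_factor: "group_action G (space factor_measure) factor_act"
proof -
  have bij: "factor_act g \<in> Bij (space factor_measure)" if g: "g \<in> carrier G" for g
  proof -
    have "bij_betw (factor_act g) (space factor_measure) (space factor_measure)"
      by (rule bij_betw_byWitness[where f' = "factor_act (inv\<^bsub>G\<^esub> g)"])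
        (use g factor_act_closed in \<open>auto simp: factor_act_act factor_act_one\<close>)
    moreover have "factor_act g \<in> extensional (space factor_measure)"
      by (simp add: factor_act_def space_factor)
    ultimately show ?thesis by (simp add: Bij_def)
  qed
  have "factor_act (g \<otimes>\<^bsub>G\<^esub> h) = compose (space factor_measure) (factor_act g) (factor_act h)"
    if "g \<in> carrier G" "h \<in> carrier G" for g h
  proof
    fix r
    show "factor_act (g \<otimes>\<^bsub>G\<^esub> h) r = compose (space factor_measure) (factor_act g) (factor_act h) r"
    proof (cases "r \<in> space factor_measure")
      case True
      then show ?thesis using that by (simp add: compose_def factor_act_act)
    next
      case False
      then show ?thesis by (simp add: compose_def factor_act_def space_factor)
    qed
  qed
  then have "factor_act \<in> hom G (BijGroup (space factor_measure))"
    using bij by (auto simp: hom_def BijGroup_def)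
  then have "group_hom G (BijGroup (space factor_measure)) factor_act"
    unfolding group_hom_def group_hom_axioms_def using G.is_group group_BijGroup by blast
  then show ?thesis by (rule group_action.intro)
qed

text \<open>
  Countably many coordinates separate the points of the factor.
\<close>

lemma eq_sets:
  assumes p: "p \<in> measurable N factor_measure" and q: "q \<in> measurable N factor_measure"
  shows "{x \<in> space N. p x = q x} \<in> sets N"
proof -
  have inj: "r = r'" if r: "r \<in> space factor_measure" "r' \<in> space factor_measure"
    and eq: "\<And>h. h \<in> carrier G \<Longrightarrow> decode r h = decode r' h" for r r'
  proof -
    have "r \<in> encode ` bits" "r' \<in> encode ` bits" using r by (simp_all only: space_factor)
    then obtain y y' where y: "r = encode y" "y \<in> bits" "r' = encode y'" "y' \<in> bits"
      by (elim imageE)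
    then have "y = y'" using eq by (intro PiE_ext[OF y(2,4)]) simp
    then show ?thesis using y by simp
  qed
  have "p x = q x \<longleftrightarrow> (\<forall>h\<in>carrier G. decode (p x) h \<longleftrightarrow> decode (q x) h)" if "x \<in> space N" for x
    using inj[OF measurable_space[OF p that] measurable_space[OF q that]] by metis
  then have "{x \<in> space N. p x = q x} =
      {x \<in> space N. \<forall>h\<in>carrier G. decode (p x) h \<longleftrightarrow> decode (q x) h}"
    by auto
  also have "\<dots> \<in> sets N"
  proof (rule sets.sets_Collect_countable_All'[OF _ countable_G])
    fix h assume h: "h \<in> carrier G"
    have "{x \<in> space N. decode (w x) h} \<in> sets N" if w: "w \<in> measurable N factor_measure" for w
    proof -
      have "{x \<in> space N. decode (w x) h} = w -` {r \<in> space factor_measure. decode r h} \<inter> space N"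
        using measurable_space[OF w] by auto
      then show ?thesis using measurable_sets[OF w coordinate_sets[OF h]] by simp
    qed
    then show "{x \<in> space N. decode (p x) h \<longleftrightarrow> decode (q x) h} \<in> sets N"
      using p q unfolding iff_conv_conj_imp
      by (intro sets.sets_Collect_conj sets.sets_Collect_imp) auto
  qed
  finally show ?thesis .
qed

lemma fixed_null:
  assumes g: "g \<in> carrier G" "g \<noteq> \<one>\<^bsub>G\<^esub>"
  shows "{r \<in> space factor_measure. factor_act g r = r} \<in> null_sets factor_measure"
proof -
  have m: "{r \<in> space factor_measure. factor_act g r = r} \<in> sets factor_measure"
    using g by (intro eq_sets factor_act_measurable measurable_ident_sets refl)
  have "{C \<in> carrier (quot_group G K). factor_map C \<in> {r \<in> space factor_measure. factor_act g r = r}} =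
     {C \<in> carrier (quot_group G K). \<forall>h\<in>carrier G. act h C \<in> mark \<longleftrightarrow> act h (act g C) \<in> mark}"
  proof -
    have "factor_act g (factor_map C) = factor_map C \<longleftrightarrow>
        (\<forall>h\<in>carrier G. act h C \<in> mark \<longleftrightarrow> act h (act g C) \<in> mark)"
      if C: "C \<in> carrier (quot_group G K)" for C
      using factor_map_eq_iff[OF C act_closed[OF C g(1)]] factor_map_act[OF C g(1)] by auto
    then show ?thesis using factor_map_space by auto
  qed
  then show ?thesis
    using m marker_free[OF finite_F F_sub one_F card_F u_G u_notin card_K g] emeasure_factor[OF m]
    by (simp add: null_sets_def)
qed

lemma free_factor: "free_pmp_action G factor_measure factor_act"
proof -
  have "distr factor_measure factor_measure (factor_act g) = factor_measure" if g: "g \<in> carrier G" for g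
    by (rule measure_eqI) (use g emeasure_factor_act in \<open>auto simp: emeasure_distr\<close>)
  then have "pmp_action G factor_measure factor_act"
    unfolding pmp_action_def using standard_factor group_action_factor factor_act_measurable by blast
  moreover have "AE r in factor_measure. stabilizer G factor_act r = {\<one>\<^bsub>G\<^esub>}"
  proof (rule AE_I')
    show "(\<Union>g\<in>carrier G - {\<one>\<^bsub>G\<^esub>}. {r \<in> space factor_measure. factor_act g r = r}) \<in> null_sets factor_measure"
      using countable_G fixed_null by (intro null_sets_UN') auto
    show "{r \<in> space factor_measure. stabilizer G factor_act r \<noteq> {\<one>\<^bsub>G\<^esub>}} \<subseteq>
        (\<Union>g\<in>carrier G - {\<one>\<^bsub>G\<^esub>}. {r \<in> space factor_measure. factor_act g r = r})"
      by (auto simp: stabilizer_def factor_act_one)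
  qed
  ultimately show ?thesis by (simp add: free_pmp_action_def)
qed

lemma factor_act_moves_into:
  assumes U: "U \<in> sets factor_measure" "emeasure factor_measure U > 0"
    and V: "V \<in> sets factor_measure" "emeasure factor_measure V > 0"
  shows "\<exists>g\<in>carrier G. \<exists>r\<in>U. factor_act g r \<in> V"
proof -
  let ?U = "{C \<in> carrier (quot_group G K). factor_map C \<in> U}"
  let ?V = "{C \<in> carrier (quot_group G K). factor_map C \<in> V}"
  have "measure lam ?U > 0" "measure lam ?V > 0"
    using U V by (simp_all add: emeasure_factor emeasure_eq_measure)
  then obtain g where g: "g \<in> carrier G" "measure lam {C \<in> ?U. act g C \<in> ?V} > 0"
    using shift_moves_into[OF sets_factor_vimage[OF U(1)] _ sets_factor_vimage[OF V(1)]] by blast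
  have "{C \<in> ?U. act g C \<in> ?V} \<noteq> {}"
  proof
    assume "{C \<in> ?U. act g C \<in> ?V} = {}"
    with g(2) show False by (simp only: measure_empty)
  qed
  then obtain C where "C \<in> ?U" "act g C \<in> ?V" by blast
  then show ?thesis using g(1) factor_map_act by force
qed

end

section \<open>Graphings determine cosets\<close>

context marked_coset_shift
begin

text \<open>
  Let \<open>Q\<close> be the part of the orbit relation whose pairs, as far as they lie in the orbit of \<open>y\<close>, have the same
  ratio for \<open>C1\<close> and \<open>C2\<close> between the group elements that belong to them. Freeness makes these elements unique,
  and multiplicativity of ratios makes \<open>Q\<close> an equivalence relation. It contains the edges, so it
  contains the relation that they generate, which is the whole orbit relation.
\<close>

lemma graphing_determines_coset:
  assumes X0: "orbit_rel G factor_measure factor_act \<inter> X0 \<times> X0 =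
      smallest_equiv X0 ({(x, f i x) | i x. x \<in> A i} \<inter> X0 \<times> X0)"
    and C: "C1 \<in> carrier (quot_group G K)" "C2 \<in> carrier (quot_group G K)"
    and y: "factor_map C1 = y"
    and orb: "\<And>g. g \<in> carrier G \<Longrightarrow> factor_act g y \<in> X0"
    and X0s: "X0 \<subseteq> space factor_measure"
    and free: "\<And>g. g \<in> carrier G \<Longrightarrow> factor_act g y = y \<Longrightarrow> g = \<one>\<^bsub>G\<^esub>"
    and edge: "\<And>i g a. g \<in> carrier G \<Longrightarrow> a \<in> carrier G \<Longrightarrow> factor_act a y \<in> A i \<Longrightarrow>
      f i (factor_act a y) = factor_act g (factor_act a y) \<Longrightarrow>
      ratio (act a C1) (inv\<^bsub>G\<^esub> g) \<one>\<^bsub>G\<^esub> = ratio (act a C2) (inv\<^bsub>G\<^esub> g) \<one>\<^bsub>G\<^esub>"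
  shows "C1 = C2"
proof -
  let ?R = "orbit_rel G factor_measure factor_act"
  let ?P = "{(x, f i x) | i x. x \<in> A i} \<inter> X0 \<times> X0"
  have ys: "y \<in> space factor_measure" using y factor_map_space by blast
  have free': "a = b" if "a \<in> carrier G" "b \<in> carrier G" "factor_act a y = factor_act b y" for a b
  proof -
    have "factor_act (inv\<^bsub>G\<^esub> a \<otimes>\<^bsub>G\<^esub> b) y = factor_act (inv\<^bsub>G\<^esub> a) (factor_act b y)"
      using that ys by (simp add: factor_act_act)
    also have "\<dots> = factor_act (inv\<^bsub>G\<^esub> a) (factor_act a y)" using that by simp
    also have "\<dots> = y" using that(1,2) ys by (simp add: factor_act_act factor_act_one)
    finally have "inv\<^bsub>G\<^esub> a \<otimes>\<^bsub>G\<^esub> b = \<one>\<^bsub>G\<^esub>"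
      by (rule free[rotated]) (use that in simp)
    then show ?thesis using that by (metis G.inv_closed G.inv_equality G.inv_inv)
  qed
  have R: "(z, w) \<in> ?R \<longleftrightarrow> z \<in> space factor_measure \<and> (\<exists>g\<in>carrier G. w = factor_act g z)" for z w
    by (auto simp: orbit_rel_def orbit_def)
  define same where "same z w \<longleftrightarrow> (\<forall>a\<in>carrier G. \<forall>b\<in>carrier G. z = factor_act a y \<longrightarrow> w = factor_act b y \<longrightarrow>
      ratio C1 (inv\<^bsub>G\<^esub> b) (inv\<^bsub>G\<^esub> a) = ratio C2 (inv\<^bsub>G\<^esub> b) (inv\<^bsub>G\<^esub> a))" for z w
  define Q where "Q = {(z, w) \<in> ?R \<inter> X0 \<times> X0. same z w}"
  have "equiv X0 Q"
  proof (rule equivI)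
    show "Q \<subseteq> X0 \<times> X0" by (auto simp: Q_def)
    show "refl_on X0 Q"
    proof (rule refl_onI)
      fix z assume z: "z \<in> X0"
      then have zs: "z \<in> space factor_measure" using X0s by auto
      have "(z, z) \<in> ?R" unfolding R using zs factor_act_one by (metis G.one_closed)
      moreover have "same z z"
        unfolding same_def
      proof (intro ballI impI)
        fix a b assume ab: "a \<in> carrier G" "b \<in> carrier G" "z = factor_act a y" "z = factor_act b y"
        then have "a = b" using free' by metis
        then show "ratio C1 (inv\<^bsub>G\<^esub> b) (inv\<^bsub>G\<^esub> a) = ratio C2 (inv\<^bsub>G\<^esub> b) (inv\<^bsub>G\<^esub> a)"
          using ab C by (simp add: ratio_refl)
      qed
      ultimately show "(z, z) \<in> Q" using z by (simp add: Q_def)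
    qed
    show "sym Q"
    proof (rule symI)
      fix z w assume zw: "(z, w) \<in> Q"
      then obtain g where g: "g \<in> carrier G" "w = factor_act g z" "z \<in> X0" "w \<in> X0" "same z w"
        by (auto simp: Q_def R)
      have "z = factor_act (inv\<^bsub>G\<^esub> g) w" using g X0s by (auto simp: factor_act_act factor_act_one)
      then have "(w, z) \<in> ?R" unfolding R using g X0s G.inv_closed by blast
      moreover have "same w z"
        unfolding same_def
      proof (intro ballI impI)
        fix a b assume ab: "a \<in> carrier G" "b \<in> carrier G" "w = factor_act a y" "z = factor_act b y"
        then have "ratio C1 (inv\<^bsub>G\<^esub> a) (inv\<^bsub>G\<^esub> b) = ratio C2 (inv\<^bsub>G\<^esub> a) (inv\<^bsub>G\<^esub> b)"
          using g(5) unfolding same_def by blast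
        then show "ratio C1 (inv\<^bsub>G\<^esub> b) (inv\<^bsub>G\<^esub> a) = ratio C2 (inv\<^bsub>G\<^esub> b) (inv\<^bsub>G\<^esub> a)"
          using ab C ratio_sym[of _ "inv\<^bsub>G\<^esub> a" "inv\<^bsub>G\<^esub> b"] by simp
      qed
      ultimately show "(w, z) \<in> Q" using g by (simp add: Q_def)
    qed
    show "trans Q"
    proof (rule transI)
      fix z w v assume "(z, w) \<in> Q" "(w, v) \<in> Q"
      then obtain g h where g: "g \<in> carrier G" "w = factor_act g z" "z \<in> X0" "w \<in> X0" "same z w"
        and h: "h \<in> carrier G" "v = factor_act h w" "v \<in> X0" "same w v"
        by (auto simp: Q_def R)
      have "v = factor_act (h \<otimes>\<^bsub>G\<^esub> g) z" using g h X0s by (auto simp: factor_act_act)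
      then have "(z, v) \<in> ?R" unfolding R using g h X0s G.m_closed by blast
      moreover have "same z v"
        unfolding same_def
      proof (intro ballI impI)
        fix a b assume ab: "a \<in> carrier G" "b \<in> carrier G" "z = factor_act a y" "v = factor_act b y"
        let ?c = "g \<otimes>\<^bsub>G\<^esub> a"
        have c: "?c \<in> carrier G" "w = factor_act ?c y" using g ab ys by (simp_all add: factor_act_act)
        have "ratio C1 (inv\<^bsub>G\<^esub> ?c) (inv\<^bsub>G\<^esub> a) = ratio C2 (inv\<^bsub>G\<^esub> ?c) (inv\<^bsub>G\<^esub> a)"
          using g(5) ab c unfolding same_def by blast
        moreover have "ratio C1 (inv\<^bsub>G\<^esub> b) (inv\<^bsub>G\<^esub> ?c) = ratio C2 (inv\<^bsub>G\<^esub> b) (inv\<^bsub>G\<^esub> ?c)"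
          using h(4) ab c unfolding same_def by blast
        ultimately show "ratio C1 (inv\<^bsub>G\<^esub> b) (inv\<^bsub>G\<^esub> a) = ratio C2 (inv\<^bsub>G\<^esub> b) (inv\<^bsub>G\<^esub> a)"
          using ab c C ratio_trans[of _ "inv\<^bsub>G\<^esub> b" "inv\<^bsub>G\<^esub> ?c" "inv\<^bsub>G\<^esub> a"] by simp
      qed
      ultimately show "(z, v) \<in> Q" using g h by (simp add: Q_def)
    qed
  qed
  moreover have "?P \<subseteq> Q"
  proof
    fix p assume p: "p \<in> ?P"
    then obtain i z where z: "p = (z, f i z)" "z \<in> A i" "z \<in> X0" "f i z \<in> X0" by auto
    have "?P \<subseteq> smallest_equiv X0 ?P" unfolding smallest_equiv_def by blast
    then have "p \<in> ?R" using p X0 by blast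
    then obtain g where g: "g \<in> carrier G" "f i z = factor_act g z" using z R by blast
    have "same z (f i z)"
      unfolding same_def
    proof (intro ballI impI)
      fix a b assume ab: "a \<in> carrier G" "b \<in> carrier G" "z = factor_act a y" "f i z = factor_act b y"
      then have "factor_act b y = factor_act (g \<otimes>\<^bsub>G\<^esub> a) y" using g ys by (simp add: factor_act_act)
      then have b: "b = g \<otimes>\<^bsub>G\<^esub> a" using ab g free' by simp
      have "ratio (act a C1) (inv\<^bsub>G\<^esub> g) \<one>\<^bsub>G\<^esub> = ratio (act a C2) (inv\<^bsub>G\<^esub> g) \<one>\<^bsub>G\<^esub>"
        using g z ab by (intro edge[of g a i]) simp_all
      then show "ratio C1 (inv\<^bsub>G\<^esub> b) (inv\<^bsub>G\<^esub> a) = ratio C2 (inv\<^bsub>G\<^esub> b) (inv\<^bsub>G\<^esub> a)"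
        using ab(1) g C by (simp add: ratio_act b G.inv_mult_group)
    qed
    then show "p \<in> Q" using \<open>p \<in> ?R\<close> z by (simp add: Q_def)
  qed
  ultimately have sub: "?R \<inter> X0 \<times> X0 \<subseteq> Q"
    unfolding X0 smallest_equiv_def by blast
  have "ratio C1 a \<one>\<^bsub>G\<^esub> = ratio C2 a \<one>\<^bsub>G\<^esub>" if a: "a \<in> carrier G" for a
  proof -
    have i: "inv\<^bsub>G\<^esub> a \<in> carrier G" using a by simp
    have "y = factor_act \<one>\<^bsub>G\<^esub> y" using ys factor_act_one by simp
    moreover from this have "y \<in> X0" using orb[OF G.one_closed] by simp
    moreover have "(y, factor_act (inv\<^bsub>G\<^esub> a) y) \<in> ?R" unfolding R using ys i by blast
    ultimately have "same y (factor_act (inv\<^bsub>G\<^esub> a) y)"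
      using sub orb[OF i] by (auto simp: Q_def)
    then have "ratio C1 (inv\<^bsub>G\<^esub> (inv\<^bsub>G\<^esub> a)) (inv\<^bsub>G\<^esub> \<one>\<^bsub>G\<^esub>) = ratio C2 (inv\<^bsub>G\<^esub> (inv\<^bsub>G\<^esub> a)) (inv\<^bsub>G\<^esub> \<one>\<^bsub>G\<^esub>)"
      using i \<open>y = factor_act \<one>\<^bsub>G\<^esub> y\<close> unfolding same_def by (metis G.one_closed)
    then show ?thesis using a by simp
  qed
  then show ?thesis by (rule ratio_ext[OF C G.one_closed])
qed

text \<open>
  Each edge map acts as a group element, which varies with the point. Cut the domain according to the
  first group element in an enumeration that describes the map at a point; the total mass does not grow.
\<close>

lemma graphing_pieces:
  assumes gr: "graphing factor_measure R A f"
  obtains B :: "nat \<Rightarrow> real set" and \<gamma> :: "nat \<Rightarrow> 'g" where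
    "\<And>c. B c \<in> sets factor_measure" "\<And>c. \<gamma> c \<in> carrier G"
    "(\<Sum>c. emeasure factor_measure (B c)) \<le> (\<Sum>i. emeasure factor_measure (A i))"
    "\<And>i z g. z \<in> A i \<Longrightarrow> g \<in> carrier G \<Longrightarrow> f i z = factor_act g z \<Longrightarrow>
      \<exists>c. z \<in> B c \<and> factor_act (\<gamma> c) z = factor_act g z"
proof -
  have Am: "A i \<in> sets factor_measure"
    and fm: "f i \<in> measurable (restrict_space factor_measure (A i)) factor_measure" for i
    using gr by (auto simp: graphing_def borel_partial_bij_def)
  let ?e = "from_nat_into (carrier G)"
  have ne: "carrier G \<noteq> {}" using G.one_closed by blast
  have e: "?e k \<in> carrier G" for k using from_nat_into[OF ne] .
  define eqs where "eqs i k = {z \<in> A i. f i z = factor_act (?e k) z}" for i k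
  define D where "D i k = eqs i k - (\<Union>l<k. eqs i l)" for i k
  have eqm: "eqs i k \<in> sets factor_measure" for i k
  proof -
    have sp: "space (restrict_space factor_measure (A i)) = A i"
      using sets.sets_into_space[OF Am] by (auto simp: space_restrict_space)
    have "{z \<in> space (restrict_space factor_measure (A i)). f i z = factor_act (?e k) z}
        \<in> sets (restrict_space factor_measure (A i))"
      by (intro eq_sets fm measurable_restrict_space1 factor_act_measurable e)
    then have "eqs i k \<in> sets (restrict_space factor_measure (A i))"
      unfolding eqs_def sp .
    then show ?thesis
      using Am sets.sets_into_space[OF Am] by (simp add: sets_restrict_space_iff Int_absorb2)
  qed
  have Dm: "D i k \<in> sets factor_measure" for i k using eqm by (auto simp: D_def)
  have disj: "disjoint_family (D i)" for i
    unfolding disjoint_family_on_def D_def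
  proof (intro ballI impI)
    fix k l :: nat assume "k \<noteq> l"
    then show "(eqs i k - (\<Union>l<k. eqs i l)) \<inter> (eqs i l - (\<Union>k<l. eqs i k)) = {}"
      by (cases "k < l") auto
  qed
  define B where "B c = (case prod_decode c of (i, k) \<Rightarrow> D i k)" for c
  define \<gamma> where "\<gamma> c = ?e (snd (prod_decode c))" for c
  show thesis
  proof (rule that[of B \<gamma>])
    show "B c \<in> sets factor_measure" for c using Dm by (simp add: B_def split: prod.split)
    show "\<gamma> c \<in> carrier G" for c using e by (simp add: \<gamma>_def)
    have "(\<Sum>c. emeasure factor_measure (B c)) =
        (\<Sum>c. (\<lambda>(i, k). emeasure factor_measure (D i k)) (prod_decode c))"
      by (simp add: B_def case_prod_unfold)
    also have "\<dots> = (\<Sum>i. \<Sum>k. emeasure factor_measure (D i k))"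
      by (rule suminf_ennreal_2dimen) simp
    also have "\<dots> = (\<Sum>i. emeasure factor_measure (\<Union>k. D i k))"
      using Dm disj by (intro arg_cong[of _ _ suminf] ext suminf_emeasure) auto
    also have "\<dots> \<le> (\<Sum>i. emeasure factor_measure (A i))"
      using Am by (intro suminf_le emeasure_mono) (auto simp: D_def eqs_def)
    finally show "(\<Sum>c. emeasure factor_measure (B c)) \<le> (\<Sum>i. emeasure factor_measure (A i))" .
    fix i z g assume z: "z \<in> A i" and g: "g \<in> carrier G" and eq: "f i z = factor_act g z"
    obtain k where "?e k = g" using from_nat_into_surj[OF countable_G g] by blast
    then have "z \<in> eqs i k" using z eq by (simp add: eqs_def)
    define k0 where "k0 = (LEAST k. z \<in> eqs i k)"
    have "z \<in> eqs i k0" unfolding k0_def using \<open>z \<in> eqs i k\<close> by (rule LeastI)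
    moreover have "z \<notin> eqs i l" if "l < k0" for l
      using that unfolding k0_def by (rule not_less_Least)
    ultimately have "z \<in> D i k0" by (simp add: D_def)
    moreover have "factor_act (?e k0) z = factor_act g z"
      using \<open>z \<in> eqs i k0\<close> eq by (simp add: eqs_def)
    ultimately show "\<exists>c. z \<in> B c \<and> factor_act (\<gamma> c) z = factor_act g z"
      by (intro exI[of _ "prod_encode (i, k0)"]) (simp add: B_def \<gamma>_def)
  qed
qed

end

section \<open>The generator and its entropy\<close>

context marked_coset_shift
begin

text \<open>
  The generator \<open>\<beta>\<close> vanishes off the marker set; on it, \<open>\<beta>\<close> encodes the \<open>m\<close> ratios along the edges that the
  greedy allocation has moved to the given point. As the marker set, the graphing and the allocation all live on
  the factor, two points with equal \<open>\<beta>\<close>-names have the same allocated edges, so equal ratios are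
  ratios along the same edge.
\<close>

lemma rokhlin_entropy_le_graphing:
  assumes gr: "graphing factor_measure (orbit_rel G factor_measure factor_act) A f"
    and le: "(\<Sum>i. emeasure factor_measure (A i)) \<le> of_nat m * emeasure lam mark"
    and \<delta>: "measure lam mark = \<delta>" "0 < \<delta>" "\<delta> < 1"
  shows "rokhlin_entropy G lam act \<le>
    ennreal (- (1 - \<delta>) * ln (1 - \<delta>) + \<delta> * ln (real (card (carrier K) ^ m) / \<delta>))"
proof -
  let ?M = factor_measure and ?X = "carrier (quot_group G K)"
  interpret FM: prob_space ?M by (rule prob_factor)
  have mark_sets: "mark \<in> sets lam" using mark_cylinder cylinders_sets by blast
  have markX: "mark \<subseteq> ?X" using cylinders_into[OF mark_cylinder] .
  obtain X0 where X0: "conull ?M X0" "orbit_rel G ?M factor_act \<inter> X0 \<times> X0 =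
      smallest_equiv X0 ({(x, f i x) | i x. x \<in> A i} \<inter> X0 \<times> X0)"
    using gr by (auto simp: graphing_def)
  obtain B :: "nat \<Rightarrow> real set" and \<gamma> where B: "\<And>c. B c \<in> sets ?M" and \<gamma>: "\<And>c. \<gamma> c \<in> carrier G"
    and sumB: "(\<Sum>c. emeasure ?M (B c)) \<le> (\<Sum>i. emeasure ?M (A i))"
    and edge: "\<And>i z g. z \<in> A i \<Longrightarrow> g \<in> carrier G \<Longrightarrow> f i z = factor_act g z \<Longrightarrow>
      \<exists>c. z \<in> B c \<and> factor_act (\<gamma> c) z = factor_act g z"
    using graphing_pieces[OF gr] by metis
  define t where "t = from_nat_into (carrier G)"
  have t: "t n \<in> carrier G" for n
    unfolding t_def using from_nat_into[of "carrier G"] G.one_closed by blast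
  define E where "E = {r \<in> space ?M. decode r \<one>\<^bsub>G\<^esub>}"
  have Em: "E \<in> sets ?M" unfolding E_def by (rule coordinate_sets) simp
  have markE: "C \<in> mark \<longleftrightarrow> factor_map C \<in> E" if "C \<in> ?X" for C
    using that decode_factor_map[of "\<one>\<^bsub>G\<^esub>" C] factor_map_space by (simp add: E_def act_one)
  have "{C \<in> ?X. factor_map C \<in> E} = mark"
  proof (intro equalityI subsetI)
    fix C assume "C \<in> {C \<in> ?X. factor_map C \<in> E}"
    then show "C \<in> mark" using markE by simp
  next
    fix C assume C: "C \<in> mark"
    have "C \<in> ?X" using subsetD[OF markX C] .
    then show "C \<in> {C \<in> ?X. factor_map C \<in> E}" using markE C by simp
  qed
  then have "emeasure ?M E = emeasure lam mark" by (simp add: emeasure_factor[OF Em])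
  then have le': "(\<Sum>c. emeasure ?M (B c)) \<le> of_nat m * emeasure ?M E"
    using order_trans[OF sumB le] by simp
  have rec: "\<exists>n. \<exists>x\<in>U. factor_act (t n) x \<in> V"
    if UV: "U \<in> sets ?M" "V \<in> sets ?M" "0 < emeasure ?M U" "0 < emeasure ?M V" for U V
  proof -
    obtain g x where g: "g \<in> carrier G" "x \<in> U" "factor_act g x \<in> V"
      using factor_act_moves_into[OF UV(1,3,2,4)] by blast
    obtain n where "t n = g" unfolding t_def using from_nat_into_surj[OF countable_G g(1)] by blast
    then show ?thesis using g by blast
  qed
  have tinv: "inv\<^bsub>G\<^esub> (t n) \<in> carrier G" for n using t by simp
  have undo: "factor_act (inv\<^bsub>G\<^esub> (t n)) (factor_act (t n) x) = x"
    "factor_act (t n) (factor_act (inv\<^bsub>G\<^esub> (t n)) x) = x" if "x \<in> space ?M" for n x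
    using that t by (simp_all add: factor_act_act factor_act_one)
  obtain P :: "nat \<Rightarrow> real set" and e n j :: "nat \<Rightarrow> nat" where
    P: "\<And>r. P r \<in> sets ?M" "\<And>r. P r \<subseteq> B (e r)"
    and PE: "\<And>r x. x \<in> P r \<Longrightarrow> factor_act (t (n r)) x \<in> E"
    and Pj: "\<And>r x. x \<in> P r \<Longrightarrow> j r < m"
    and Pinj: "\<And>r r' x x'. x \<in> P r \<Longrightarrow> x' \<in> P r' \<Longrightarrow> j r = j r' \<Longrightarrow>
      factor_act (t (n r)) x = factor_act (t (n r')) x' \<Longrightarrow> r = r'"
    and Pnull: "\<And>i. B i - (\<Union>r\<in>{r. e r = i}. P r) \<in> null_sets ?M"
  proof (rule FM.greedy_allocation[of "\<lambda>n. factor_act (t n)" "\<lambda>n. factor_act (inv\<^bsub>G\<^esub> (t n))" B E m,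
        OF factor_act_measurable[OF t] factor_act_measurable[OF tinv] undo
          emeasure_factor_act[OF tinv] rec B Em le'])
    fix P :: "nat \<Rightarrow> real set" and e n j :: "nat \<Rightarrow> nat"
    assume "\<And>r. P r \<in> sets ?M" "\<And>r. P r \<subseteq> B (e r)" "\<And>r x. x \<in> P r \<Longrightarrow> factor_act (t (n r)) x \<in> E"
      "\<And>r x. x \<in> P r \<Longrightarrow> j r < m"
      "\<And>r r' x x'. x \<in> P r \<Longrightarrow> x' \<in> P r' \<Longrightarrow> j r = j r' \<Longrightarrow>
        factor_act (t (n r)) x = factor_act (t (n r')) x' \<Longrightarrow> r = r'"
      "\<And>i. B i - (\<Union>r\<in>{r. e r = i}. P r) \<in> null_sets ?M"
    then show thesis by (rule that)
  qed
  \<comment> \<open>\<open>slot k C r\<close>: slot \<open>k\<close> at the image of \<open>C\<close> was filled in stage \<open>r\<close>, with the edge that \<open>val C r\<close> measures.\<close>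
  define slot where "slot k C r \<longleftrightarrow> j r = k \<and> factor_act (inv\<^bsub>G\<^esub> (t (n r))) (factor_map C) \<in> P r" for k C r
  define val where "val C r = ratio (act (inv\<^bsub>G\<^esub> (t (n r))) C) (inv\<^bsub>G\<^esub> (\<gamma> (e r))) \<one>\<^bsub>G\<^esub>" for C r
  have slot_unique: "r = r'" if "slot k C r" "slot k C r'" for k C r r'
  proof (rule Pinj)
    show "factor_act (inv\<^bsub>G\<^esub> (t (n r))) (factor_map C) \<in> P r"
      "factor_act (inv\<^bsub>G\<^esub> (t (n r'))) (factor_map C) \<in> P r'" "j r = j r'"
      using that by (simp_all add: slot_def)
    show "factor_act (t (n r)) (factor_act (inv\<^bsub>G\<^esub> (t (n r))) (factor_map C)) =
        factor_act (t (n r')) (factor_act (inv\<^bsub>G\<^esub> (t (n r'))) (factor_map C))"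
      using t factor_map_space by (simp add: factor_act_act factor_act_one)
  qed
  \<comment> \<open>An unfilled slot gets the default value \<open>1\<close>.\<close>
  define \<tau> where "\<tau> C k = (if \<exists>r. slot k C r then val C (THE r. slot k C r) else \<one>\<^bsub>K\<^esub>)" for C k
  have \<tau>: "\<tau> C k = val C r" if "slot k C r" for C k r
    using that slot_unique[OF that] unfolding \<tau>_def by (metis the_equality)
  have \<tau>K: "\<tau> C k \<in> carrier K" if "C \<in> ?X" for C k
    using that t \<gamma> by (auto simp: \<tau>_def val_def intro!: ratio_closed act_closed)
  define W where "W = (\<Pi>\<^sub>E k\<in>{..<m}. carrier K)"
  have W: "finite W" "card W = card (carrier K) ^ m"
    using finite_K by (simp_all add: W_def finite_PiE card_PiE)
  obtain code where code: "bij_betw code W {0..<card W}" using ex_bij_betw_finite_nat[OF W(1)] by blast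
  define \<sigma> where "\<sigma> C = (\<lambda>k\<in>{..<m}. \<tau> C k)" for C
  have \<sigma>W: "\<sigma> C \<in> W" if "C \<in> ?X" for C using that \<tau>K by (simp add: \<sigma>_def W_def)
  \<comment> \<open>The successor keeps \<open>0\<close> free for the points off the marker set.\<close>
  define \<beta> where "\<beta> C = (if C \<in> mark then Suc (code (\<sigma> C)) else 0)" for C

  have slot_sets: "{C \<in> space lam. slot k C r} \<in> sets lam" for k r
  proof -
    have "(\<lambda>C. factor_act (inv\<^bsub>G\<^esub> (t (n r))) (factor_map C)) \<in> measurable lam ?M"
      using t by (intro measurable_compose[OF factor_map_measurable factor_act_measurable]) simp
    from measurable_sets[OF this P(1)[of r]]
    have "{C \<in> space lam. factor_act (inv\<^bsub>G\<^esub> (t (n r))) (factor_map C) \<in> P r} \<in> sets lam"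
      by (simp add: vimage_def Int_def conj_commute)
    then show ?thesis
      unfolding slot_def by (intro sets.sets_Collect_conj sets.sets_Collect_const)
  qed
  have val_sets: "{C \<in> space lam. val C r = a} \<in> sets lam" for r a
  proof -
    let ?h = "inv\<^bsub>G\<^esub> (inv\<^bsub>G\<^esub> (t (n r)))"
    let ?b = "?h \<otimes>\<^bsub>G\<^esub> inv\<^bsub>G\<^esub> (\<gamma> (e r))" and ?c = "?h \<otimes>\<^bsub>G\<^esub> \<one>\<^bsub>G\<^esub>"
    have bc: "?b \<in> carrier G" "?c \<in> carrier G" using t \<gamma> by simp_all
    have "{C \<in> ?X. ratio C ?b ?c = a} \<in> sets lam"
    proof (rule depends_on_measurable[of "{?b, ?c}"])
      show "depends_on {?b, ?c} {C \<in> ?X. ratio C ?b ?c = a}"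
      proof (rule depends_onI)
        fix x y assume "x \<in> full" "y \<in> full" "\<And>f. f \<in> {?b, ?c} \<Longrightarrow> x f = y f"
          "coset x \<in> {C \<in> ?X. ratio C ?b ?c = a}"
        moreover from this(3) have "x ?b = y ?b" "x ?c = y ?c" by blast+
        ultimately show "coset y \<in> {C \<in> ?X. ratio C ?b ?c = a}"
          using bc by (simp add: ratio_coset carrier_quot)
      qed auto
    qed simp
    moreover have "{C \<in> space lam. val C r = a} = {C \<in> ?X. ratio C ?b ?c = a}"
      using t \<gamma> by (intro Collect_cong conj_cong) (simp_all add: space_lam val_def ratio_act)
    ultimately show ?thesis by simp
  qed
  have \<tau>_sets: "{C \<in> space lam. \<tau> C k = a} \<in> sets lam" for k a
  proof -
    have "\<tau> C k = a \<longleftrightarrow> (\<exists>r. slot k C r \<and> val C r = a) \<or> (\<forall>r. \<not> slot k C r) \<and> a = \<one>\<^bsub>K\<^esub>" for C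
    proof (cases "\<exists>r. slot k C r")
      case True
      then obtain r where r: "slot k C r" by blast
      then show ?thesis using \<tau>[OF r] slot_unique[OF r] by metis
    next
      case False
      then show ?thesis by (auto simp: \<tau>_def)
    qed
    then have "{C \<in> space lam. \<tau> C k = a} = {C \<in> space lam.
        (\<exists>r. slot k C r \<and> val C r = a) \<or> (\<forall>r. \<not> slot k C r) \<and> a = \<one>\<^bsub>K\<^esub>}" by simp
    also have "\<dots> \<in> sets lam"
      by (intro sets.sets_Collect_disj sets.sets_Collect_conj sets.sets_Collect_countable_Ex
          sets.sets_Collect_countable_All sets.sets_Collect_neg sets.sets_Collect_const slot_sets val_sets)
    finally show ?thesis .
  qed
  have \<sigma>_meas: "\<sigma> \<in> measurable lam (count_space W)"
    unfolding measurable_count_space_eq2[OF W(1)]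
  proof (intro conjI ballI)
    show "\<sigma> \<in> space lam \<rightarrow> W" using \<sigma>W by (simp add: space_lam)
    fix w assume w: "w \<in> W"
    have "\<sigma> C = w \<longleftrightarrow> (\<forall>k\<in>{..<m}. \<tau> C k = w k)" for C
      using w unfolding \<sigma>_def W_def by (auto simp: fun_eq_iff PiE_iff extensional_def restrict_def)
    then have "\<sigma> -` {w} \<inter> space lam = {C \<in> space lam. \<forall>k\<in>{..<m}. \<tau> C k = w k}" by auto
    also have "\<dots> \<in> sets lam" by (intro sets.sets_Collect_finite_All \<tau>_sets) simp
    finally show "\<sigma> -` {w} \<inter> space lam \<in> sets lam" .
  qed
  have \<beta>_meas: "\<beta> \<in> measurable lam (count_space UNIV)"
  proof -
    have "(\<lambda>C. Suc (code (\<sigma> C))) \<in> measurable lam (count_space UNIV)"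
      using measurable_compose[OF \<sigma>_meas, of "\<lambda>w. Suc (code w)" "count_space UNIV"] by simp
    moreover have "{C \<in> space lam. C \<in> mark} = mark" using markX by (auto simp: space_lam)
    ultimately show ?thesis
      unfolding \<beta>_def using mark_sets by (intro measurable_If) auto
  qed

  \<comment> \<open>The good points: the graphing generates there, all edges have been allocated, and stabilizers are trivial.\<close>
  define Y where "Y = {r \<in> X0. (\<forall>c. r \<notin> B c - (\<Union>r\<in>{r. e r = c}. P r)) \<and>
      (\<forall>g\<in>carrier G. factor_act g r = r \<longrightarrow> g = \<one>\<^bsub>G\<^esub>)}"
  have X0': "X0 \<in> sets ?M" "space ?M - X0 \<in> null_sets ?M" "X0 \<subseteq> space ?M"
    using X0(1) sets.sets_into_space[of X0 ?M] by (auto simp: conull_def)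
  have Yc: "space ?M - Y \<in> null_sets ?M"
  proof -
    have "space ?M - Y = (space ?M - X0) \<union> ((\<Union>c. B c - (\<Union>r\<in>{r. e r = c}. P r)) \<union>
        (\<Union>g\<in>carrier G - {\<one>\<^bsub>G\<^esub>}. {r \<in> space ?M. factor_act g r = r}))"
    proof -
      have "B c \<subseteq> space ?M" for c using B sets.sets_into_space by blast
      then show ?thesis using X0'(3) unfolding Y_def by blast
    qed
    also have "\<dots> \<in> null_sets ?M"
      using countable_G
      by (intro null_sets.Un null_sets_UN null_sets_UN' X0' Pnull fixed_null countable_Diff) auto
    finally show ?thesis .
  qed
  have YX0: "Y \<subseteq> X0" by (auto simp: Y_def)
  define X' where "X' = {C \<in> ?X. \<forall>g\<in>carrier G. factor_map (act g C) \<in> Y}"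
  have X'_act: "act g C \<in> X'" if "C \<in> X'" "g \<in> carrier G" for g C
    using that by (auto simp: X'_def act_closed act_act)
  have "conull lam X'"
  proof -
    let ?N = "\<lambda>g. {C \<in> ?X. act g C \<in> {C \<in> ?X. factor_map C \<in> space ?M - Y}}"
    have N0: "{C \<in> ?X. factor_map C \<in> space ?M - Y} \<in> sets lam"
      using Yc by (intro sets_factor_vimage) auto
    have "?N g \<in> null_sets lam" if g: "g \<in> carrier G" for g
    proof -
      have "emeasure lam {C \<in> ?X. factor_map C \<in> space ?M - Y} = 0"
        using emeasure_factor[OF null_setsD2[OF Yc]] null_setsD1[OF Yc] by simp
      then have "emeasure lam (?N g) = 0"
        using measure_act[OF g N0] by (simp only: emeasure_eq_measure)
      then show ?thesis using sets_act[OF g N0] by blast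
    qed
    then have "(\<Union>g\<in>carrier G. ?N g) \<in> null_sets lam" using countable_G by (intro null_sets_UN') auto
    moreover have "space lam - X' = (\<Union>g\<in>carrier G. ?N g)"
      using act_closed factor_map_space by (auto simp: X'_def space_lam)
    ultimately have null: "space lam - X' \<in> null_sets lam" by simp
    have "X' = space lam - (space lam - X')" by (auto simp: X'_def space_lam)
    then have "X' \<in> sets lam" using null by (metis null_setsD2 sets.compl_sets)
    then show ?thesis using null by (simp add: conull_def)
  qed
  moreover have "act g ` X' = X'" if g: "g \<in> carrier G" for g
  proof
    show "act g ` X' \<subseteq> X'" using X'_act g by blast
    show "X' \<subseteq> act g ` X'"
    proof
      fix C assume C: "C \<in> X'"
      then have "C = act g (act (inv\<^bsub>G\<^esub> g) C)" using g by (simp add: X'_def act_act act_one)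
      then show "C \<in> act g ` X'" using X'_act[OF C, of "inv\<^bsub>G\<^esub> g"] g by blast
    qed
  qed
  moreover have "C1 = C2" if C1: "C1 \<in> X'" and C2: "C2 \<in> X'"
    and eq: "\<And>g. g \<in> carrier G \<Longrightarrow> \<beta> (act g C1) = \<beta> (act g C2)" for C1 C2
  proof (rule graphing_determines_coset[OF X0(2)])
    show C: "C1 \<in> ?X" "C2 \<in> ?X" using C1 C2 by (auto simp: X'_def)
    define y where "y = factor_map C1"
    then show "factor_map C1 = y" by simp
    have "act g C1 \<in> mark \<longleftrightarrow> act g C2 \<in> mark" if "g \<in> carrier G" for g
      using eq[OF that] by (simp add: \<beta>_def split: if_splits)
    then have y2: "factor_map C2 = y" using factor_map_eq_iff[OF C] by (simp add: y_def)
    have yY: "factor_act g y \<in> Y" if "g \<in> carrier G" for g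
      using C1 that by (auto simp: X'_def y_def factor_map_act)
    then show "factor_act g y \<in> X0" if "g \<in> carrier G" for g using that YX0 by blast
    show "X0 \<subseteq> space ?M" by (rule X0')
    have ys: "y \<in> space ?M" by (simp add: y_def factor_map_space)
    then have "y \<in> Y" using yY[OF G.one_closed] factor_act_one by simp
    then show "g = \<one>\<^bsub>G\<^esub>" if "g \<in> carrier G" "factor_act g y = y" for g
      using that by (auto simp: Y_def)
    fix i g a
    assume g: "g \<in> carrier G" and a: "a \<in> carrier G" and z: "factor_act a y \<in> A i"
      "f i (factor_act a y) = factor_act g (factor_act a y)"
    let ?z = "factor_act a y"
    obtain c where c: "?z \<in> B c" "factor_act (\<gamma> c) ?z = factor_act g ?z"
      using edge[OF z(1) g z(2)] by blast
    have zs: "?z \<in> space ?M" using factor_act_closed[OF a ys] .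
    have "\<gamma> c = g"
    proof -
      have "factor_act (inv\<^bsub>G\<^esub> g \<otimes>\<^bsub>G\<^esub> \<gamma> c) ?z = factor_act (inv\<^bsub>G\<^esub> g) (factor_act (\<gamma> c) ?z)"
        using g \<gamma> zs by (simp add: factor_act_act)
      also have "\<dots> = ?z" unfolding c(2) using g zs by (simp only: factor_act_act G.inv_closed G.l_inv factor_act_one)
      finally have "inv\<^bsub>G\<^esub> g \<otimes>\<^bsub>G\<^esub> \<gamma> c = \<one>\<^bsub>G\<^esub>"
        using yY[OF a] g \<gamma> unfolding Y_def by blast
      then show ?thesis using g \<gamma> by (metis G.inv_closed G.inv_equality G.inv_inv)
    qed
    have "?z \<in> Y" by (rule yY[OF a])
    then obtain r where r: "e r = c" "?z \<in> P r" using c(1) unfolding Y_def by blast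
    \<comment> \<open>The edge starting at \<open>a y\<close> was allocated to the marked point \<open>?h y\<close>, where both names record its ratio.\<close>
    let ?h = "t (n r) \<otimes>\<^bsub>G\<^esub> a"
    have h: "?h \<in> carrier G" using t a by simp
    have fh: "factor_map (act ?h D) = factor_act (t (n r)) ?z" if "D \<in> ?X" "factor_map D = y" for D
      using that t a ys by (simp add: factor_map_act factor_act_act)
    have slot: "slot (j r) (act ?h D) r" if "D \<in> ?X" "factor_map D = y" for D
      using fh[OF that] t zs r by (simp add: slot_def factor_act_act factor_act_one)
    have mk: "act ?h D \<in> mark" if "D \<in> ?X" "factor_map D = y" for D
      using markE[OF act_closed[OF that(1) h]] fh[OF that] PE[OF r(2)] by simp
    have "act ?h C1 \<in> mark" "act ?h C2 \<in> mark"
      by (rule mk[OF C(1) y_def[symmetric]], rule mk[OF C(2) y2])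
    then have "code (\<sigma> (act ?h C1)) = code (\<sigma> (act ?h C2))" using eq[OF h] by (simp add: \<beta>_def)
    then have "\<sigma> (act ?h C1) = \<sigma> (act ?h C2)"
      by (rule inj_onD[OF bij_betw_imp_inj_on[OF code] _
            \<sigma>W[OF act_closed[OF C(1) h]] \<sigma>W[OF act_closed[OF C(2) h]]])
    then have "\<sigma> (act ?h C1) (j r) = \<sigma> (act ?h C2) (j r)" by simp
    then have "\<tau> (act ?h C1) (j r) = \<tau> (act ?h C2) (j r)" using Pj[OF r(2)] by (simp add: \<sigma>_def)
    then have "val (act ?h C1) r = val (act ?h C2) r"
      using \<tau>[OF slot[OF C(1)]] \<tau>[OF slot[OF C(2) y2]] y_def by simp
    moreover have "act (inv\<^bsub>G\<^esub> (t (n r))) (act ?h D) = act a D" if "D \<in> ?X" for D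
      using that t a by (simp add: act_act flip: G.m_assoc)
    ultimately show "ratio (act a C1) (inv\<^bsub>G\<^esub> g) \<one>\<^bsub>G\<^esub> = ratio (act a C2) (inv\<^bsub>G\<^esub> g) \<one>\<^bsub>G\<^esub>"
      using C by (simp add: val_def r(1) \<open>\<gamma> c = g\<close>)
  qed
  ultimately have gen: "generating G lam act \<beta>"
    unfolding generating_def using \<beta>_meas by (intro conjI exI[of _ X'] ballI impI) blast+

  have "rokhlin_entropy G lam act \<le> cond_entropy lam \<beta> (invariant_sets G lam act)"
    unfolding rokhlin_entropy_def using gen by (intro INF_lower) simp
  also have "\<dots> \<le> shannon_entropy lam \<beta>"
  proof (rule cond_entropy_le_shannon_entropy)
    have "act g ` ?X = ?X" if g: "g \<in> carrier G" for g
    proof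
      show "act g ` ?X \<subseteq> ?X" using act_closed g by blast
      show "?X \<subseteq> act g ` ?X"
      proof
        fix C assume C: "C \<in> ?X"
        then have "C = act g (act (inv\<^bsub>G\<^esub> g) C)" using g by (simp add: act_act act_one)
        then show "C \<in> act g ` ?X" using act_closed[OF C, of "inv\<^bsub>G\<^esub> g"] g by blast
      qed
    qed
    then show "space lam \<in> invariant_sets G lam act"
      by (simp add: invariant_sets_def) (simp add: space_lam)
  qed (rule prob_space_axioms)
  also have "\<dots> \<le> ennreal (- (1 - \<delta>) * ln (1 - \<delta>) + \<delta> * ln (real (card (carrier K) ^ m) / \<delta>))"
  proof (rule shannon_entropy_two_level[OF prob_space_axioms \<beta>_meas])
    show "\<beta> C \<le> card (carrier K) ^ m" if "C \<in> space lam" for C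
    proof -
      have "code (\<sigma> C) \<in> {0..<card W}"
        using code \<sigma>W that by (auto simp: bij_betw_def space_lam)
      then show ?thesis using W by (auto simp: \<beta>_def)
    qed
    show "card (carrier K) ^ m > 0" using card_K_pos by simp
    have "{C \<in> space lam. \<beta> C \<noteq> 0} = mark" using markX by (auto simp: \<beta>_def space_lam)
    then show "measure lam {C \<in> space lam. \<beta> C \<noteq> 0} = \<delta>" using \<delta> by simp
  qed (use \<delta> in auto)
  finally show ?thesis .
qed

lemma cost_factor_le_sup_cost:
  "cost factor_measure (orbit_rel G factor_measure factor_act) \<le> sup_cost G"
  unfolding sup_cost_def using free_factor
  by (intro SUP_upper2[of "(factor_measure, factor_act)"]) auto

end

context coset_shift
begin

text \<open>
  Every further element of \<open>F\<close> divides the bound on the measure by \<open>|K|\<close>.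
\<close>

lemma exists_small_marker:
  assumes d: "d > 0" and K: "card (carrier K) \<ge> 2"
  obtains F u where "marked_coset_shift G K lam F u" "measure lam (marker F u) > 0" "measure lam (marker F u) < d"
proof -
  let ?q = "real (card (carrier K))"
  have "(\<lambda>n. (1 / ?q) ^ n) \<longlonglongrightarrow> 0" using K by (intro LIMSEQ_realpow_zero) auto
  then have "eventually (\<lambda>n. (1 / ?q) ^ n < d) sequentially" using d by (rule order_tendstoD)
  then obtain n where n: "(1 / ?q) ^ n < d" by (auto simp: eventually_sequentially)
  have "infinite (carrier G - {\<one>\<^bsub>G\<^esub>})" using infinite_G by simp
  then obtain F0 where F0: "finite F0" "card F0 = Suc n" "F0 \<subseteq> carrier G - {\<one>\<^bsub>G\<^esub>}"
    using infinite_arbitrarily_large by blast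
  define F where "F = insert \<one>\<^bsub>G\<^esub> F0"
  have "\<one>\<^bsub>G\<^esub> \<notin> F0" using F0 by blast
  then have F: "finite F" "F \<subseteq> carrier G" "\<one>\<^bsub>G\<^esub> \<in> F" "card F = n + 2"
    using F0 by (auto simp: F_def)
  have "\<not> carrier G \<subseteq> F" using infinite_G F(1) finite_subset by blast
  then obtain u where u: "u \<in> carrier G" "u \<notin> F" by blast
  interpret marked_coset_shift G K lam F u by unfold_locales (use F u K in auto)
  have "mark \<noteq> {}" using marker_separates[OF F(1-3) _ u K] F(4) by auto
  then have "measure lam mark \<ge> 1 / ?q ^ card (insert u F)"
    using F u by (intro measure_cylinder_ge marker_depends) auto
  moreover have "1 / ?q ^ card (insert u F) > 0" using K by simp
  ultimately have "measure lam mark > 0" by linarith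
  moreover have "measure lam mark < d"
  proof -
    have "measure lam mark \<le> ?q ^ 2 / ?q ^ Suc (card F)" by (rule measure_marker_le[OF F(1-3) u])
    also have "?q ^ Suc (card F) = ?q ^ 2 * ?q ^ Suc n"
      unfolding F(4) by (simp flip: power_add)
    also have "?q ^ 2 / (?q ^ 2 * ?q ^ Suc n) = (1 / ?q) ^ Suc n" using K by (simp add: power_divide)
    also have "\<dots> \<le> (1 / ?q) ^ n" using K by (intro power_decreasing) auto
    finally show ?thesis using n by linarith
  qed
  ultimately show thesis by (rule that[OF marked_coset_shift_axioms])
qed

text \<open>
  The choice \<open>m = \<lceil>c' / \<delta>\<rceil>\<close> gives the marked points just enough slots for a graphing of cost below \<open>c'\<close>, and
  rounding up adds at most \<open>\<delta> log |K|\<close> to the entropy.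
\<close>

lemma rokhlin_entropy_le_sup_cost:
  assumes K: "card (carrier K) \<ge> 2" and fin: "sup_cost G < \<infinity>"
  shows "rokhlin_entropy G lam act \<le> sup_cost G * ennreal (ln (card (carrier K)))"
proof (rule ennreal_le_epsilon)
  fix \<epsilon> :: real assume \<epsilon>: "\<epsilon> > 0"
  define L where "L = ln (real (card (carrier K)))"
  have L: "L > 0" using K by (simp add: L_def)
  obtain c where c: "sup_cost G = ennreal c" "c \<ge> 0" using fin by (cases "sup_cost G") auto
  \<comment> \<open>Half of \<open>\<epsilon>\<close> pays for a graphing of almost minimal cost, the other half for the overhead.\<close>
  define c' where "c' = c + \<epsilon> / (2 * L)"
  have c': "c' > c" using \<epsilon> L by (simp add: c'_def)
  obtain d where d: "d > 0" "\<And>\<delta>. 0 < \<delta> \<Longrightarrow> \<delta> < d \<Longrightarrow>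
      - (1 - \<delta>) * ln (1 - \<delta>) - \<delta> * ln \<delta> + \<delta> * L < \<epsilon> / 2"
    using small_entropy_overhead[of "\<epsilon> / 2" L] \<epsilon> by auto
  obtain F u where "marked_coset_shift G K lam F u"
    and F: "measure lam (marker F u) > 0" "measure lam (marker F u) < min d 1"
    using exists_small_marker[OF _ K, of "min d 1"] d by auto
  then interpret marked_coset_shift G K lam F u by simp
  define \<delta> where "\<delta> = measure lam mark"
  have \<delta>: "\<delta> > 0" "\<delta> < d" "\<delta> < 1" using F by (auto simp: \<delta>_def)
  define m where "m = nat \<lceil>c' / \<delta>\<rceil>"
  have m: "c' \<le> m * \<delta>" "m * \<delta> \<le> c' + \<delta>"
  proof -
    have "c' / \<delta> \<ge> 0" using c' c \<delta> by simp
    then have "c' / \<delta> \<le> real m" "real m \<le> c' / \<delta> + 1" unfolding m_def by linarith+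
    then show "c' \<le> m * \<delta>" "m * \<delta> \<le> c' + \<delta>" using \<delta> by (simp_all add: field_simps)
  qed
  have "cost factor_measure (orbit_rel G factor_measure factor_act) \<le> ennreal c"
    using cost_factor_le_sup_cost c by simp
  also have "\<dots> < ennreal c'" using c c' by (simp add: ennreal_less_iff)
  finally have "cost factor_measure (orbit_rel G factor_measure factor_act) < ennreal c'" .
  then obtain A f where gr: "graphing factor_measure (orbit_rel G factor_measure factor_act) A f"
    and lt: "(\<Sum>i. emeasure factor_measure (A i)) < ennreal c'"
    unfolding cost_def by (auto simp: INF_less_iff)
  have "ennreal c' \<le> ennreal (m * \<delta>)" using m by (intro ennreal_leI) simp
  also have "\<dots> = of_nat m * emeasure lam mark"
    using \<delta> by (simp add: ennreal_mult emeasure_eq_measure \<delta>_def ennreal_of_nat_eq_real_of_nat)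
  finally have "rokhlin_entropy G lam act \<le>
      ennreal (- (1 - \<delta>) * ln (1 - \<delta>) + \<delta> * ln (real (card (carrier K) ^ m) / \<delta>))"
    using lt \<delta> by (intro rokhlin_entropy_le_graphing[OF gr]) (auto simp: \<delta>_def)
  also have "\<dots> \<le> ennreal (c * L + \<epsilon>)"
  proof (rule ennreal_leI)
    have e: "ln (real (card (carrier K) ^ m) / \<delta>) = m * L - ln \<delta>"
      using \<delta> K by (simp add: ln_div ln_realpow L_def)
    have "\<delta> * ln (real (card (carrier K) ^ m) / \<delta>) = (m * \<delta>) * L - \<delta> * ln \<delta>"
      unfolding e by (simp add: algebra_simps)
    also have "(m * \<delta>) * L \<le> (c' + \<delta>) * L" using m L by (intro mult_right_mono) auto
    also have "(c' + \<delta>) * L = c * L + \<epsilon> / 2 + \<delta> * L" using L by (simp add: c'_def field_simps)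
    finally show "- (1 - \<delta>) * ln (1 - \<delta>) + \<delta> * ln (real (card (carrier K) ^ m) / \<delta>) \<le> c * L + \<epsilon>"
      using d(2)[OF \<delta>(1,2)] by linarith
  qed
  also have "\<dots> = sup_cost G * ennreal L + ennreal \<epsilon>"
    using c L \<epsilon> by (simp add: ennreal_mult ennreal_plus)
  finally show "rokhlin_entropy G lam act \<le> sup_cost G * ennreal (ln (card (carrier K))) + ennreal \<epsilon>"
    by (simp add: L_def)
qed

text \<open>
  The quotient is a single point.
\<close>

lemma rokhlin_entropy_trivial:
  assumes K: "card (carrier K) = 1"
  shows "rokhlin_entropy G lam act = 0"
proof -
  let ?X = "carrier (quot_group G K)"
  have K1: "carrier K = {\<one>\<^bsub>K\<^esub>}" using K K.one_closed by (metis card_1_singletonE singletonD)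
  have single: "C = D" if "C \<in> ?X" "D \<in> ?X" for C D
    using that ratio_closed[OF _ _ G.one_closed] K1 by (intro ratio_ext[OF that G.one_closed]) auto
  have surj: "act g ` ?X = ?X" if g: "g \<in> carrier G" for g
    using single act_closed[OF _ g] by blast
  have "generating G lam act (\<lambda>_. 0)"
    unfolding generating_def
  proof (intro conjI exI[of _ ?X] ballI impI)
    have "?X \<in> sets lam" using sets.top[of lam] by (simp add: space_lam)
    then show "conull lam ?X" by (simp add: conull_def space_lam)
  qed (use surj single in auto)
  then have "rokhlin_entropy G lam act \<le> cond_entropy lam (\<lambda>_. 0) (invariant_sets G lam act)"
    unfolding rokhlin_entropy_def by (intro INF_lower) simp
  also have "\<dots> \<le> shannon_entropy lam (\<lambda>_. 0)"
  proof (rule cond_entropy_le_shannon_entropy[OF prob_space_axioms])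
    show "space lam \<in> invariant_sets G lam act"
      using surj sets.top[of lam] by (simp add: invariant_sets_def space_lam)
  qed
  also have "\<dots> = 0"
  proof -
    have "measure lam ((\<lambda>_. 0 :: nat) -` {k} \<inter> space lam) *
        ln (measure lam ((\<lambda>_. 0 :: nat) -` {k} \<inter> space lam)) = 0" for k
      by (cases "k = 0") (simp_all add: prob_space)
    then show ?thesis by (simp only: shannon_entropy_def) simp
  qed
  finally show ?thesis by simp
qed

end

theorem theorem9p3:
  fixes G :: "('g, 'b) monoid_scheme" and K :: "('k, 'c) monoid_scheme"
    and lam :: "('g \<Rightarrow> 'k) set measure"
  assumes "group G" and "countable (carrier G)" and "infinite (carrier G)"
    and "comm_group K" and "finite (carrier K)"
    and "haar_prob_measure (quot_group G K) (quot_topology G K) lam"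
  shows "rokhlin_entropy G lam (quot_shift G K) \<le> sup_cost G * ennreal (ln (real (order K)))"
proof -
  interpret coset_shift G K lam
    by (intro coset_shift.intro coset_shift_axioms.intro assms)
  show ?thesis
  proof (cases "card (carrier K) = 1")
    case True
    then show ?thesis using rokhlin_entropy_trivial by simp
  next
    case False
    then have K: "card (carrier K) \<ge> 2" using card_K_pos by linarith
    show ?thesis
    proof (cases "sup_cost G = \<infinity>")
      case True
      have "ln (real (order K)) > 0" using K by (simp add: order_def)
      then show ?thesis using True by (simp add: ennreal_mult_eq_top_iff ennreal_top_mult)
    next
      case False
      then show ?thesis using rokhlin_entropy_le_sup_cost[OF K] by (simp add: order_def less_top)
    qed
  qed
qed

end
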